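(* Let $k$ be a fixed positive integer. For each $n$, let $P_n,K_n$ be integers with $1\le K_n\le P_n$, and consider the uniform random intersection graph $G_u(n,P_n,K_n)$. Define the sequence $\alpha_n$ by $$\frac{K_n^2}{P_n}=\frac{\ln n+(k-1)\ln\ln n+\alpha_n}{n}.$$ If $K_n=\Omega\big((\ln n)^3\big)$, then $$\lim_{n\to\infty}\mathbb{P}[G_u(n,P_n,K_n)\text{ is }k\text{-robust}]=\begin{cases}0,&\text{if }\lim_{n\to\infty}\alpha_n=-\infty,\\ 1,&\text{if }\lim_{n\to\infty}\alpha_n=\infty.\end{cases}$$
   Context: Uniform random intersection graph $G_u(n,P_n,K_n)$: node set $\{v_1,\dots,v_n\}$; there is a pool of $P_n$ distinct objects; independently for each node $v_i$, an object set $S_i$ is chosen uniformly at random among all $K_n$-element subsets of the pool. Two distinct nodes $v_i,v_j$ are joined by an undirected edge iff $S_i\cap S_j\neq\emptyset$. A graph with node set $\mathcal{V}$ is $k$-robust if for every pair of non-empty disjoint subsets $A,B\subseteq\mathcal{V}$, at least one of the following holds: (a) some node of $A$ has at least $k$ neighbors in $\mathcal{V}\setminus A$; (b) some node of $B$ has at least $k$ neighbors in $\mathcal{V}\setminus B$. All parameters are sequences indexed by $n$, limits are as $n\to\infty$, $k$ does not depend on $n$, and $o,\omega,O,\Omega$ are standard Landau notation. *)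

theory Defs
  imports "HOL-Probability.Probability" "HOL-Library.Landau_Symbols"
begin

text \<open>A simple graph is a pair of its node set and its set of (two-element) edges.\<close>

type_synonym 'a graph = "'a set \<times> 'a set set"

definition neighbors :: "'a graph \<Rightarrow> 'a \<Rightarrow> 'a set" where
  "neighbors G v = {w \<in> fst G. {v, w} \<in> snd G}"

text \<open>Intended for finite graphs only, since \<open>card\<close> is \<open>0\<close> on infinite sets.\<close>

definition k_robust :: "nat \<Rightarrow> 'a graph \<Rightarrow> bool" where
  "k_robust k G \<longleftrightarrow>
     (\<forall>A B. A \<subseteq> fst G \<and> B \<subseteq> fst G \<and> A \<noteq> {} \<and> B \<noteq> {} \<and> A \<inter> B = {} \<longrightarrow>
        (\<exists>v\<in>A. k \<le> card (neighbors G v \<inter> (fst G - A))) \<or>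
        (\<exists>v\<in>B. k \<le> card (neighbors G v \<inter> (fst G - B))))"

definition intersection_graph :: "'a set \<Rightarrow> ('a \<Rightarrow> 'b set) \<Rightarrow> 'a graph" where
  "intersection_graph V S =
     (V, {{u, v} | u v. u \<in> V \<and> v \<in> V \<and> u \<noteq> v \<and> S u \<inter> S v \<noteq> {}})"

text \<open>
  Node \<open>v\<^sub>i\<close> is represented by \<open>i\<close> and the pool by \<open>{1..P}\<close>.  The product distribution makes
  the object sets independent; its second argument is merely the value taken outside \<open>{1..n}\<close>.
  The distribution is meaningful for \<open>K \<le> P\<close>, where the set of choices is non-empty.
\<close>

definition object_sets_pmf :: "nat \<Rightarrow> nat \<Rightarrow> nat \<Rightarrow> (nat \<Rightarrow> nat set) pmf" where
  "object_sets_pmf n P K =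
     Pi_pmf {1..n} {} (\<lambda>_. pmf_of_set {S. S \<subseteq> {1..P} \<and> card S = K})"

definition uniform_random_intersection_graph :: "nat \<Rightarrow> nat \<Rightarrow> nat \<Rightarrow> nat graph pmf" where
  "uniform_random_intersection_graph n P K =
     map_pmf (intersection_graph {1..n}) (object_sets_pmf n P K)"

end

theory Submission
  imports Defs "HOL-Real_Asymp.Real_Asymp"
begin

text \<open>
  Write \<open>x = K\<^sup>2 / P\<close> and \<open>y = n x\<close>.

  If \<open>\<alpha> \<rightarrow> \<infinity>\<close>, a graph that is not \<open>k\<close>-robust has a non-empty set \<open>A\<close> of at most \<open>n / 2\<close> nodes,
  each with fewer than \<open>k\<close> neighbours outside \<open>A\<close>.  Assume first \<open>y \<le> 4 ln n\<close>.  Then the object sets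
  barely overlap: since \<open>K\<close> dominates \<open>(ln n)\<^sup>2\<close>, Markov's inequality bounds the sum of all pairwise
  intersections by \<open>P / K\<close> with high probability.  Conditionally on the object sets outside \<open>A\<close>, those
  of the nodes of \<open>A\<close> are independent, so \<open>A\<close> is bad with probability at most
  \<open>(C y\<^bsup>k-1\<^esup> exp (- (n - |A|) x))\<^bsup>|A|\<^esup>\<close>, and a union bound over \<open>A\<close> tends to \<open>0\<close>.  A larger \<open>y\<close>
  is reduced to this case by replacing every object by \<open>m\<close> copies: a random \<open>K\<close>-subset of the enlarged
  pool, projected and completed at random, is a random \<open>K\<close>-subset of the original pool, so enlarging
  the pool only destroys edges.

  If \<open>\<alpha> \<rightarrow> -\<infinity>\<close>, the second moment method finds a node of degree less than \<open>k\<close>, which \<open>k\<close>-robustness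
  forbids.
\<close>

subsection \<open>Random subsets of fixed size\<close>

text \<open>The obstacle in both halves is dependence: all edges at a node share its object set.
  Fixing some of the object sets leaves the others independent and uniform, so everything rests on
  how one random K-subset meets given sets. For robustness, meeting few of the given sets means
  missing almost all of their union, which has at least |W| K minus the total overlap elements. The
  threshold P / K for the overlap is balanced from two sides: it costs each node of A only a factor
  e, while Markov's bound for exceeding it is y^2 / K. The latter is under control for y of order ln
  n but need not be small for larger y, which is why the pool has to be enlarged. For the second
  moment, the sets s and t of two nodes are given. If they are disjoint, the two degrees are almost
  independent. If not, the loss is exponential in |s \<inter> t|; but the exponential moment of |s
  \<inter> t| exceeds 1 only by a quantity of order x, so such pairs contribute little.\<close>

definition ksubset_pmf :: "'b set \<Rightarrow> nat \<Rightarrow> 'b set pmf" where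
  "ksubset_pmf \<Omega> K = pmf_of_set {S. S \<subseteq> \<Omega> \<and> card S = K}"

lemma ksubsets_nonempty:
  assumes "finite \<Omega>" "K \<le> card \<Omega>"
  shows "{S. S \<subseteq> \<Omega> \<and> card S = K} \<noteq> {}"
  using obtain_subset_with_card_n[OF assms(2)] by blast

lemma set_ksubset_pmf:
  assumes "finite \<Omega>" "K \<le> card \<Omega>"
  shows "set_pmf (ksubset_pmf \<Omega> K) = {S. S \<subseteq> \<Omega> \<and> card S = K}"
  unfolding ksubset_pmf_def using assms ksubsets_nonempty
  by (intro set_pmf_of_set) auto

lemma prob_ksubset_pmf:
  assumes "finite \<Omega>" "K \<le> card \<Omega>"
  shows "measure_pmf.prob (ksubset_pmf \<Omega> K) H =
           real (card {S. S \<subseteq> \<Omega> \<and> card S = K \<and> S \<in> H}) / real (card \<Omega> choose K)"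
proof -
  have "measure_pmf.prob (ksubset_pmf \<Omega> K) H =
          real (card ({S. S \<subseteq> \<Omega> \<and> card S = K} \<inter> H)) / real (card {S. S \<subseteq> \<Omega> \<and> card S = K})"
    unfolding ksubset_pmf_def
    by (rule measure_pmf_of_set) (use assms ksubsets_nonempty in auto)
  moreover have "{S. S \<subseteq> \<Omega> \<and> card S = K} \<inter> H = {S. S \<subseteq> \<Omega> \<and> card S = K \<and> S \<in> H}"
    by auto
  ultimately show ?thesis
    using n_subsets[OF assms(1), of K] by simp
qed

lemma card_ksubsets_between:
  assumes fin: "finite \<Omega>" and B: "B \<subseteq> \<Omega>" and R: "R \<subseteq> \<Omega>" and BR: "B \<inter> R = {}" and "card B \<le> K"
  shows "card {S. S \<subseteq> \<Omega> \<and> card S = K \<and> B \<subseteq> S \<and> S \<inter> R = {}} =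
           (card \<Omega> - card B - card R) choose (K - card B)"
proof -
  have fB: "finite B" using B fin finite_subset by blast
  have fR: "finite R" using R fin finite_subset by blast
  have "bij_betw (\<lambda>S. S \<union> B) {S. S \<subseteq> \<Omega> - B - R \<and> card S = K - card B}
          {S. S \<subseteq> \<Omega> \<and> card S = K \<and> B \<subseteq> S \<and> S \<inter> R = {}}"
  proof (rule bij_betwI[where g = "\<lambda>S. S - B"])
    show "(\<lambda>S. S \<union> B) \<in> {S. S \<subseteq> \<Omega> - B - R \<and> card S = K - card B} \<rightarrow>
        {S. S \<subseteq> \<Omega> \<and> card S = K \<and> B \<subseteq> S \<and> S \<inter> R = {}}"
    proof safe
      fix S assume S: "S \<subseteq> \<Omega> - B - R" "card S = K - card B"
      have "finite S" using S(1) fin by (meson Diff_subset finite_subset order_trans)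
      then show "card (S \<union> B) = K"
        using S \<open>card B \<le> K\<close> fB by (subst card_Un_disjoint) auto
    qed (use B BR in auto)
    show "(\<lambda>S. S - B) \<in> {S. S \<subseteq> \<Omega> \<and> card S = K \<and> B \<subseteq> S \<and> S \<inter> R = {}} \<rightarrow>
        {S. S \<subseteq> \<Omega> - B - R \<and> card S = K - card B}"
      using fB by (auto simp: card_Diff_subset)
  qed auto
  then have "card {S. S \<subseteq> \<Omega> \<and> card S = K \<and> B \<subseteq> S \<and> S \<inter> R = {}} =
      card {S. S \<subseteq> \<Omega> - B - R \<and> card S = K - card B}"
    by (rule bij_betw_same_card[symmetric])
  also have "\<dots> = card (\<Omega> - B - R) choose (K - card B)"
    using fin by (simp add: n_subsets)
  also have "card (\<Omega> - B - R) = card \<Omega> - card B - card R"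
    using B R BR fB fR by (subst card_Diff_subset, auto simp: card_Diff_subset)
  finally show ?thesis .
qed

text \<open>Shrinking a pool of M + 1 points to M points multiplies the number of L-subsets by 1 - L
  / (M + 1), which is at most exp (- L / N) since M + 1 \<le> N. Removing r points yields r such
  factors.\<close>

lemma binomial_diff_le_exp:
  assumes "r \<le> N"
  shows "real ((N - r) choose L) \<le> real (N choose L) * exp (- (real r * real L / real N))"
  using assms
proof (induction r)
  case (Suc r)
  define M where "M = N - Suc r"
  have M: "N - r = Suc M" and MN: "Suc M \<le> N" using Suc.prems by (auto simp: M_def)
  have IH: "real (Suc M choose L) \<le> real (N choose L) * exp (- (real r * real L / real N))"
    using Suc M by simp
  have step: "real (M choose L) \<le> real (Suc M choose L) * exp (- (real L / real N))"
  proof (cases "L \<le> Suc M")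
    case True
    have "Suc M * (M choose L) = (Suc M - L) * (Suc M choose L)"
      using binomial_absorb_comp[of "Suc M" L] by simp
    then have "real (Suc M) * real (M choose L) = (real (Suc M) - real L) * real (Suc M choose L)"
      using True by (metis of_nat_diff of_nat_mult)
    then have "real (M choose L) = (1 - real L / real (Suc M)) * real (Suc M choose L)"
      by (simp add: field_simps)
    also have "\<dots> \<le> exp (- (real L / real (Suc M))) * real (Suc M choose L)"
      using exp_ge_add_one_self[of "- (real L / real (Suc M))"]
      by (intro mult_right_mono) auto
    also have "\<dots> \<le> exp (- (real L / real N)) * real (Suc M choose L)"
      using MN by (intro mult_right_mono) (auto simp: frac_le)
    finally show ?thesis by (simp add: mult.commute)
  qed (simp add: binomial_eq_0)
  have "real (N - Suc r choose L) \<le> real (Suc M choose L) * exp (- (real L / real N))"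
    using step by (simp add: M_def)
  also have "\<dots> \<le> real (N choose L) * exp (- (real r * real L / real N)) * exp (- (real L / real N))"
    by (intro mult_right_mono IH) auto
  also have "\<dots> = real (N choose L) * exp (- (real (Suc r) * real L / real N))"
    by (simp add: exp_add[symmetric] mult.assoc algebra_simps add_divide_distrib)
  finally show ?case .
qed simp

text \<open>Each further forced element contributes a factor (K - i) / (N - i), and this is at most
  K / N because K \<le> N.\<close>

lemma binomial_diff_both_le:
  assumes "j \<le> K" "K \<le> N"
  shows "real ((N - j) choose (K - j)) \<le> real (N choose K) * (real K / real N) ^ j"
  using assms
proof (induction j)
  case (Suc j)
  define M L where "M = N - Suc j" and "L = K - Suc j"
  have M: "N - j = Suc M" and L: "K - j = Suc L" using Suc.prems by (auto simp: M_def L_def)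
  have "Suc L * (Suc M choose Suc L) = Suc M * (M choose L)"
    using Suc_times_binomial_eq[of M L] by (simp add: ac_simps)
  then have "real (Suc L) * real (Suc M choose Suc L) = real (Suc M) * real (M choose L)"
    by (metis of_nat_mult)
  then have "real (M choose L) = real (Suc M choose Suc L) * (real (Suc L) / real (Suc M))"
    by (simp add: field_simps)
  moreover have "real (Suc L) / real (Suc M) \<le> real K / real N"
  proof -
    have "real j * real K \<le> real j * real N"
      using Suc.prems by (intro mult_left_mono) auto
    then have "real (K - j) * real N \<le> real K * real (N - j)"
      using Suc.prems by (simp add: of_nat_diff algebra_simps)
    then show ?thesis
      unfolding M[symmetric] L[symmetric] using Suc.prems by (simp add: field_simps)
  qed
  ultimately have "real (M choose L) \<le> real (Suc M choose Suc L) * (real K / real N)"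
    by (simp only: mult_left_mono of_nat_0_le_iff)
  also have "\<dots> \<le> (real (N choose K) * (real K / real N) ^ j) * (real K / real N)"
  proof (rule mult_right_mono)
    show "real (Suc M choose Suc L) \<le> real (N choose K) * (real K / real N) ^ j"
      using Suc M L by simp
  qed simp
  finally show ?case
    by (simp add: M_def L_def mult_ac)
qed simp

text \<open>The estimate from which the containment and avoidance bounds are read off: counting
  gives the exact probability (P - j - r choose K - j) / (P choose K), and the two preceding bounds
  factor it. The difference K - card B is taken in the reals, so that card B > K is covered too; the
  event is then impossible.\<close>

lemma prob_ksubset_contains_avoids_le:
  assumes fin: "finite \<Omega>" and K: "K \<le> card \<Omega>" and B: "B \<subseteq> \<Omega>" and R: "R \<subseteq> \<Omega>" and BR: "B \<inter> R = {}"
  shows "measure_pmf.prob (ksubset_pmf \<Omega> K) {S. B \<subseteq> S \<and> S \<inter> R = {}} \<le>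
           (real K / real (card \<Omega>)) ^ card B *
           exp (- (real (card R) * (real K - real (card B)) / real (card \<Omega>)))"
proof (cases "card B \<le> K")
  case True
  let ?P = "card \<Omega>" and ?j = "card B" and ?r = "card R"
  have jr: "?j + ?r \<le> ?P"
    using B R BR fin by (metis Un_least card_Un_disjoint card_mono finite_subset)
  have pos: "real (?P choose K) > 0" using K by (simp add: zero_less_binomial_iff)
  have "real ((?P - ?j - ?r) choose (K - ?j)) \<le>
      real ((?P - ?j) choose (K - ?j)) * exp (- (real ?r * real (K - ?j) / real (?P - ?j)))"
    using jr by (intro binomial_diff_le_exp) auto
  \<comment> \<open>Enlarging the denominator to P weakens the bound. If B is the whole pool, the
    old denominator is 0, but then R is empty and both exponents vanish.\<close>
  also have "\<dots> \<le> real ((?P - ?j) choose (K - ?j)) * exp (- (real ?r * real (K - ?j) / real ?P))"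
  proof (cases "?P - ?j = 0")
    case True
    then have "?r = 0" using jr by simp
    then show ?thesis by (simp del: card_eq_0_iff)
  next
    case False
    then show ?thesis by (intro mult_left_mono) (auto intro!: divide_left_mono)
  qed
  also have "\<dots> \<le> (real (?P choose K) * (real K / real ?P) ^ ?j) * exp (- (real ?r * real (K - ?j) / real ?P))"
    using True K by (intro mult_right_mono binomial_diff_both_le) auto
  finally have "real ((?P - ?j - ?r) choose (K - ?j)) / real (?P choose K) \<le>
      (real K / real ?P) ^ ?j * exp (- (real ?r * real (K - ?j) / real ?P))"
    using pos by (simp add: field_simps)
  moreover have "measure_pmf.prob (ksubset_pmf \<Omega> K) {S. B \<subseteq> S \<and> S \<inter> R = {}} =
      real ((?P - ?j - ?r) choose (K - ?j)) / real (?P choose K)"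
    using card_ksubsets_between[OF fin B R BR True] prob_ksubset_pmf[OF fin K] by simp
  ultimately show ?thesis using True by (simp add: of_nat_diff)
next
  case False
  have "{S. S \<subseteq> \<Omega> \<and> card S = K \<and> (B \<subseteq> S \<and> S \<inter> R = {})} = {}"
    using False card_mono[of S B for S] finite_subset[OF _ fin] by blast
  then have "measure_pmf.prob (ksubset_pmf \<Omega> K) {S. B \<subseteq> S \<and> S \<inter> R = {}} = 0"
    by (simp only: prob_ksubset_pmf[OF fin K] mem_Collect_eq card.empty of_nat_0 div_0)
  then show ?thesis by simp
qed

lemma prob_ksubset_contains_le:
  assumes "finite \<Omega>" "K \<le> card \<Omega>" "B \<subseteq> \<Omega>"
  shows "measure_pmf.prob (ksubset_pmf \<Omega> K) {S. B \<subseteq> S} \<le> (real K / real (card \<Omega>)) ^ card B"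
  using prob_ksubset_contains_avoids_le[of \<Omega> K B "{}"] assms by simp

lemma prob_ksubset_avoids_le:
  assumes "finite \<Omega>" "K \<le> card \<Omega>" "R \<subseteq> \<Omega>"
  shows "measure_pmf.prob (ksubset_pmf \<Omega> K) {S. S \<inter> R = {}} \<le>
           exp (- (real (card R) * real K / real (card \<Omega>)))"
  using prob_ksubset_contains_avoids_le[of \<Omega> K "{}" R] assms by simp

lemma prob_ksubset_avoids:
  assumes "finite \<Omega>" "K \<le> card \<Omega>" "R \<subseteq> \<Omega>"
  shows "measure_pmf.prob (ksubset_pmf \<Omega> K) {S. S \<inter> R = {}} =
           real ((card \<Omega> - card R) choose K) / real (card \<Omega> choose K)"
  using prob_ksubset_pmf[of \<Omega> K "{S. S \<inter> R = {}}"] card_ksubsets_between[of \<Omega> "{}" R K] assms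
  by simp

lemma prob_ksubset_meets_le:
  assumes fin: "finite \<Omega>" and K: "K \<le> card \<Omega>" and R: "R \<subseteq> \<Omega>"
  shows "measure_pmf.prob (ksubset_pmf \<Omega> K) {S. S \<inter> R \<noteq> {}} \<le>
           real (card R) * real K / real (card \<Omega>)"
proof -
  have "finite R" using R fin finite_subset by blast
  have "measure_pmf.prob (ksubset_pmf \<Omega> K) {S. S \<inter> R \<noteq> {}} =
      measure_pmf.prob (ksubset_pmf \<Omega> K) (\<Union>a\<in>R. {S. {a} \<subseteq> S})"
    by (rule arg_cong[where f = "measure_pmf.prob _"]) auto
  also have "\<dots> \<le> (\<Sum>a\<in>R. measure_pmf.prob (ksubset_pmf \<Omega> K) {S. {a} \<subseteq> S})"
    using \<open>finite R\<close> by (intro measure_pmf.finite_measure_subadditive_finite) auto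
  also have "\<dots> \<le> (\<Sum>a\<in>R. real K / real (card \<Omega>))"
    using R prob_ksubset_contains_le[OF fin K, of "{a}" for a] by (intro sum_mono) auto
  finally show ?thesis by simp
qed

section \<open>Conditioning in product distributions\<close>

lemma prob_bind_pmf:
  "measure_pmf.prob (bind_pmf M N) X = measure_pmf.expectation M (\<lambda>s. measure_pmf.prob (N s) X)"
proof -
  have "ennreal (measure_pmf.prob (bind_pmf M N) X) =
      (\<integral>\<^sup>+s. ennreal (measure_pmf.prob (N s) X) \<partial>M)"
    by (simp add: measure_pmf.emeasure_eq_measure[symmetric])
  also have "\<dots> = ennreal (measure_pmf.expectation M (\<lambda>s. measure_pmf.prob (N s) X))"
    by (intro nn_integral_eq_integral measure_pmf.integrable_const_bound[where B = 1]) auto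
  finally show ?thesis by (simp add: integral_nonneg_AE)
qed

lemma prob_Pi_pmf_insert:
  assumes "finite W" "v \<notin> W"
  shows "measure_pmf.prob (Pi_pmf (insert v W) d p) X =
           measure_pmf.expectation (p v) (\<lambda>s. measure_pmf.prob (Pi_pmf W d p) {f. f(v := s) \<in> X})"
proof -
  have "Pi_pmf (insert v W) d p = bind_pmf (p v) (\<lambda>s. map_pmf (\<lambda>f. f(v := s)) (Pi_pmf W d p))"
    using assms by (simp add: Pi_pmf_insert' map_pmf_def)
  then show ?thesis by (simp add: prob_bind_pmf vimage_def)
qed

lemma prob_Pi_pmf_union:
  assumes "finite A" "finite W" "A \<inter> W = {}"
  shows "measure_pmf.prob (Pi_pmf (A \<union> W) d p) X =
           measure_pmf.expectation (Pi_pmf W d p)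
             (\<lambda>g. measure_pmf.prob (Pi_pmf A d p) {f. (\<lambda>v. if v \<in> A then f v else g v) \<in> X})"
proof -
  have "Pi_pmf (A \<union> W) d p =
      bind_pmf (Pi_pmf W d p) (\<lambda>g. map_pmf (\<lambda>f v. if v \<in> A then f v else g v) (Pi_pmf A d p))"
    unfolding Pi_pmf_union[OF assms] pair_pmf_def
    by (subst bind_commute_pmf) (simp add: map_pmf_def bind_assoc_pmf bind_return_pmf)
  then show ?thesis by (simp add: prob_bind_pmf vimage_def)
qed

lemma expectation_pmf_le:
  fixes f :: "'a \<Rightarrow> real"
  assumes "\<And>s. s \<in> set_pmf M \<Longrightarrow> f s \<le> c" "\<And>s. s \<in> set_pmf M \<Longrightarrow> 0 \<le> f s"
  shows "measure_pmf.expectation M f \<le> c"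
proof -
  have "integrable M f"
    by (rule measure_pmf.integrable_const_bound[where B = c]) (auto intro!: AE_pmfI simp: assms)
  then have "measure_pmf.expectation M f \<le> measure_pmf.expectation M (\<lambda>_. c)"
    by (intro integral_mono_AE) (auto intro!: AE_pmfI assms)
  then show ?thesis by simp
qed

subsection \<open>Nodes with few neighbours outside a set\<close>

lemma sum_subsets_by_card:
  fixes g :: "nat \<Rightarrow> real"
  assumes "finite W"
  shows "(\<Sum>J | J \<subseteq> W \<and> card J < k. g (card J)) = (\<Sum>j<k. real (card W choose j) * g j)"
proof -
  have "(\<Sum>J | J \<subseteq> W \<and> card J < k. g (card J)) =
      (\<Sum>j<k. \<Sum>J | J \<in> {J. J \<subseteq> W \<and> card J < k} \<and> card J = j. g (card J))"
    using assms by (intro sum.group[symmetric]) auto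
  also have "\<dots> = (\<Sum>j<k. \<Sum>J | J \<subseteq> W \<and> card J = j. g j)"
    by (intro sum.cong) auto
  also have "\<dots> = (\<Sum>j<k. real (card W choose j) * g j)"
    using n_subsets[OF assms] by simp
  finally show ?thesis .
qed

text \<open>Each new set keeps only the points outside the union of the earlier ones, so
  disjointness is gained without losing any point of the union.\<close>

lemma ex_disjoint_shrinking:
  assumes "finite W"
  shows "\<exists>F'. (\<forall>w\<in>W. F' w \<subseteq> F w) \<and> disjoint_family_on F' W \<and> (\<Union>w\<in>W. F' w) = (\<Union>w\<in>W. F w)"
  using assms
proof induction
  case (insert w W)
  then obtain F' where F': "\<forall>w\<in>W. F' w \<subseteq> F w" "disjoint_family_on F' W"
    "(\<Union>w\<in>W. F' w) = (\<Union>w\<in>W. F w)" by blast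
  let ?G = "F'(w := F w - (\<Union>w\<in>W. F w))"
  have eq: "?G v = F' v" if "v \<in> W" for v using that insert by auto
  have "disjoint_family_on ?G (insert w W)"
    using F' insert.hyps(2) eq unfolding disjoint_family_on_def by auto
  moreover have "\<forall>v\<in>insert w W. ?G v \<subseteq> F v" using F' eq by auto
  moreover have "(\<Union>v\<in>insert w W. ?G v) = (\<Union>v\<in>insert w W. F v)"
  proof -
    have "(\<Union>v\<in>insert w W. ?G v) = ?G w \<union> (\<Union>v\<in>W. ?G v)" by (rule UN_insert)
    also have "(\<Union>v\<in>W. ?G v) = (\<Union>v\<in>W. F' v)" using eq by (intro SUP_cong) auto
    finally show ?thesis using F'(3) by auto
  qed
  ultimately show ?case by blast
qed (simp add: disjoint_family_on_def)

text \<open>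
  Shrinking the sets to disjoint ones can only decrease the number of sets that are met, and for
  disjoint sets the event splits according to which of them are met and in which element.
\<close>

lemma prob_ksubset_meets_few_le:
  assumes fin: "finite \<Omega>" and K: "K \<le> card \<Omega>" and W: "finite W"
    and F: "\<And>w. w \<in> W \<Longrightarrow> F w \<subseteq> \<Omega>" "\<And>w. w \<in> W \<Longrightarrow> card (F w) \<le> K"
    and k: "k \<le> K" and U: "u \<le> real (card (\<Union>w\<in>W. F w))"
  shows "measure_pmf.prob (ksubset_pmf \<Omega> K) {S. card {w \<in> W. S \<inter> F w \<noteq> {}} < k} \<le>
           (\<Sum>j<k. real (card W choose j) *
              ((real K ^ 2 / real (card \<Omega>)) ^ j *
               exp (- ((u - real j * real K) * (real K - real j) / real (card \<Omega>)))))"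
proof -
  let ?Q = "ksubset_pmf \<Omega> K" and ?P = "real (card \<Omega>)"
  from ex_disjoint_shrinking[OF W, of F] obtain F' where "\<forall>w\<in>W. F' w \<subseteq> F w"
    and F'23: "disjoint_family_on F' W" "(\<Union>w\<in>W. F' w) = (\<Union>w\<in>W. F w)"
    by (elim exE conjE)
  then have F': "\<And>w. w \<in> W \<Longrightarrow> F' w \<subseteq> F w" by simp
  have F'\<Omega>: "F' w \<subseteq> \<Omega>" if "w \<in> W" for w using F(1)[OF that] F'[OF that] by auto
  have finF: "finite (F w)" if "w \<in> W" for w using F(1)[OF that] fin finite_subset by blast
  have finF': "finite (F' w)" if "w \<in> W" for w using F'\<Omega>[OF that] fin finite_subset by blast
  have cardF': "card (F' w) \<le> K" if "w \<in> W" for w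
    using card_mono[OF finF[OF that] F'[OF that]] F(2)[OF that] by simp
  define R where "R J = (\<Union>w\<in>W - J. F' w)" for J
  define g where "g j = (real K ^ 2 / ?P) ^ j * exp (- ((u - real j * real K) * (real K - real j) / ?P))" for j :: nat
  have R\<Omega>: "R J \<subseteq> \<Omega>" for J using F'\<Omega> by (auto simp: R_def)
  \<comment> \<open>Leaving out the sets indexed by J removes at most K points for each of them from
    the union.\<close>
  have cardR: "u - real (card J) * real K \<le> real (card (R J))" if J: "J \<subseteq> W" for J
  proof -
    have "(\<Union>w\<in>W. F w) = R J \<union> (\<Union>w\<in>J. F' w)"
      using J by (subst F'23(2)[symmetric]) (auto simp: R_def)
    then have "card (\<Union>w\<in>W. F w) \<le> card (R J) + card (\<Union>w\<in>J. F' w)"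
      by (simp only: card_Un_le)
    also have "card (\<Union>w\<in>J. F' w) \<le> (\<Sum>w\<in>J. card (F' w))"
      using J W finite_subset by (intro card_UN_le) auto
    also have "\<dots> \<le> (\<Sum>w\<in>J. K)" using cardF' J by (intro sum_mono) auto
    finally have "card (\<Union>w\<in>W. F w) \<le> card (R J) + card J * K" by simp
    then have "real (card (\<Union>w\<in>W. F w)) \<le> real (card (R J)) + real (card J) * real K"
      by (metis of_nat_add of_nat_le_iff of_nat_mult)
    then show ?thesis using U by linarith
  qed
  have pJ: "measure_pmf.prob ?Q {S. (\<forall>w\<in>J. S \<inter> F' w \<noteq> {}) \<and> S \<inter> R J = {}} \<le> g (card J)"
    if J: "J \<subseteq> W" "card J < k" for J
  proof -
    have finJ: "finite J" using J W finite_subset by blast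
    have "measure_pmf.prob ?Q {S. (\<forall>w\<in>J. S \<inter> F' w \<noteq> {}) \<and> S \<inter> R J = {}} \<le>
        measure_pmf.prob ?Q (\<Union>c\<in>PiE J F'. {S. c ` J \<subseteq> S \<and> S \<inter> R J = {}})"
    proof (rule measure_pmf.finite_measure_mono)
      show "{S. (\<forall>w\<in>J. S \<inter> F' w \<noteq> {}) \<and> S \<inter> R J = {}} \<subseteq>
          (\<Union>c\<in>PiE J F'. {S. c ` J \<subseteq> S \<and> S \<inter> R J = {}})"
      proof safe
        fix S assume S: "\<forall>w\<in>J. S \<inter> F' w \<noteq> {}" "S \<inter> R J = {}"
        define c where "c = restrict (\<lambda>w. SOME a. a \<in> S \<inter> F' w) J"
        have c: "c w \<in> S \<inter> F' w" if "w \<in> J" for w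
          using S(1) that some_in_eq[of "S \<inter> F' w"] by (auto simp: c_def)
        then have "c \<in> PiE J F'" by (auto simp: c_def)
        moreover have "c ` J \<subseteq> S" using c by auto
        ultimately show "S \<in> (\<Union>c\<in>PiE J F'. {S. c ` J \<subseteq> S \<and> S \<inter> R J = {}})"
          using S(2) by blast
      qed
    qed simp
    also have "\<dots> \<le> (\<Sum>c\<in>PiE J F'. measure_pmf.prob ?Q {S. c ` J \<subseteq> S \<and> S \<inter> R J = {}})"
      using finJ J finF' by (intro measure_pmf.finite_measure_subadditive_finite finite_PiE) auto
    also have "\<dots> \<le> (\<Sum>c\<in>PiE J F'. (real K / ?P) ^ card J *
        exp (- ((u - real (card J) * real K) * (real K - real (card J)) / ?P)))"
    proof (rule sum_mono)
      fix c assume c: "c \<in> PiE J F'"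
      have cw: "c w \<in> F' w" if "w \<in> J" for w using c that by auto
      \<comment> \<open>Disjointness makes the chosen elements distinct, so the full power card J of
        K / P is gained.\<close>
      have "inj_on c J"
      proof (rule inj_onI, rule ccontr)
        fix v w assume vw: "v \<in> J" "w \<in> J" "c v = c w" "v \<noteq> w"
        then have "F' v \<inter> F' w = {}" using F'23(1) J by (auto simp: disjoint_family_on_def)
        then show False using vw cw[OF vw(1)] cw[OF vw(2)] by auto
      qed
      then have card: "card (c ` J) = card J" by (rule card_image)
      have disj: "c ` J \<inter> R J = {}"
      proof (rule ccontr)
        assume "c ` J \<inter> R J \<noteq> {}"
        then obtain v w where vw: "v \<in> J" "w \<in> W - J" "c v \<in> F' w" by (auto simp: R_def)
        then have "v \<in> W" "w \<in> W" "v \<noteq> w" using J by auto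
        then have "F' v \<inter> F' w = {}" using F'23(1) unfolding disjoint_family_on_def by blast
        then show False using vw cw[OF vw(1)] by auto
      qed
      have "measure_pmf.prob ?Q {S. c ` J \<subseteq> S \<and> S \<inter> R J = {}} \<le>
          (real K / ?P) ^ card J * exp (- (real (card (R J)) * (real K - real (card J)) / ?P))"
      proof -
        have "c ` J \<subseteq> \<Omega>" using cw J F'\<Omega> by blast
        from prob_ksubset_contains_avoids_le[OF fin K this R\<Omega> disj] show ?thesis
          by (simp only: card)
      qed
      \<comment> \<open>From card J < k \<le> K the factor K - card J is nonnegative, so the lower
        bound on \<open>card (R J)\<close> may be inserted.\<close>
      also have "\<dots> \<le> (real K / ?P) ^ card J *
          exp (- ((u - real (card J) * real K) * (real K - real (card J)) / ?P))"
        using cardR[OF J(1)] J(2) k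
        by (intro mult_left_mono) (auto intro!: divide_right_mono mult_right_mono)
      finally show "measure_pmf.prob ?Q {S. c ` J \<subseteq> S \<and> S \<inter> R J = {}} \<le>
          (real K / ?P) ^ card J *
          exp (- ((u - real (card J) * real K) * (real K - real (card J)) / ?P))" .
    qed
    also have "\<dots> = real (card (PiE J F')) * ((real K / ?P) ^ card J *
        exp (- ((u - real (card J) * real K) * (real K - real (card J)) / ?P)))"
      by simp
    \<comment> \<open>There are at most K choices for each index in J; together with (K / P)^card J
      they form the power of K^2 / P in \<open>g\<close>.\<close>
    also have "\<dots> \<le> real K ^ card J * ((real K / ?P) ^ card J *
        exp (- ((u - real (card J) * real K) * (real K - real (card J)) / ?P)))"
    proof (rule mult_right_mono)
      have "card (PiE J F') = (\<Prod>w\<in>J. card (F' w))" using finJ by (simp add: card_PiE)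
      also have "\<dots> \<le> (\<Prod>w\<in>J. K)" using J cardF' by (intro prod_mono) auto
      finally have "card (PiE J F') \<le> K ^ card J" by simp
      then show "real (card (PiE J F')) \<le> real K ^ card J" by (metis of_nat_le_iff of_nat_power)
    qed simp
    also have "\<dots> = g (card J)"
      by (simp add: g_def power_divide power_mult_distrib power2_eq_square)
    finally show ?thesis .
  qed
  have "measure_pmf.prob ?Q {S. card {w \<in> W. S \<inter> F w \<noteq> {}} < k} \<le>
      measure_pmf.prob ?Q (\<Union>J\<in>{J. J \<subseteq> W \<and> card J < k}. {S. (\<forall>w\<in>J. S \<inter> F' w \<noteq> {}) \<and> S \<inter> R J = {}})"
  proof (rule measure_pmf.finite_measure_mono)
    show "{S. card {w \<in> W. S \<inter> F w \<noteq> {}} < k} \<subseteq>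
        (\<Union>J\<in>{J. J \<subseteq> W \<and> card J < k}. {S. (\<forall>w\<in>J. S \<inter> F' w \<noteq> {}) \<and> S \<inter> R J = {}})"
    proof
      fix S assume "S \<in> {S. card {w \<in> W. S \<inter> F w \<noteq> {}} < k}"
      then have S: "card {w \<in> W. S \<inter> F w \<noteq> {}} < k" by simp
      define J where "J = {w \<in> W. S \<inter> F' w \<noteq> {}}"
      have "J \<subseteq> {w \<in> W. S \<inter> F w \<noteq> {}}" using F' by (auto simp: J_def)
      then have "card J < k" using S W card_mono[of "{w \<in> W. S \<inter> F w \<noteq> {}}" J] by simp
      moreover have "J \<subseteq> W" "\<forall>w\<in>J. S \<inter> F' w \<noteq> {}" "S \<inter> R J = {}"
        by (auto simp: J_def R_def)
      ultimately show "S \<in> (\<Union>J\<in>{J. J \<subseteq> W \<and> card J < k}.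
          {S. (\<forall>w\<in>J. S \<inter> F' w \<noteq> {}) \<and> S \<inter> R J = {}})" by blast
    qed
  qed simp
  also have "\<dots> \<le> (\<Sum>J | J \<subseteq> W \<and> card J < k.
      measure_pmf.prob ?Q {S. (\<forall>w\<in>J. S \<inter> F' w \<noteq> {}) \<and> S \<inter> R J = {}})"
    using W by (intro measure_pmf.finite_measure_subadditive_finite) auto
  also have "\<dots> \<le> (\<Sum>J | J \<subseteq> W \<and> card J < k. g (card J))"
    using pJ by (intro sum_mono) auto
  also have "\<dots> = (\<Sum>j<k. real (card W choose j) * g j)"
    by (rule sum_subsets_by_card[OF W])
  finally show ?thesis unfolding g_def .
qed

section \<open>Total overlap of the object sets\<close>

definition overlap :: "'b set \<Rightarrow> 'a set \<Rightarrow> ('a \<Rightarrow> 'b set) \<Rightarrow> real" where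
  "overlap \<Omega> V f = (\<Sum>(i, j) \<in> {(i, j). i \<in> V \<and> j \<in> V \<and> i \<noteq> j}. real (card (\<Omega> \<inter> f i \<inter> f j)))"

lemma finite_distinct_pairs: "finite V \<Longrightarrow> finite {(i, j). i \<in> V \<and> j \<in> V \<and> i \<noteq> j}"
  by (rule finite_subset[of _ "V \<times> V"]) auto

lemma overlap_mono:
  assumes "finite V" "W \<subseteq> V"
  shows "overlap \<Omega> W f \<le> overlap \<Omega> V f"
  unfolding overlap_def using assms
  by (intro sum_mono2 finite_distinct_pairs) auto

lemma overlap_cong:
  assumes "\<And>w. w \<in> W \<Longrightarrow> f w = g w"
  shows "overlap \<Omega> W f = overlap \<Omega> W g"
  unfolding overlap_def using assms by (intro sum.cong) auto

text \<open>A Bonferroni inequality. Since \<open>overlap\<close> runs over ordered pairs, every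
  intersection is counted twice; this only weakens the bound and spares an ordering of the
  nodes.\<close>

lemma card_UN_ge_overlap:
  assumes "finite \<Omega>" "finite W" "\<And>w. w \<in> W \<Longrightarrow> f w \<subseteq> \<Omega> \<and> card (f w) = K"
  shows "real (card W) * real K - overlap \<Omega> W f \<le> real (card (\<Union>w\<in>W. f w))"
  using assms(2,3)
proof (induction W)
  case (insert w W)
  let ?D = "\<lambda>V. {(i, j). i \<in> V \<and> j \<in> V \<and> i \<noteq> j}" and ?U = "\<Union>w\<in>W. f w"
  have fin: "finite (f v)" if "v \<in> insert w W" for v
    using insert.prems[OF that] assms(1) finite_subset by blast
  have IH: "real (card W) * real K - overlap \<Omega> W f \<le> real (card ?U)"
    using insert by auto
  have "overlap \<Omega> W f + (\<Sum>j\<in>W. real (card (f w \<inter> f j))) =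
      (\<Sum>(i, j)\<in>?D W. real (card (\<Omega> \<inter> f i \<inter> f j))) + (\<Sum>(i, j)\<in>Pair w ` W. real (card (\<Omega> \<inter> f i \<inter> f j)))"
  proof -
    have "\<Omega> \<inter> f w = f w" using insert.prems by auto
    then show ?thesis by (simp add: overlap_def sum.reindex inj_on_def)
  qed
  also have "\<dots> = (\<Sum>(i, j)\<in>?D W \<union> Pair w ` W. real (card (\<Omega> \<inter> f i \<inter> f j)))"
    using insert.hyps by (intro sum.union_disjoint[symmetric] finite_distinct_pairs) auto
  \<comment> \<open>Of the new pairs only (w, j) are used; the mirrored pairs (j, w) are
    dropped.\<close>
  also have "\<dots> \<le> overlap \<Omega> (insert w W) f"
    unfolding overlap_def using insert.hyps by (intro sum_mono2 finite_distinct_pairs) auto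
  finally have ov: "overlap \<Omega> W f + (\<Sum>j\<in>W. real (card (f w \<inter> f j))) \<le> overlap \<Omega> (insert w W) f" .
  have "card (f w \<inter> ?U) = card (\<Union>j\<in>W. f w \<inter> f j)" by (rule arg_cong[where f = card]) auto
  also have "\<dots> \<le> (\<Sum>j\<in>W. card (f w \<inter> f j))" using insert.hyps by (intro card_UN_le) auto
  finally have "real (card (f w \<inter> ?U)) \<le> (\<Sum>j\<in>W. real (card (f w \<inter> f j)))"
    by (metis of_nat_le_iff of_nat_sum)
  moreover have "card (f w) + card ?U = card (f w \<union> ?U) + card (f w \<inter> ?U)"
    using fin insert.hyps by (intro card_Un_Int) auto
  moreover have "card (f w) = K" using insert.prems by auto
  ultimately have "real K + real (card ?U) \<le> real (card (f w \<union> ?U)) + (\<Sum>j\<in>W. real (card (f w \<inter> f j)))"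
    by linarith
  then show ?case using IH ov insert.hyps by (simp add: algebra_simps)
qed (simp add: overlap_def)

lemma finite_set_Pi_ksubset:
  assumes "finite V" "finite \<Omega>" "K \<le> card \<Omega>"
  shows "finite (set_pmf (Pi_pmf V d (\<lambda>_. ksubset_pmf \<Omega> K)))"
  using assms by (subst set_Pi_pmf) (auto intro!: finite_PiE_dflt simp: set_ksubset_pmf)

lemma set_Pi_ksubsetD:
  assumes "finite V" "finite \<Omega>" "K \<le> card \<Omega>" "f \<in> set_pmf (Pi_pmf V d (\<lambda>_. ksubset_pmf \<Omega> K))" "v \<in> V"
  shows "f v \<subseteq> \<Omega> \<and> card (f v) = K"
  using assms by (auto simp: set_Pi_pmf PiE_dflt_def set_ksubset_pmf)

text \<open>By linearity: a given object lies in both sets of a given pair with probability at most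
  (K / P)^2, and there are P objects.\<close>

lemma expectation_overlap_le:
  assumes V: "finite V" and fin: "finite \<Omega>" and K: "K \<le> card \<Omega>"
  shows "measure_pmf.expectation (Pi_pmf V d (\<lambda>_. ksubset_pmf \<Omega> K)) (overlap \<Omega> V) \<le>
           real (card V) ^ 2 * (real K ^ 2 / real (card \<Omega>))"
proof -
  let ?M = "Pi_pmf V d (\<lambda>_. ksubset_pmf \<Omega> K)" and ?P = "real (card \<Omega>)"
  let ?D = "{(i, j). i \<in> V \<and> j \<in> V \<and> i \<noteq> j}"
  note fs = finite_set_Pi_ksubset[OF V fin K, of d]
  have int: "integrable ?M h" for h :: "_ \<Rightarrow> real"
    by (rule integrable_measure_pmf_finite[OF fs])
  have pij: "measure_pmf.prob ?M {f. a \<in> f i \<and> a \<in> f j} \<le> (real K / ?P)\<^sup>2"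
    if "i \<in> V" "j \<in> V" "i \<noteq> j" "a \<in> \<Omega>" for i j a
  proof -
    let ?B = "\<lambda>v. if v = i \<or> v = j then {S. a \<in> S} else UNIV"
    have "{f. a \<in> f i \<and> a \<in> f j} = Pi V ?B" using that by (auto simp: Pi_def)
    then have "measure_pmf.prob ?M {f. a \<in> f i \<and> a \<in> f j} =
        (\<Prod>v\<in>V. measure_pmf.prob (ksubset_pmf \<Omega> K) (?B v))"
      using measure_Pi_pmf_Pi[OF V, of d "\<lambda>_. ksubset_pmf \<Omega> K" ?B] by simp
    also have "\<dots> = (\<Prod>v\<in>{i, j}. measure_pmf.prob (ksubset_pmf \<Omega> K) (?B v))"
      using V that by (intro prod.mono_neutral_right) auto
    also have "\<dots> = measure_pmf.prob (ksubset_pmf \<Omega> K) {S. a \<in> S} ^ 2"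
      using that by (simp add: power2_eq_square)
    also have "\<dots> \<le> (real K / ?P)\<^sup>2"
      using prob_ksubset_contains_le[OF fin K, of "{a}"] that by (intro power_mono) auto
    finally show ?thesis .
  qed
  \<comment> \<open>Cutting with \<Omega> in \<open>overlap\<close> makes this identity true for
    every f, also outside the support of the distribution.\<close>
  have "overlap \<Omega> V f = (\<Sum>(i, j)\<in>?D. \<Sum>a\<in>\<Omega>. indicator {f. a \<in> f i \<and> a \<in> f j} f)" for f
  proof -
    have "real (card (\<Omega> \<inter> f i \<inter> f j)) = (\<Sum>a\<in>\<Omega>. indicator {f. a \<in> f i \<and> a \<in> f j} f)" for i j
    proof -
      have "(\<Sum>a\<in>\<Omega>. indicator {f. a \<in> f i \<and> a \<in> f j} f) = (\<Sum>a\<in>\<Omega>. indicator (f i \<inter> f j) a :: real)"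
        by (intro sum.cong) (auto simp: indicator_def)
      also have "\<dots> = real (card (\<Omega> \<inter> (f i \<inter> f j)))"
        using fin by (simp add: indicator_def Int_def flip: sum.inter_filter)
      finally show ?thesis by (simp add: Int_assoc)
    qed
    then show ?thesis by (simp add: overlap_def)
  qed
  then have "measure_pmf.expectation ?M (overlap \<Omega> V) =
      measure_pmf.expectation ?M (\<lambda>f. \<Sum>(i, j)\<in>?D. \<Sum>a\<in>\<Omega>. indicator {f. a \<in> f i \<and> a \<in> f j} f)"
    by presburger
  also have "\<dots> = (\<Sum>(i, j)\<in>?D. \<Sum>a\<in>\<Omega>. measure_pmf.prob ?M {f. a \<in> f i \<and> a \<in> f j})"
    by (simp add: case_prod_beta Bochner_Integration.integral_sum int)
  also have "\<dots> \<le> (\<Sum>(i, j)\<in>?D. \<Sum>a\<in>\<Omega>. (real K / ?P)\<^sup>2)"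
    using pij by (intro sum_mono) (auto simp del: sum_constant intro!: sum_mono)
  also have "\<dots> = real (card ?D) * (real K ^ 2 / ?P)"
    by (simp add: case_prod_beta power2_eq_square)
  also have "\<dots> \<le> real (card V) ^ 2 * (real K ^ 2 / ?P)"
  proof (rule mult_right_mono)
    have "card ?D \<le> card (V \<times> V)" using V by (intro card_mono) auto
    then have "real (card ?D) \<le> real (card V * card V)"
      by (simp only: of_nat_le_iff card_cartesian_product)
    then show "real (card ?D) \<le> real (card V) ^ 2"
      by (simp add: power2_eq_square)
  qed simp
  finally show ?thesis .
qed

text \<open>The case u = |W| K - P / K of the preceding bound, with the exponent expanded. The three
  corrections to - |W| y / n have separate sources: 1 is the permitted overlap P / K times K / P, k
  y / K comes from K - j in place of K, and k y / n from the fewer than k sets of K objects that may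
  be met. As y \<ge> 1, each factor y^j is at most y^(k-1).\<close>

lemma prob_ksubset_meets_few_le_crude:
  fixes n y :: real
  assumes fin: "finite \<Omega>" and K: "K \<le> card \<Omega>" "1 \<le> K" and W: "finite W"
    and F: "\<And>w. w \<in> W \<Longrightarrow> F w \<subseteq> \<Omega>" "\<And>w. w \<in> W \<Longrightarrow> card (F w) \<le> K"
    and k: "1 \<le> k" "k \<le> K"
    and U: "real (card W) * real K - real (card \<Omega>) / real K \<le> real (card (\<Union>w\<in>W. F w))"
    and n: "real (card W) \<le> n" "n > 0" and y: "y = n * (real K ^ 2 / real (card \<Omega>))" "1 \<le> y"
  shows "measure_pmf.prob (ksubset_pmf \<Omega> K) {S. card {w \<in> W. S \<inter> F w \<noteq> {}} < k} \<le>
           real k * y ^ (k - 1) *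
           exp (1 + real k * y / real K + real k * y / n - real (card W) * y / n)"
proof -
  define P N x where "P = real (card \<Omega>)" and "N = real (card W)" and "x = real K ^ 2 / P"
  have P: "P > 0" using K by (auto simp: P_def)
  have K0: "real K > 0" using K by simp
  have x: "x \<ge> 0" "y = n * x" using P y by (auto simp: x_def P_def)
  let ?u = "N * real K - P / real K"
  have "measure_pmf.prob (ksubset_pmf \<Omega> K) {S. card {w \<in> W. S \<inter> F w \<noteq> {}} < k} \<le>
      (\<Sum>j<k. real (card W choose j) * (x ^ j * exp (- ((?u - real j * real K) * (real K - real j) / P))))"
    using prob_ksubset_meets_few_le[OF fin K(1) W F k(2) U] unfolding P_def N_def x_def .
  also have "\<dots> \<le> (\<Sum>j<k. y ^ (k - 1) * exp (1 + real k * y / real K + real k * y / n - N * y / n))"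
  proof (rule sum_mono)
    fix j assume "j \<in> {..<k}"
    then have j: "j < k" by simp
    have "real (card W choose j) * x ^ j \<le> n ^ j * x ^ j"
    proof (rule mult_right_mono)
      have "real (card W choose j) \<le> real (card W) ^ j"
      proof (cases "j \<le> card W")
        case True
        from binomial_le_pow[OF this] show ?thesis by (metis of_nat_le_iff of_nat_power)
      qed (simp add: binomial_eq_0)
      also have "\<dots> \<le> n ^ j" using n by (intro power_mono) auto
      finally show "real (card W choose j) \<le> n ^ j" .
    qed (use x in simp)
    also have "\<dots> = y ^ j" by (simp add: x power_mult_distrib)
    also have "\<dots> \<le> y ^ (k - 1)" using y j by (intro power_increasing) auto
    finally have 1: "real (card W choose j) * x ^ j \<le> y ^ (k - 1)" .
    have jk: "real j \<le> real k" "real j \<le> real K" using j k by auto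
    have "N * real K ^ 2 - n * real K * real k - P - real k * real K ^ 2 \<le>
        (?u - real j * real K) * (real K - real j)"
    proof -
      have "(?u - real j * real K) * (real K - real j) =
          N * real K ^ 2 - N * real K * real j - (P / real K + real j * real K) * (real K - real j)"
        by (simp add: algebra_simps power2_eq_square)
      moreover have "N * real K * real j \<le> n * real K * real k"
        using n jk K0 by (intro mult_mono) (auto simp: N_def)
      moreover have "(P / real K + real j * real K) * (real K - real j) \<le> P + real k * real K ^ 2"
      proof -
        have "(P / real K + real j * real K) * (real K - real j) \<le> (P / real K + real j * real K) * real K"
          using P K0 by (intro mult_left_mono) auto
        also have "\<dots> = P + real j * real K ^ 2" using K0 by (simp add: field_simps power2_eq_square)
        also have "\<dots> \<le> P + real k * real K ^ 2" using jk by (intro add_left_mono mult_right_mono) auto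
        finally show ?thesis .
      qed
      ultimately show ?thesis by linarith
    qed
    then have "(N * real K ^ 2 - n * real K * real k - P - real k * real K ^ 2) / P \<le>
        (?u - real j * real K) * (real K - real j) / P"
      using P by (intro divide_right_mono) auto
    moreover have "(N * real K ^ 2 - n * real K * real k - P - real k * real K ^ 2) / P =
        N * y / n - real k * y / real K - 1 - real k * y / n"
      using P K0 n by (simp add: x x_def field_simps power2_eq_square)
    ultimately have 2: "- ((?u - real j * real K) * (real K - real j) / P) \<le>
        1 + real k * y / real K + real k * y / n - N * y / n"
      by linarith
    have "real (card W choose j) * (x ^ j * exp (- ((?u - real j * real K) * (real K - real j) / P))) \<le>
       y ^ (k - 1) * exp (- ((?u - real j * real K) * (real K - real j) / P))"
      using mult_right_mono[OF 1, of "exp (- ((?u - real j * real K) * (real K - real j) / P))"]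
      by (simp add: mult.assoc)
    also have "\<dots> \<le> y ^ (k - 1) * exp (1 + real k * y / real K + real k * y / n - N * y / n)"
      using 2 y by (intro mult_left_mono) auto
    finally show "real (card W choose j) * (x ^ j * exp (- ((?u - real j * real K) * (real K - real j) / P))) \<le>
        y ^ (k - 1) * exp (1 + real k * y / real K + real k * y / n - N * y / n)" .
  qed
  also have "\<dots> = real k * y ^ (k - 1) * exp (1 + real k * y / real K + real k * y / n - N * y / n)"
    by simp
  finally show ?thesis by (simp add: N_def)
qed

text \<open>This is the failure of the robustness condition at one set: v lies in A and w outside,
  so every counted w is a neighbour of v other than v. Formulated for object sets instead of graphs,
  it applies verbatim to an enlarged pool.\<close>

definition isolating :: "nat \<Rightarrow> 'a set \<Rightarrow> ('a \<Rightarrow> 'b set) \<Rightarrow> 'a set \<Rightarrow> bool" where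
  "isolating k V f A \<longleftrightarrow> (\<forall>v\<in>A. card {w \<in> V - A. f v \<inter> f w \<noteq> {}} < k)"

text \<open>Given the sets outside A, the events for the nodes of A are independent and equally
  likely, whence the power card A. The overlap condition involves all of V, but it implies the same
  condition on V - A, which is decided by the conditioning: either it holds and bounds the union
  from below, or the event is empty.\<close>

lemma prob_isolating_le:
  assumes fin: "finite \<Omega>" and K: "K \<le> card \<Omega>" "1 \<le> K" and V: "finite V"
    and k: "1 \<le> k" "k \<le> K" and A: "A \<subseteq> V" and n: "n = real (card V)" "n > 0"
    and y: "y = n * (real K ^ 2 / real (card \<Omega>))" "1 \<le> y"
  shows "measure_pmf.prob (Pi_pmf V d (\<lambda>_. ksubset_pmf \<Omega> K))
           {f. overlap \<Omega> V f \<le> real (card \<Omega>) / real K \<and> isolating k V f A} \<le>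
         (real k * y ^ (k - 1) *
           exp (1 + real k * y / real K + real k * y / n - (n - real (card A)) * y / n)) ^ card A"
    (is "measure_pmf.prob ?M ?E \<le> ?r ^ card A")
proof -
  define W where "W = V - A"
  have W: "finite W" "A \<inter> W = {}" "V = A \<union> W" using V A by (auto simp: W_def)
  have finA: "finite A" using A V finite_subset by blast
  have cW: "real (card W) = n - real (card A)"
    using A V card_mono[OF V A] finA by (simp add: W_def n card_Diff_subset of_nat_diff)
  have r0: "?r \<ge> 0" using y by simp
  let ?Q = "ksubset_pmf \<Omega> K"
  have "measure_pmf.prob ?M ?E = measure_pmf.expectation (Pi_pmf W d (\<lambda>_. ?Q))
      (\<lambda>g. measure_pmf.prob (Pi_pmf A d (\<lambda>_. ?Q)) {f. (\<lambda>v. if v \<in> A then f v else g v) \<in> ?E})"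
    using prob_Pi_pmf_union[OF finA W(1,2), of d "\<lambda>_. ?Q" ?E] W(3) by simp
  also have "\<dots> \<le> ?r ^ card A"
  proof (rule expectation_pmf_le)
    fix g assume g: "g \<in> set_pmf (Pi_pmf W d (\<lambda>_. ?Q))"
    note gW = set_Pi_ksubsetD[OF W(1) fin K(1) g]
    show "measure_pmf.prob (Pi_pmf A d (\<lambda>_. ?Q)) {f. (\<lambda>v. if v \<in> A then f v else g v) \<in> ?E} \<le> ?r ^ card A"
    proof (cases "overlap \<Omega> W g \<le> real (card \<Omega>) / real K")
      case True
      let ?H = "{S. card {w \<in> W. S \<inter> g w \<noteq> {}} < k}"
      have "measure_pmf.prob (Pi_pmf A d (\<lambda>_. ?Q)) {f. (\<lambda>v. if v \<in> A then f v else g v) \<in> ?E} \<le>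
          measure_pmf.prob (Pi_pmf A d (\<lambda>_. ?Q)) (Pi A (\<lambda>_. ?H))"
      proof (rule measure_pmf.finite_measure_mono)
        show "{f. (\<lambda>v. if v \<in> A then f v else g v) \<in> ?E} \<subseteq> Pi A (\<lambda>_. ?H)"
        proof (intro subsetI Pi_I)
          fix f v assume f: "f \<in> {f. (\<lambda>v. if v \<in> A then f v else g v) \<in> ?E}" and v: "v \<in> A"
          have "{w \<in> V - A. f v \<inter> (if w \<in> A then f w else g w) \<noteq> {}} = {w \<in> W. f v \<inter> g w \<noteq> {}}"
            by (auto simp: W_def)
          then show "f v \<in> ?H" using f v by (auto simp: isolating_def)
        qed
      qed simp
      also have "\<dots> = measure_pmf.prob ?Q ?H ^ card A"
        using finA by (simp add: measure_Pi_pmf_Pi)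
      also have "\<dots> \<le> ?r ^ card A"
      proof (rule power_mono)
        have U: "real (card W) * real K - real (card \<Omega>) / real K \<le> real (card (\<Union>w\<in>W. g w))"
          using card_UN_ge_overlap[OF fin W(1), of g K] gW True by force
        show "measure_pmf.prob ?Q ?H \<le> ?r"
          using prob_ksubset_meets_few_le_crude[OF fin K W(1) _ _ k U _ n(2) y] gW cW by auto
      qed simp
      finally show ?thesis .
    next
      case False
      have "overlap \<Omega> W g \<le> overlap \<Omega> V (\<lambda>v. if v \<in> A then f v else g v)" for f
      proof -
        have "overlap \<Omega> W g = overlap \<Omega> W (\<lambda>v. if v \<in> A then f v else g v)"
          using W(2) by (intro overlap_cong) auto
        also have "\<dots> \<le> overlap \<Omega> V (\<lambda>v. if v \<in> A then f v else g v)"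
          using V by (intro overlap_mono) (auto simp: W_def)
        finally show ?thesis .
      qed
      then have "{f. (\<lambda>v. if v \<in> A then f v else g v) \<in> ?E} = {}"
        using False by (auto simp: not_le intro: order_less_le_trans)
      then show ?thesis by (simp only: measure_empty zero_le_power[OF r0])
    qed
  qed simp
  finally show ?thesis .
qed

lemma prob_ex_isolating_le:
  fixes \<Omega> :: "'b set" and V :: "'a set"
  assumes fin: "finite \<Omega>" and K: "K \<le> card \<Omega>" "1 \<le> K" and V: "finite V"
    and k: "1 \<le> k" "k \<le> K" and n: "n = card V" "n > 0"
    and y: "y = real n * (real K ^ 2 / real (card \<Omega>))" "1 \<le> y"
  shows "measure_pmf.prob (Pi_pmf V d (\<lambda>_. ksubset_pmf \<Omega> K))
           {f. \<exists>A\<subseteq>V. A \<noteq> {} \<and> 2 * card A \<le> n \<and> isolating k V f A} \<le>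
         y ^ 2 / real K +
         (\<Sum>m=1..n div 2. real (n choose m) *
           (real k * y ^ (k - 1) *
            exp (1 + real k * y / real K + real k * y / real n - (real n - real m) * y / real n)) ^ m)"
proof -
  let ?M = "Pi_pmf V d (\<lambda>_. ksubset_pmf \<Omega> K)" and ?\<tau> = "real (card \<Omega>) / real K"
  let ?r = "\<lambda>m. (real k * y ^ (k - 1) *
            exp (1 + real k * y / real K + real k * y / real n - (real n - real m) * y / real n)) ^ m"
  let ?\<A> = "{A. A \<subseteq> V \<and> card A \<in> {1..n div 2}}"
  have P: "card \<Omega> > 0" using K by auto
  have \<tau>0: "?\<tau> > 0" using P K by simp
  have finA: "finite ?\<A>" using V by simp
  have "measure_pmf.prob ?M {f. \<exists>A\<subseteq>V. A \<noteq> {} \<and> 2 * card A \<le> n \<and> isolating k V f A} \<le>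
      measure_pmf.prob ?M ({f. overlap \<Omega> V f \<ge> ?\<tau>} \<union>
        (\<Union>A\<in>?\<A>. {f. overlap \<Omega> V f \<le> ?\<tau> \<and> isolating k V f A}))"
  proof (rule measure_pmf.finite_measure_mono)
    show "{f. \<exists>A\<subseteq>V. A \<noteq> {} \<and> 2 * card A \<le> n \<and> isolating k V f A} \<subseteq>
        {f. overlap \<Omega> V f \<ge> ?\<tau>} \<union>
        (\<Union>A\<in>?\<A>. {f. overlap \<Omega> V f \<le> ?\<tau> \<and> isolating k V f A})"
    proof
      fix f :: "'a \<Rightarrow> 'b set" assume "f \<in> {f. \<exists>A\<subseteq>V. A \<noteq> {} \<and> 2 * card A \<le> n \<and> isolating k V f A}"
      then obtain A where A: "A \<subseteq> V" "A \<noteq> {}" "2 * card A \<le> n" "isolating k V f A" by blast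
      have "card A > 0" using A(1,2) V finite_subset card_gt_0_iff by blast
      then have "A \<in> ?\<A>" using A by auto
      then show "f \<in> {f. overlap \<Omega> V f \<ge> ?\<tau>} \<union>
          (\<Union>A\<in>?\<A>. {f. overlap \<Omega> V f \<le> ?\<tau> \<and> isolating k V f A})"
        using A(4) by (cases "overlap \<Omega> V f \<ge> ?\<tau>") auto
    qed
  qed simp
  also have "\<dots> \<le> measure_pmf.prob ?M {f. overlap \<Omega> V f \<ge> ?\<tau>} +
      measure_pmf.prob ?M (\<Union>A\<in>?\<A>. {f. overlap \<Omega> V f \<le> ?\<tau> \<and> isolating k V f A})"
    by (rule measure_Un_le) auto
  finally have 1: "measure_pmf.prob ?M {f. \<exists>A\<subseteq>V. A \<noteq> {} \<and> 2 * card A \<le> n \<and> isolating k V f A} \<le>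
      measure_pmf.prob ?M {f. overlap \<Omega> V f \<ge> ?\<tau>} +
      measure_pmf.prob ?M (\<Union>A\<in>?\<A>. {f. overlap \<Omega> V f \<le> ?\<tau> \<and> isolating k V f A})" .
  have 2: "measure_pmf.prob ?M {f. overlap \<Omega> V f \<ge> ?\<tau>} \<le> y ^ 2 / real K"
  proof -
    have "measure_pmf.prob ?M {f. overlap \<Omega> V f \<ge> ?\<tau>} \<le>
        measure_pmf.expectation ?M (overlap \<Omega> V) / ?\<tau>"
    proof -
      have "integrable ?M (overlap \<Omega> V)"
        by (intro integrable_measure_pmf_finite finite_set_Pi_ksubset V fin K)
      moreover have "AE f in ?M. 0 \<le> overlap \<Omega> V f"
        by (auto simp: overlap_def intro!: sum_nonneg AE_pmfI)
      ultimately have "measure_pmf.prob ?M {f \<in> space (measure_pmf ?M). ?\<tau> \<le> overlap \<Omega> V f} \<le>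
          measure_pmf.expectation ?M (overlap \<Omega> V) / ?\<tau>"
        using \<tau>0 by (intro integral_Markov_inequality_measure[where A = "{}"]) auto
      then show ?thesis by simp
    qed
    also have "\<dots> \<le> (real n ^ 2 * (real K ^ 2 / real (card \<Omega>))) / ?\<tau>"
      using expectation_overlap_le[OF V fin K(1), of d] \<tau>0 n by (intro divide_right_mono) auto
    also have "\<dots> = y ^ 2 / real K"
      using P K by (simp add: y field_simps power2_eq_square)
    finally show ?thesis .
  qed
  have "measure_pmf.prob ?M (\<Union>A\<in>?\<A>. {f. overlap \<Omega> V f \<le> ?\<tau> \<and> isolating k V f A}) \<le>
      (\<Sum>A\<in>?\<A>. measure_pmf.prob ?M {f. overlap \<Omega> V f \<le> ?\<tau> \<and> isolating k V f A})"
    using finA by (intro measure_pmf.finite_measure_subadditive_finite) auto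
  also have "\<dots> \<le> (\<Sum>A\<in>?\<A>. ?r (card A))"
    using prob_isolating_le[OF fin K V k, of _ "real n" y d] n y by (intro sum_mono) auto
  also have "\<dots> = (\<Sum>m=1..n div 2. \<Sum>A | A \<in> ?\<A> \<and> card A = m. ?r (card A))"
    using finA by (intro sum.group[symmetric]) auto
  also have "\<dots> = (\<Sum>m=1..n div 2. \<Sum>A | A \<subseteq> V \<and> card A = m. ?r m)"
    by (intro sum.cong) auto
  also have "\<dots> = (\<Sum>m=1..n div 2. real (n choose m) * ?r m)"
    using n_subsets[OF V] n by simp
  finally show ?thesis using 1 2 by linarith
qed

subsection \<open>Non-robust graphs and larger pools\<close>

lemma neighbors_intersection_graph:
  assumes "v \<in> V"
  shows "neighbors (intersection_graph V f) v = {w \<in> V. w \<noteq> v \<and> f v \<inter> f w \<noteq> {}}"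
  using assms by (auto simp: neighbors_def intersection_graph_def doubleton_eq_iff)

lemma fst_intersection_graph [simp]: "fst (intersection_graph V f) = V"
  by (simp add: intersection_graph_def)

text \<open>When robustness fails, both A and B are isolating, and two disjoint sets cannot both
  contain more than half of the nodes. The size bound guarantees later that half of y survives in
  the exponent.\<close>

lemma ex_isolating_if_not_k_robust:
  assumes V: "finite V" and "\<not> k_robust k (intersection_graph V f)"
  shows "\<exists>A\<subseteq>V. A \<noteq> {} \<and> 2 * card A \<le> card V \<and> isolating k V f A"
proof -
  let ?G = "intersection_graph V f"
  obtain A B where AB: "A \<subseteq> V" "B \<subseteq> V" "A \<noteq> {}" "B \<noteq> {}" "A \<inter> B = {}"
    and nb: "\<not> (\<exists>v\<in>A. k \<le> card (neighbors ?G v \<inter> (V - A)))"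
       "\<not> (\<exists>v\<in>B. k \<le> card (neighbors ?G v \<inter> (V - B)))"
    using assms(2) unfolding k_robust_def fst_intersection_graph not_all not_imp de_Morgan_disj
    by (elim exE conjE) (rule that; assumption)
  have iso: "isolating k V f D"
    if D: "D \<subseteq> V" "\<not> (\<exists>v\<in>D. k \<le> card (neighbors ?G v \<inter> (V - D)))" for D
    unfolding isolating_def
  proof
    fix v assume v: "v \<in> D"
    then have "{w \<in> V - D. f v \<inter> f w \<noteq> {}} = neighbors ?G v \<inter> (V - D)"
      using D(1) neighbors_intersection_graph[of v V f] by auto
    then show "card {w \<in> V - D. f v \<inter> f w \<noteq> {}} < k" using D(2) v by auto
  qed
  have "card A + card B = card (A \<union> B)"
    using AB(5) finite_subset[OF AB(1) V] finite_subset[OF AB(2) V]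
    by (intro card_Un_disjoint[symmetric])
  also have "\<dots> \<le> card V" using AB V by (intro card_mono) auto
  finally have "2 * card A \<le> card V \<or> 2 * card B \<le> card V" by linarith
  then show ?thesis using AB iso[OF AB(1) nb(1)] iso[OF AB(2) nb(2)] by blast
qed

lemma isolating_mono:
  assumes V: "finite V" and sub: "\<And>u v. u \<in> V \<Longrightarrow> v \<in> V \<Longrightarrow> g u \<inter> g v \<noteq> {} \<Longrightarrow> f u \<inter> f v \<noteq> {}"
    and A: "A \<subseteq> V" and iso: "isolating k V f A"
  shows "isolating k V g A"
  unfolding isolating_def
proof
  fix v assume v: "v \<in> A"
  have "{w \<in> V - A. g v \<inter> g w \<noteq> {}} \<subseteq> {w \<in> V - A. f v \<inter> f w \<noteq> {}}"
    using sub v A by auto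
  then have "card {w \<in> V - A. g v \<inter> g w \<noteq> {}} \<le> card {w \<in> V - A. f v \<inter> f w \<noteq> {}}"
    using V by (intro card_mono) auto
  then show "card {w \<in> V - A. g v \<inter> g w \<noteq> {}} < k"
    using iso v by (auto simp: isolating_def)
qed

section \<open>Coupling with a larger pool\<close>

lemma ex_permutes_image:
  assumes fin: "finite \<Omega>" and S: "S \<subseteq> \<Omega>" and S': "S' \<subseteq> \<Omega>" and card: "card S = card S'"
  shows "\<exists>\<sigma>. \<sigma> permutes \<Omega> \<and> \<sigma> ` S = S'"
proof -
  have finS: "finite S" "finite S'" using S S' fin finite_subset by auto
  obtain f where f: "bij_betw f S S'"
    using finite_same_card_bij[OF finS card] by blast
  have "card (\<Omega> - S) = card (\<Omega> - S')"
    using S S' finS card by (simp add: card_Diff_subset)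
  then obtain g where g: "bij_betw g (\<Omega> - S) (\<Omega> - S')"
    using finite_same_card_bij[of "\<Omega> - S" "\<Omega> - S'"] fin by blast
  define \<sigma> where "\<sigma> x = (if x \<in> S then f x else if x \<in> \<Omega> then g x else x)" for x
  have 1: "bij_betw \<sigma> S S'" using f by (subst bij_betw_cong[of S \<sigma> f]) (auto simp: \<sigma>_def)
  have 2: "bij_betw \<sigma> (\<Omega> - S) (\<Omega> - S')"
    using g by (subst bij_betw_cong[of "\<Omega> - S" \<sigma> g]) (auto simp: \<sigma>_def)
  have "bij_betw \<sigma> (S \<union> (\<Omega> - S)) (S' \<union> (\<Omega> - S'))"
    by (rule bij_betw_combine[OF 1 2]) auto
  then have "bij_betw \<sigma> \<Omega> \<Omega>" using S S' by (simp add: Un_absorb1)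
  then have "\<sigma> permutes \<Omega>" using S by (intro bij_imp_permutes) (auto simp: \<sigma>_def)
  then show ?thesis using bij_betw_imp_surj_on[OF 1] by blast
qed

lemma pmf_eq_pmf_of_setI:
  assumes "finite X" "X \<noteq> {}" "set_pmf D \<subseteq> X" "\<And>a b. a \<in> X \<Longrightarrow> b \<in> X \<Longrightarrow> pmf D a = pmf D b"
  shows "D = pmf_of_set X"
proof (rule pmf_eqI)
  fix a
  show "pmf D a = pmf (pmf_of_set X) a"
  proof (cases "a \<in> X")
    case True
    have "1 = (\<Sum>b\<in>X. pmf D b)" using assms(1,3) by (simp add: sum_pmf_eq_1)
    also have "\<dots> = (\<Sum>b\<in>X. pmf D a)" using assms(4)[OF _ True] by (rule sum.cong[OF refl])
    also have "\<dots> = real (card X) * pmf D a" by simp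
    finally show ?thesis using True assms(1,2) by (simp add: field_simps)
  next
    case False
    then show ?thesis using assms(1-3) by (auto simp: set_pmf_iff)
  qed
qed

text \<open>The second stage of the coupling: projecting a K-subset of \<Omega> \<times> C merges
  copies of the same object, so fewer than K objects may remain, and the deficit is filled
  uniformly.\<close>

definition completion_pmf :: "'b set \<Rightarrow> nat \<Rightarrow> 'b set \<Rightarrow> 'b set pmf" where
  "completion_pmf \<Omega> K T = pmf_of_set {S. S \<subseteq> \<Omega> \<and> card S = K \<and> T \<subseteq> S}"

lemma completions_nonempty:
  assumes "finite \<Omega>" "T \<subseteq> \<Omega>" "card T \<le> K" "K \<le> card \<Omega>"
  shows "{S. S \<subseteq> \<Omega> \<and> card S = K \<and> T \<subseteq> S} \<noteq> {}"
  using exists_subset_between[of T K \<Omega>] assms by blast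

lemma set_completion_pmf:
  assumes "finite \<Omega>" "T \<subseteq> \<Omega>" "card T \<le> K" "K \<le> card \<Omega>"
  shows "set_pmf (completion_pmf \<Omega> K T) = {S. S \<subseteq> \<Omega> \<and> card S = K \<and> T \<subseteq> S}"
  unfolding completion_pmf_def using completions_nonempty[OF assms] assms
  by (intro set_pmf_of_set) auto

text \<open>Completion commutes with relabelling the objects, which lets the invariance of the first
  stage pass to the two-stage distribution.\<close>

lemma map_completion_pmf:
  assumes fin: "finite \<Omega>" and T: "T \<subseteq> \<Omega>" "card T \<le> K" and K: "K \<le> card \<Omega>" and \<sigma>: "\<sigma> permutes \<Omega>"
  shows "map_pmf (image \<sigma>) (completion_pmf \<Omega> K T) = completion_pmf \<Omega> K (\<sigma> ` T)"
proof -
  let ?X = "\<lambda>T. {S. S \<subseteq> \<Omega> \<and> card S = K \<and> T \<subseteq> S}"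
  have inj: "inj \<sigma>" using \<sigma> permutes_inj by blast
  have "map_pmf (image \<sigma>) (completion_pmf \<Omega> K T) = pmf_of_set (image \<sigma> ` ?X T)"
    unfolding completion_pmf_def using completions_nonempty[OF fin T K] fin inj
    by (intro map_pmf_of_set_inj) (auto simp: inj_on_def inj_image_eq_iff)
  also have "image \<sigma> ` ?X T = ?X (\<sigma> ` T)"
  proof (intro equalityI subsetI)
    fix S assume "S \<in> image \<sigma> ` ?X T"
    then obtain S0 where S0: "S0 \<subseteq> \<Omega>" "card S0 = K" "T \<subseteq> S0" "S = \<sigma> ` S0" by blast
    have "\<sigma> ` S0 \<subseteq> \<Omega>" using S0(1) permutes_image[OF \<sigma>] by blast
    moreover have "card (\<sigma> ` S0) = K" using S0(2) inj by (simp add: card_image inj_on_subset)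
    ultimately show "S \<in> ?X (\<sigma> ` T)" using S0 by auto
  next
    fix S assume S: "S \<in> ?X (\<sigma> ` T)"
    have eq: "\<sigma> ` (\<sigma> -` S) = S" using permutes_surj[OF \<sigma>] by (rule surj_image_vimage_eq)
    have "\<sigma> -` S \<subseteq> \<Omega>" using S permutes_in_image[OF \<sigma>] by auto
    moreover have "card (\<sigma> -` S) = K"
      using S eq card_image[OF inj_on_subset[OF inj, of "\<sigma> -` S"]] by simp
    moreover have "T \<subseteq> \<sigma> -` S" using S by auto
    ultimately show "S \<in> image \<sigma> ` ?X T" using eq by blast
  qed
  finally show ?thesis by (simp add: completion_pmf_def)
qed

lemma map_ksubset_pmf_bij:
  assumes fin: "finite \<Omega>" and K: "K \<le> card \<Omega>" and \<sigma>: "bij_betw \<sigma> \<Omega> \<Omega>"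
  shows "map_pmf (image \<sigma>) (ksubset_pmf \<Omega> K) = ksubset_pmf \<Omega> K"
  unfolding ksubset_pmf_def
proof (rule map_pmf_of_set_bij_betw)
  let ?X = "{S. S \<subseteq> \<Omega> \<and> card S = K}"
  have inj: "inj_on \<sigma> \<Omega>" using \<sigma> bij_betw_def by blast
  have inj': "inj_on (image \<sigma>) ?X"
    using inj by (auto intro!: inj_onI dest: inj_on_image_eq_iff)
  moreover have "image \<sigma> ` ?X \<subseteq> ?X"
  proof safe
    fix S x assume "S \<subseteq> \<Omega>" "x \<in> S"
    then show "\<sigma> x \<in> \<Omega>" using \<sigma> bij_betwE by blast
  next
    fix S assume "S \<subseteq> \<Omega>"
    then show "card (\<sigma> ` S) = card S" using inj by (meson card_image inj_on_subset)
  qed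
  then have "image \<sigma> ` ?X = ?X"
    using inj' fin by (intro endo_inj_surj) auto
  ultimately show "bij_betw (image \<sigma>) ?X ?X" by (simp add: bij_betw_def)
qed (use fin ksubsets_nonempty[OF fin K] in auto)

lemma le_card_Times:
  assumes "finite C" "C \<noteq> {}" "K \<le> card \<Omega>"
  shows "K \<le> card (\<Omega> \<times> C)"
proof -
  have "1 \<le> card C" using assms(1,2) card_gt_0_iff[of C] by linarith
  then have "card \<Omega> * 1 \<le> card \<Omega> * card C" by (rule mult_le_mono2)
  then show ?thesis using assms(3) unfolding card_cartesian_product by linarith
qed

text \<open>
  Both sides are invariant under all permutations of \<open>\<Omega>\<close>, because these lift to \<open>\<Omega> \<times> C\<close>.
\<close>

lemma ksubset_pmf_via_larger_pool:
  assumes fin: "finite \<Omega>" "finite C" and C: "C \<noteq> {}" and K: "K \<le> card \<Omega>"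
  shows "ksubset_pmf \<Omega> K = bind_pmf (ksubset_pmf (\<Omega> \<times> C) K) (\<lambda>T. completion_pmf \<Omega> K (fst ` T))"
    (is "_ = ?D")
proof -
  let ?X = "{S. S \<subseteq> \<Omega> \<and> card S = K}"
  have finC: "finite (\<Omega> \<times> C)" using fin by simp
  have KC: "K \<le> card (\<Omega> \<times> C)" by (rule le_card_Times[OF fin(2) C K])
  have supp: "fst ` T \<subseteq> \<Omega> \<and> card (fst ` T) \<le> K" if "T \<in> set_pmf (ksubset_pmf (\<Omega> \<times> C) K)" for T
  proof -
    have T: "T \<subseteq> \<Omega> \<times> C" "card T = K" using that set_ksubset_pmf[OF finC KC] by auto
    have "finite T" using T finC finite_subset by blast
    then show ?thesis using T card_image_le[of T fst] by auto
  qed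
  have inv: "map_pmf (image \<sigma>) ?D = ?D" if \<sigma>: "\<sigma> permutes \<Omega>" for \<sigma>
  proof -
    let ?\<sigma> = "map_prod \<sigma> (id :: 'b \<Rightarrow> 'b)"
    have bij: "bij_betw ?\<sigma> (\<Omega> \<times> C) (\<Omega> \<times> C)"
      using \<sigma> by (intro bij_betw_map_prod) (auto simp: permutes_imp_bij)
    have "map_pmf (image \<sigma>) ?D =
        bind_pmf (ksubset_pmf (\<Omega> \<times> C) K) (\<lambda>T. map_pmf (image \<sigma>) (completion_pmf \<Omega> K (fst ` T)))"
      by (simp add: map_bind_pmf)
    also have "\<dots> = bind_pmf (ksubset_pmf (\<Omega> \<times> C) K) (\<lambda>T. completion_pmf \<Omega> K (fst ` (?\<sigma> ` T)))"
    proof (rule bind_pmf_cong[OF refl])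
      fix T assume "T \<in> set_pmf (ksubset_pmf (\<Omega> \<times> C) K)"
      moreover have "fst ` (?\<sigma> ` T) = \<sigma> ` (fst ` T)" by (auto simp: image_image)
      ultimately show "map_pmf (image \<sigma>) (completion_pmf \<Omega> K (fst ` T)) =
          completion_pmf \<Omega> K (fst ` (?\<sigma> ` T))"
        using supp map_completion_pmf[OF fin(1) _ _ K \<sigma>] by metis
    qed
    also have "\<dots> = bind_pmf (map_pmf (image ?\<sigma>) (ksubset_pmf (\<Omega> \<times> C) K)) (\<lambda>T. completion_pmf \<Omega> K (fst ` T))"
      by (simp add: bind_map_pmf)
    also have "\<dots> = ?D" by (simp add: map_ksubset_pmf_bij[OF finC KC bij])
    finally show ?thesis .
  qed
  have "?D = pmf_of_set ?X"
  proof (rule pmf_eq_pmf_of_setI)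
    show "finite ?X" using fin by simp
    show "?X \<noteq> {}" by (rule ksubsets_nonempty[OF fin(1) K])
    show "set_pmf ?D \<subseteq> ?X"
      using supp set_completion_pmf[OF fin(1) _ _ K] by fastforce
    \<comment> \<open>Permutations act transitively on the K-subsets, so invariance forces all
      masses to be equal.\<close>
    fix S S' assume "S \<in> ?X" "S' \<in> ?X"
    then obtain \<sigma> where \<sigma>: "\<sigma> permutes \<Omega>" "\<sigma> ` S = S'"
      using ex_permutes_image[OF fin(1), of S S'] by auto
    have "inj (image \<sigma>)" using permutes_inj[OF \<sigma>(1)] by (simp add: inj_on_def inj_image_eq_iff)
    then have "pmf (map_pmf (image \<sigma>) ?D) (\<sigma> ` S) = pmf ?D S" by (rule pmf_map_inj')
    then show "pmf ?D S = pmf ?D S'" using inv[OF \<sigma>(1)] \<sigma>(2) by simp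
  qed
  then show ?thesis by (simp add: ksubset_pmf_def)
qed

text \<open>The coupling is applied node by node: f v contains the projection of g v, so two nodes
  sharing a copy in g share an object in f. A set isolating for f is therefore isolating for g, and
  given a g without such a set the event on the left has probability 0.\<close>

lemma prob_ex_isolating_larger_pool:
  fixes \<Omega> :: "'b set" and C :: "'c set" and V :: "'a set"
  assumes fin: "finite \<Omega>" "finite C" and C: "C \<noteq> {}" and K: "K \<le> card \<Omega>" and V: "finite V"
  shows "measure_pmf.prob (Pi_pmf V {} (\<lambda>_. ksubset_pmf \<Omega> K))
           {f. \<exists>A\<subseteq>V. A \<noteq> {} \<and> 2 * card A \<le> n \<and> isolating k V f A} \<le>
         measure_pmf.prob (Pi_pmf V {} (\<lambda>_. ksubset_pmf (\<Omega> \<times> C) K))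
           {f. \<exists>A\<subseteq>V. A \<noteq> {} \<and> 2 * card A \<le> n \<and> isolating k V f A}"
    (is "measure_pmf.prob ?M ?E \<le> measure_pmf.prob ?M' ?E'")
proof -
  have finC: "finite (\<Omega> \<times> C)" using fin by simp
  have KC: "K \<le> card (\<Omega> \<times> C)" by (rule le_card_Times[OF fin(2) C K])
  let ?N = "\<lambda>g. Pi_pmf V {} (\<lambda>v. completion_pmf \<Omega> K (fst ` g v))"
  have "?M = bind_pmf ?M' ?N"
    unfolding ksubset_pmf_via_larger_pool[OF fin C K] by (rule Pi_pmf_bind[OF V])
  then have "measure_pmf.prob ?M ?E = measure_pmf.expectation ?M' (\<lambda>g. measure_pmf.prob (?N g) ?E)"
    by (simp add: prob_bind_pmf)
  also have "\<dots> \<le> measure_pmf.expectation ?M' (indicator ?E')"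
  proof (rule integral_mono_AE)
    show "AE g in ?M'. measure_pmf.prob (?N g) ?E \<le> indicator ?E' g"
    proof (rule AE_pmfI)
      fix g assume g: "g \<in> set_pmf ?M'"
      show "measure_pmf.prob (?N g) ?E \<le> indicator ?E' g"
      proof (cases "g \<in> ?E'")
        case False
        have "f \<notin> ?E" if f: "f \<in> set_pmf (?N g)" for f
        proof
          assume "f \<in> ?E"
          then obtain A where A: "A \<subseteq> V" "A \<noteq> {}" "2 * card A \<le> n" "isolating k V f A" by blast
          have fg: "fst ` g v \<subseteq> f v" if v: "v \<in> V" for v
          proof -
            have gv: "g v \<subseteq> \<Omega> \<times> C" "card (g v) = K" using set_Pi_ksubsetD[OF V finC KC g v] by auto
            have "finite (g v)" using gv finC finite_subset by blast
            then have "fst ` g v \<subseteq> \<Omega>" "card (fst ` g v) \<le> K" using gv card_image_le[of "g v" fst] by auto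
            moreover have "f v \<in> set_pmf (completion_pmf \<Omega> K (fst ` g v))"
              using f v V by (auto simp: set_Pi_pmf PiE_dflt_def)
            ultimately show ?thesis using set_completion_pmf[OF fin(1) _ _ K] by auto
          qed
          have "isolating k V g A"
            by (rule isolating_mono[OF V _ A(1,4)]) (use fg in blast)
          then show False using A False by blast
        qed
        then have "measure_pmf.prob (?N g) ?E = 0" by (simp add: measure_pmf_zero_iff disjoint_iff)
        then show ?thesis by simp
      qed (simp add: measure_pmf.prob_le_1)
    qed
  qed (auto intro!: integrable_measure_pmf_finite finite_set_Pi_ksubset V finC KC)
  also have "\<dots> = measure_pmf.prob ?M' ?E'" by simp
  finally show ?thesis .
qed

subsection \<open>The union bound\<close>

lemma power_div_fact_le_exp:
  fixes x :: real
  assumes "x \<ge> 0"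
  shows "x ^ m / fact m \<le> exp x"
proof -
  have "(\<Sum>i\<in>{m}. x ^ i /\<^sub>R fact i) \<le> (\<Sum>i. x ^ i /\<^sub>R fact i)"
    using assms by (intro sum_le_suminf summable_exp_generic) auto
  then show ?thesis by (simp add: exp_def divide_inverse mult.commute)
qed

text \<open>Amounts to m! \<ge> (m / e)^m, which is read off from a single term of the series of exp
  m.\<close>

lemma binomial_le_exp_power:
  assumes "1 \<le> m"
  shows "real (n choose m) \<le> (exp 1 * real n / real m) ^ m"
proof (cases "m \<le> n")
  case True
  have "(n choose m) * fact m \<le> n ^ m" by (rule binomial_fact_pow)
  then have "real ((n choose m) * fact m) \<le> real (n ^ m)" by (simp only: of_nat_le_iff)
  then have "real (n choose m) * fact m \<le> real n ^ m" by simp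
  moreover have "real m ^ m \<le> exp (real m) * fact m"
    using power_div_fact_le_exp[of "real m" m] by (simp add: field_simps)
  ultimately have "real (n choose m) * fact m * real m ^ m \<le> real n ^ m * (exp (real m) * fact m)"
    by (intro mult_mono) auto
  then have "real (n choose m) * real m ^ m \<le> real n ^ m * exp (real m)"
    by (simp add: mult_ac mult_le_cancel_left_pos)
  moreover have "exp (real m) = exp 1 ^ m" by (metis exp_of_nat_mult mult.right_neutral)
  ultimately show ?thesis using assms by (simp add: field_simps)
qed (simp add: binomial_eq_0)

lemma sum_powers_le_double:
  fixes \<epsilon> :: real
  assumes "0 \<le> \<epsilon>" "\<epsilon> \<le> 1 / 2"
  shows "(\<Sum>m=1..M. \<epsilon> ^ m) \<le> 2 * \<epsilon>"
proof -
  \<comment> \<open>The subtracted term strengthens the claim so that the induction closes: by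
    \<epsilon> \<le> 1/2 it pays for the next summand.\<close>
  have "(\<Sum>m=1..M. \<epsilon> ^ m) \<le> 2 * \<epsilon> - 2 * (\<epsilon> ^ M * \<epsilon>)"
  proof (induction M)
    case (Suc M)
    have "\<epsilon> ^ M * \<epsilon> * \<epsilon> \<le> \<epsilon> ^ M * \<epsilon> * (1/2)" using assms by (intro mult_left_mono) auto
    moreover have "(\<Sum>m=1..Suc M. \<epsilon> ^ m) = (\<Sum>m=1..M. \<epsilon> ^ m) + \<epsilon> ^ M * \<epsilon>" by simp
    moreover have "\<epsilon> ^ Suc M * \<epsilon> = \<epsilon> ^ M * \<epsilon> * \<epsilon>" by simp
    ultimately show ?case using Suc by linarith
  qed simp
  also have "\<dots> \<le> 2 * \<epsilon>" using assms by simp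
  finally show ?thesis .
qed

text \<open>
  For \<open>m \<le> n / ln n\<close> the loss \<open>exp (m y / n)\<close> is bounded and the term is small by the choice of \<open>y\<close>;
  for larger \<open>m\<close> the factor \<open>n / m\<close> is at most \<open>ln n\<close>, which \<open>exp (- y / 2) \<le> n powr (- 1 / 2)\<close> absorbs.
\<close>

lemma union_bound_term_le:
  fixes y \<beta> D :: real
  assumes m: "1 \<le> m" "m \<le> n div 2" and k: "1 \<le> k" and L: "L = ln (real n)" "1 \<le> L"
    and y: "L + (real k - 1) * ln L + \<beta> \<le> y" "L \<le> y" "y \<le> 4 * L" and D: "D \<le> 2"
  shows "real (n choose m) * (real k * y ^ (k - 1) * exp (D - (real n - real m) * y / real n)) ^ m \<le>
         (real k * 4 ^ (k - 1) * 2 ^ k * exp 7 * (exp (- \<beta>) + (L / 2) ^ k / exp (L / 2))) ^ m"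
proof -
  have n: "n \<ge> 2" and nm: "2 * m \<le> n" using m by auto
  have n0: "real n > 0" using n by simp
  have y0: "y \<ge> 0" using y L by simp
  have E: "exp L = real n" using L n0 by simp
  define B where "B = exp 1 * real n / real m * (real k * y ^ (k - 1) * exp (D - (real n - real m) * y / real n))"
  have split: "(real n - real m) * y / real n = y - real m * y / real n" using n0 by (simp add: field_simps)
  have yk: "y ^ (k - 1) \<le> 4 ^ (k - 1) * L ^ (k - 1)"
    using power_mono[OF y(3) y0, of "k - 1"] by (simp add: power_mult_distrib)
  have B: "B \<le> real k * 4 ^ (k - 1) * 2 ^ k * exp 7 * (exp (- \<beta>) + (L / 2) ^ k / exp (L / 2))"
  proof (cases "real m * L \<le> real n")
    case True
    have "real m * y \<le> real m * (4 * L)" using y by (intro mult_left_mono) auto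
    also have "\<dots> \<le> 4 * real n" using True by simp
    finally have "real m * y / real n \<le> 4" using n0 by (simp add: field_simps)
    moreover have "L + (real k - 1) * ln L + \<beta> - y \<le> 0" using y by simp
    ultimately have "D - (real n - real m) * y / real n \<le> 6 - L - (real k - 1) * ln L - \<beta>"
      unfolding split using D by linarith
    then have "exp (D - (real n - real m) * y / real n) \<le> exp (6 - L - (real k - 1) * ln L - \<beta>)"
      by simp
    also have "\<dots> = exp 6 * exp (- \<beta>) / (real n * L ^ (k - 1))"
    proof -
      have "exp ((real k - 1) * ln L) = L ^ (k - 1)"
        using L k exp_of_nat_mult[of "k - 1" "ln L"] by (simp add: of_nat_diff)
      then show ?thesis by (simp add: exp_diff exp_minus E divide_inverse mult_ac)
    qed
    finally have ex: "exp (D - (real n - real m) * y / real n) \<le> exp 6 * exp (- \<beta>) / (real n * L ^ (k - 1))" .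
    \<comment> \<open>The factor n of the binomial bound and the L^(k-1) coming from y^(k-1) now
      cancel; the latter is the purpose of the summand (k-1) ln ln n. The remaining e turns exp 6
      into exp 7.\<close>
    have "B \<le> exp 1 * real n / 1 * (real k * (4 ^ (k - 1) * L ^ (k - 1)) * (exp 6 * exp (- \<beta>) / (real n * L ^ (k - 1))))"
      unfolding B_def using m n0 y0 L by (intro mult_mono frac_le yk ex) auto
    also have "\<dots> = real k * 4 ^ (k - 1) * exp 7 * exp (- \<beta>)"
      using n0 L(2) by (simp add: field_simps flip: exp_add)
    also have "\<dots> = real k * 4 ^ (k - 1) * 1 * exp 7 * exp (- \<beta>)" by simp
    also have "\<dots> \<le> real k * 4 ^ (k - 1) * 2 ^ k * exp 7 * (exp (- \<beta>) + (L / 2) ^ k / exp (L / 2))"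
      using L by (intro mult_mono) auto
    finally show ?thesis .
  next
    case False
    have nmL: "real n / real m \<le> L" using False m by (simp add: field_simps)
    have "real m \<le> real n / 2" using nm by linarith
    then have "y / 2 \<le> (real n - real m) * y / real n"
      using y0 n0 mult_right_mono[of "real n / 2" "real n - real m" y] by (simp add: field_simps)
    then have "D - (real n - real m) * y / real n \<le> 2 - L / 2" using D y by linarith
    then have "exp (D - (real n - real m) * y / real n) \<le> exp (2 - L / 2)" by simp
    also have "\<dots> = exp 2 / exp (L / 2)" by (simp add: exp_diff)
    finally have ex: "exp (D - (real n - real m) * y / real n) \<le> exp 2 / exp (L / 2)" .
    have "B = exp 1 * (real n / real m) * (real k * y ^ (k - 1) * exp (D - (real n - real m) * y / real n))"
      by (simp add: B_def)
    also have "\<dots> \<le> exp 1 * L * (real k * (4 ^ (k - 1) * L ^ (k - 1)) * (exp 2 / exp (L / 2)))"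
      using m n0 y0 L by (intro mult_mono nmL yk ex) auto
    also have "\<dots> = real k * 4 ^ (k - 1) * (exp 1 * exp 2) * (L * L ^ (k - 1) / exp (L / 2))"
      by (simp add: field_simps)
    \<comment> \<open>Rewritten in L / 2 so that the limit of t^k / exp t can be applied at t = L /
      2; this is the origin of the factor 2^k in the constant.\<close>
    also have "L * L ^ (k - 1) = 2 ^ k * (L / 2) ^ k"
      using k by (simp add: power_divide flip: power_Suc)
    also have "real k * 4 ^ (k - 1) * (exp 1 * exp 2) * (2 ^ k * (L / 2) ^ k / exp (L / 2)) =
        real k * 4 ^ (k - 1) * 2 ^ k * exp 3 * ((L / 2) ^ k / exp (L / 2))"
      by (simp add: field_simps flip: exp_add)
    also have "\<dots> \<le> real k * 4 ^ (k - 1) * 2 ^ k * exp 7 * (exp (- \<beta>) + (L / 2) ^ k / exp (L / 2))"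
      using L by (intro mult_mono) auto
    finally show ?thesis .
  qed
  have "real (n choose m) * (real k * y ^ (k - 1) * exp (D - (real n - real m) * y / real n)) ^ m \<le>
      (exp 1 * real n / real m) ^ m * (real k * y ^ (k - 1) * exp (D - (real n - real m) * y / real n)) ^ m"
    using y0 by (intro mult_right_mono binomial_le_exp_power m) auto
  also have "\<dots> = B ^ m" by (simp only: B_def power_mult_distrib)
  also have "\<dots> \<le> (real k * 4 ^ (k - 1) * 2 ^ k * exp 7 * (exp (- \<beta>) + (L / 2) ^ k / exp (L / 2))) ^ m"
    using B y0 by (intro power_mono) (auto simp: B_def)
  finally show ?thesis .
qed

definition isolating_bound :: "nat \<Rightarrow> real \<Rightarrow> nat \<Rightarrow> nat \<Rightarrow> real" where
  "isolating_bound k y K n = y ^ 2 / real K +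
     (\<Sum>m=1..n div 2. real (n choose m) *
       (real k * y ^ (k - 1) *
        exp (1 + real k * y / real K + real k * y / real n - (real n - real m) * y / real n)) ^ m)"

text \<open>The m-th term is at most the m-th power of one null sequence, so the sum is dominated by
  a geometric series. The cubic growth of K in ln n makes y^2 / K at most 16 / (c ln n).\<close>

lemma isolating_bound_tendsto_0:
  fixes y \<beta> :: "nat \<Rightarrow> real" and K :: "nat \<Rightarrow> nat"
  assumes k: "1 \<le> k" and c: "c > 0"
    and \<beta>: "filterlim \<beta> at_top sequentially"
    and y1: "eventually (\<lambda>n. ln (real n) + (real k - 1) * ln (ln (real n)) + \<beta> n \<le> y n) sequentially"
    and y2: "eventually (\<lambda>n. y n \<le> 4 * ln (real n)) sequentially"
    and K: "eventually (\<lambda>n. c * ln (real n) ^ 3 \<le> real (K n)) sequentially"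
  shows "(\<lambda>n. isolating_bound k (y n) (K n) n) \<longlonglongrightarrow> 0"
proof -
  define \<epsilon> where "\<epsilon> n = real k * 4 ^ (k - 1) * 2 ^ k * exp 7 *
      (exp (- \<beta> n) + (ln (real n) / 2) ^ k / exp (ln (real n) / 2))" for n
  have e1: "(\<lambda>n. exp (- \<beta> n)) \<longlonglongrightarrow> 0"
    using \<beta> by (intro filterlim_compose[OF exp_at_bot] filterlim_uminus_at_bot_at_top[THEN filterlim_compose])
  have "filterlim (\<lambda>n. ln (real n) / 2) at_top sequentially" by real_asymp
  from filterlim_compose[OF tendsto_power_div_exp_0 this]
  have e2: "(\<lambda>n. (ln (real n) / 2) ^ k / exp (ln (real n) / 2)) \<longlonglongrightarrow> 0" .
  have \<epsilon>0: "\<epsilon> \<longlonglongrightarrow> 0"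
    unfolding \<epsilon>_def using tendsto_mult_right_zero[OF tendsto_add_zero[OF e1 e2]] by simp
  have "(\<lambda>n. 1 / ln (real n)) \<longlonglongrightarrow> 0" by real_asymp
  then have b1: "(\<lambda>n. 16 / c * (1 / ln (real n))) \<longlonglongrightarrow> 0" by (rule tendsto_mult_right_zero)
  have "(\<lambda>n. 1 / ln (real n) ^ 2) \<longlonglongrightarrow> 0" by real_asymp
  then have b2: "(\<lambda>n. 4 * real k / c * (1 / ln (real n) ^ 2)) \<longlonglongrightarrow> 0" by (rule tendsto_mult_right_zero)
  have "(\<lambda>n. ln (real n) / real n) \<longlonglongrightarrow> 0" by real_asymp
  then have b3: "(\<lambda>n. 4 * real k * (ln (real n) / real n)) \<longlonglongrightarrow> 0" by (rule tendsto_mult_right_zero)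
  have half: "(0::real) < 1 / 2" by simp
  have l1: "eventually (\<lambda>n. exp 1 \<le> real n) sequentially" by real_asymp
  have bound: "(\<lambda>n. 16 / c * (1 / ln (real n)) + 2 * \<epsilon> n) \<longlonglongrightarrow> 0"
    using tendsto_add[OF b1 tendsto_mult_right_zero[OF \<epsilon>0, of 2]] by simp
  have ev: "eventually (\<lambda>n. 0 \<le> isolating_bound k (y n) (K n) n \<and>
      isolating_bound k (y n) (K n) n \<le> 16 / c * (1 / ln (real n)) + 2 * \<epsilon> n) sequentially"
    using l1 y1 y2 K order_tendstoD(2)[OF b2 half] order_tendstoD(2)[OF b3 half]
      order_tendstoD(2)[OF \<epsilon>0 half] filterlim_at_top[THEN iffD1, OF \<beta>, rule_format, of 0]
      eventually_ge_at_top[of 2]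
  proof eventually_elim
    case (elim n)
    define L where "L = ln (real n)"
    have n0: "real n > 0" using elim by simp
    have L: "1 \<le> L" using elim(1) n0 by (simp add: L_def ln_ge_iff)
    have lnL: "(real k - 1) * ln L \<ge> 0" using L k by simp
    have yL: "L \<le> y n" using elim lnL by (simp add: L_def)
    have y4: "y n \<le> 4 * L" using elim by (simp add: L_def)
    have KL: "c * L ^ 3 \<le> real (K n)" using elim by (simp add: L_def)
    have cL: "c * L ^ 3 > 0" using c L by simp
    have K0: "real (K n) > 0" using KL cL by linarith
    have t1: "y n ^ 2 / real (K n) \<le> 16 / c * (1 / L)"
    proof -
      have "y n ^ 2 / real (K n) \<le> (4 * L) ^ 2 / (c * L ^ 3)"
        using yL y4 KL cL L by (intro frac_le power_mono) auto
      also have "\<dots> = 16 / c * (1 / L)" using c L by (simp add: field_simps power2_eq_square power3_eq_cube)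
      finally show ?thesis .
    qed
    have "real k * y n / real (K n) \<le> real k * (4 * L) / (c * L ^ 3)"
      using yL y4 KL cL L by (intro frac_le mult_left_mono) auto
    also have "\<dots> = 4 * real k / c * (1 / L ^ 2)"
      using c L by (simp add: field_simps power2_eq_square power3_eq_cube)
    also have "\<dots> < 1/2" using elim by (simp add: L_def)
    finally have D1: "real k * y n / real (K n) < 1/2" .
    have "real k * y n / real n \<le> real k * (4 * L) / real n"
      using y4 n0 by (intro divide_right_mono mult_left_mono) auto
    also have "\<dots> < 1/2" using elim by (simp add: L_def)
    finally have D: "1 + real k * y n / real (K n) + real k * y n / real n \<le> 2" using D1 by linarith
    have \<epsilon>n: "0 \<le> \<epsilon> n" "\<epsilon> n \<le> 1/2" using elim L by (auto simp: \<epsilon>_def L_def)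
    have "(\<Sum>m=1..n div 2. real (n choose m) * (real k * y n ^ (k - 1) *
        exp (1 + real k * y n / real (K n) + real k * y n / real n - (real n - real m) * y n / real n)) ^ m) \<le>
        (\<Sum>m=1..n div 2. \<epsilon> n ^ m)"
    proof (rule sum_mono)
      fix m assume "m \<in> {1..n div 2}"
      then have m: "1 \<le> m" "m \<le> n div 2" by auto
      have "L + (real k - 1) * ln L + \<beta> n \<le> y n" using elim by (simp add: L_def)
      from union_bound_term_le[OF m k L_def L this yL y4 D]
      show "real (n choose m) * (real k * y n ^ (k - 1) *
        exp (1 + real k * y n / real (K n) + real k * y n / real n - (real n - real m) * y n / real n)) ^ m \<le> \<epsilon> n ^ m"
        by (simp add: \<epsilon>_def L_def)
    qed
    also have "\<dots> \<le> 2 * \<epsilon> n" by (rule sum_powers_le_double[OF \<epsilon>n])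
    finally have "isolating_bound k (y n) (K n) n \<le> 16 / c * (1 / ln (real n)) + 2 * \<epsilon> n"
      using t1 by (simp add: isolating_bound_def L_def)
    moreover have "0 \<le> isolating_bound k (y n) (K n) n"
      unfolding isolating_bound_def using yL L
      by (intro add_nonneg_nonneg sum_nonneg mult_nonneg_nonneg zero_le_power divide_nonneg_nonneg) auto
    ultimately show ?case by simp
  qed
  show ?thesis
    by (rule tendsto_sandwich[OF _ _ tendsto_const bound]) (use ev in \<open>auto elim: eventually_mono\<close>)
qed

section \<open>Convergence to 1\<close>

lemma prob_uniform_random_intersection_graph:
  "measure_pmf.prob (uniform_random_intersection_graph n P K) {G. k_robust k G} =
   measure_pmf.prob (Pi_pmf {1..n} {} (\<lambda>_. ksubset_pmf {1..P} K))
     {f. k_robust k (intersection_graph {1..n} f)}"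
  by (simp add: uniform_random_intersection_graph_def object_sets_pmf_def ksubset_pmf_def vimage_def)

text \<open>Here m is the number of copies of each object and y belongs to the enlarged pool of P m
  objects, while the conclusion concerns the original graph. This leaves m free for bringing y into
  the range where the bound is small.\<close>

lemma prob_k_robust_ge:
  assumes K: "1 \<le> K" "K \<le> P" and k: "1 \<le> k" "k \<le> K" and n: "n > 0" and m: "m > 0"
    and y: "y = real n * (real K ^ 2 / (real P * real m))" "1 \<le> y"
  shows "1 - isolating_bound k y K n \<le>
           measure_pmf.prob (uniform_random_intersection_graph n P K) {G. k_robust k G}"
proof -
  let ?V = "{1..n}" and ?\<Omega> = "{1..P}"
  let ?M = "Pi_pmf ?V {} (\<lambda>_. ksubset_pmf ?\<Omega> K)"
  let ?M' = "Pi_pmf ?V {} (\<lambda>_. ksubset_pmf (?\<Omega> \<times> {..<m}) K)"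
  have KC: "K \<le> card (?\<Omega> \<times> {..<m})" using m K by (intro le_card_Times) auto
  have "measure_pmf.prob ?M (- {f. k_robust k (intersection_graph ?V f)}) \<le>
      measure_pmf.prob ?M {f. \<exists>A\<subseteq>?V. A \<noteq> {} \<and> 2 * card A \<le> n \<and> isolating k ?V f A}"
  proof (rule measure_pmf.finite_measure_mono)
    show "- {f. k_robust k (intersection_graph ?V f)} \<subseteq>
        {f :: nat \<Rightarrow> nat set. \<exists>A\<subseteq>?V. A \<noteq> {} \<and> 2 * card A \<le> n \<and> isolating k ?V f A}"
      using ex_isolating_if_not_k_robust[of ?V k] by auto
  qed simp
  also have "\<dots> \<le> measure_pmf.prob ?M' {f. \<exists>A\<subseteq>?V. A \<noteq> {} \<and> 2 * card A \<le> n \<and> isolating k ?V f A}"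
    using m K by (intro prob_ex_isolating_larger_pool) auto
  also have "\<dots> \<le> isolating_bound k y K n"
    unfolding isolating_bound_def using K k n y KC
    by (intro prob_ex_isolating_le) (auto simp: card_cartesian_product)
  finally have "measure_pmf.prob ?M (- {f. k_robust k (intersection_graph ?V f)}) \<le> isolating_bound k y K n" .
  then show ?thesis
    unfolding prob_uniform_random_intersection_graph
    using measure_pmf.prob_compl[of "{f. k_robust k (intersection_graph ?V f)}" ?M]
    by (simp add: Compl_eq_Diff_UNIV)
qed

lemma prob_k_robust_tendsto_1:
  fixes k :: nat and P K :: "nat \<Rightarrow> nat" and \<alpha> :: "nat \<Rightarrow> real"
  assumes k: "k \<ge> 1"
    and KP: "\<And>n. n \<ge> 1 \<Longrightarrow> 1 \<le> K n \<and> K n \<le> P n"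
    and x: "\<And>n. n \<ge> 2 \<Longrightarrow> (real (K n))\<^sup>2 / real (P n) =
             (ln (real n) + (real k - 1) * ln (ln (real n)) + \<alpha> n) / real n"
    and c: "c > 0" and K: "eventually (\<lambda>n. c * ln (real n) ^ 3 \<le> real (K n)) sequentially"
    and \<alpha>: "filterlim \<alpha> at_top sequentially"
  shows "(\<lambda>n. measure_pmf.prob (uniform_random_intersection_graph n (P n) (K n)) {G. k_robust k G}) \<longlonglongrightarrow> 1"
proof -
  \<comment> \<open>The number of copies is chosen to bring y between 2 ln n and 4 ln n: for t \<ge>
    2 the floor of t lies between t / 2 and t. For t < 2 the original value n K^2 / P is already
    below 4 ln n and one copy is enough.\<close>
  define t where "t n = real n * ((real (K n))\<^sup>2 / real (P n)) / (2 * ln (real n))" for n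
  define m where "m n = max 1 (nat \<lfloor>t n\<rfloor>)" for n
  define y where "y n = real n * ((real (K n))\<^sup>2 / (real (P n) * real (m n)))" for n
  \<comment> \<open>With several copies only y \<ge> 2 ln n is known, so the excess of y over ln n +
    (k-1) ln ln n is at least the second argument; with one copy it is \<alpha>. The minimum serves
    both cases and still tends to infinity.\<close>
  define \<beta> where "\<beta> n = min (\<alpha> n) (ln (real n) - (real k - 1) * ln (ln (real n)))" for n
  have g: "filterlim (\<lambda>n. ln (real n) - (real k - 1) * ln (ln (real n))) at_top sequentially"
    by real_asymp
  have \<beta>: "filterlim \<beta> at_top sequentially"
    unfolding filterlim_at_top \<beta>_def min.bounded_iff
    using \<alpha> g by (auto simp: filterlim_at_top intro: eventually_conj)
  have l1: "eventually (\<lambda>n. exp 1 \<le> real n) sequentially" by real_asymp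
  have ev: "eventually (\<lambda>n. ln (real n) + (real k - 1) * ln (ln (real n)) + \<beta> n \<le> y n \<and> y n \<le> 4 * ln (real n)) sequentially"
    using l1 eventually_ge_at_top[of 2] filterlim_at_top[THEN iffD1, OF \<alpha>, rule_format, of 0]
  proof eventually_elim
    case (elim n)
    define L where "L = ln (real n)"
    have n0: "real n > 0" using elim by simp
    have L: "1 \<le> L" using elim(1) n0 by (simp add: L_def ln_ge_iff)
    have lnL: "(real k - 1) * ln L \<ge> 0" using L k by simp
    define Y where "Y = L + (real k - 1) * ln L + \<alpha> n"
    have Y: "real n * ((real (K n))\<^sup>2 / real (P n)) = Y"
      using x[of n] elim n0 by (simp add: Y_def L_def)
    have Y0: "Y > 0" using L lnL elim by (simp add: Y_def)
    have tn: "t n = Y / (2 * L)" using Y by (simp add: t_def L_def)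
    have yn: "y n = Y / real (m n)"
      unfolding Y[symmetric] y_def by simp
    have b: "\<beta> n \<le> \<alpha> n" "\<beta> n \<le> L - (real k - 1) * ln L" by (auto simp: \<beta>_def L_def)
    have "L + (real k - 1) * ln L + \<beta> n \<le> y n \<and> y n \<le> 4 * L"
    proof (cases "t n < 2")
      case True
      then have "\<lfloor>t n\<rfloor> \<le> 1" by linarith
      then have "nat \<lfloor>t n\<rfloor> \<le> 1" by linarith
      then have "m n = 1" by (simp only: m_def max_absorb1)
      then have "y n = Y" using yn by simp
      moreover have "Y < 4 * L" using True L by (simp add: tn field_simps)
      ultimately show ?thesis using b by (simp add: Y_def)
    next
      case False
      then have fl: "2 \<le> \<lfloor>t n\<rfloor>" by linarith
      then have "1 \<le> nat \<lfloor>t n\<rfloor>" by linarith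
      then have "m n = nat \<lfloor>t n\<rfloor>" by (simp only: m_def max_absorb2)
      then have "real (m n) = of_int \<lfloor>t n\<rfloor>" using fl by simp
      then have mn: "real (m n) \<le> t n" "t n / 2 \<le> real (m n)" using False by linarith+
      have m0: "real (m n) > 0" using mn False by linarith
      have "y n \<ge> 2 * L"
        using mn(1) m0 L unfolding yn tn by (simp add: field_simps)
      moreover have "y n \<le> 4 * L"
        using mn(2) m0 L unfolding yn tn by (simp add: field_simps)
      ultimately show ?thesis using b by linarith
    qed
    then show ?case by (simp add: L_def)
  qed
  have lim0: "(\<lambda>n. isolating_bound k (y n) (K n) n) \<longlonglongrightarrow> 0"
    by (rule isolating_bound_tendsto_0[OF k c \<beta> _ _ K]) (use ev in \<open>auto elim: eventually_mono\<close>)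
  have lim1: "(\<lambda>n. 1 - isolating_bound k (y n) (K n) n) \<longlonglongrightarrow> 1"
    using tendsto_diff[OF tendsto_const lim0, of 1] by simp
  have "filterlim (\<lambda>n. ln (real n) ^ 3) at_top sequentially" by real_asymp
  then have "filterlim (\<lambda>n. c * ln (real n) ^ 3) at_top sequentially"
    by (rule filterlim_tendsto_pos_mult_at_top[OF tendsto_const c])
  then have kK: "eventually (\<lambda>n. real k \<le> c * ln (real n) ^ 3) sequentially"
    by (simp add: filterlim_at_top)
  have "eventually (\<lambda>n. 1 - isolating_bound k (y n) (K n) n \<le>
      measure_pmf.prob (uniform_random_intersection_graph n (P n) (K n)) {G. k_robust k G}) sequentially"
    using ev K kK l1 eventually_ge_at_top[of 2] filterlim_at_top[THEN iffD1, OF \<beta>, rule_format, of 0]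
  proof eventually_elim
    case (elim n)
    have "1 \<le> ln (real n)" using elim by (simp add: ln_ge_iff)
    moreover from this have "(real k - 1) * ln (ln (real n)) \<ge> 0" using k by simp
    ultimately have "1 \<le> y n" using elim by linarith
    then show ?case
      using KP[of n] elim k by (intro prob_k_robust_ge[where m = "m n"]) (auto simp: y_def m_def)
  qed
  then show ?thesis
    by (intro tendsto_sandwich[OF _ _ lim1 tendsto_const]) (auto simp: measure_pmf.prob_le_1)
qed

subsection \<open>Nodes of low degree\<close>

definition low_degree :: "nat \<Rightarrow> 'a set \<Rightarrow> ('a \<Rightarrow> 'b set) \<Rightarrow> 'a \<Rightarrow> bool" where
  "low_degree k V f v \<longleftrightarrow> card {w \<in> V - {v}. f w \<inter> f v \<noteq> {}} < k"

text \<open>Robustness is tested on {v} and its complement. If it is witnessed by a node u of the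
  complement, the only possible neighbour of u outside that set is v; so either k = 0, or k = 1 and
  u is a neighbour of v.\<close>

lemma k_robust_imp_not_low_degree:
  assumes V: "finite V" "2 \<le> card V" and v: "v \<in> V" and rob: "k_robust k (intersection_graph V f)"
  shows "\<not> low_degree k V f v"
proof -
  let ?G = "intersection_graph V f" and ?N = "{w \<in> V - {v}. f w \<inter> f v \<noteq> {}}"
  have ne: "V - {v} \<noteq> {}"
  proof
    assume "V - {v} = {}"
    then have "V = {v}" using v by auto
    then show False using V by simp
  qed
  have "(\<exists>u\<in>{v}. k \<le> card (neighbors ?G u \<inter> (V - {v}))) \<or>
      (\<exists>u\<in>V - {v}. k \<le> card (neighbors ?G u \<inter> (V - (V - {v}))))"
    using rob[unfolded k_robust_def fst_intersection_graph, rule_format, of "{v}" "V - {v}"] ne v by auto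
  then have "k \<le> card ?N"
  proof
    assume "\<exists>u\<in>{v}. k \<le> card (neighbors ?G u \<inter> (V - {v}))"
    moreover have "neighbors ?G v \<inter> (V - {v}) = ?N" using v by (auto simp: neighbors_intersection_graph)
    ultimately show ?thesis by simp
  next
    assume "\<exists>u\<in>V - {v}. k \<le> card (neighbors ?G u \<inter> (V - (V - {v})))"
    then obtain u where u: "u \<in> V - {v}" "k \<le> card (neighbors ?G u \<inter> (V - (V - {v})))" by blast
    have Vv: "V - (V - {v}) = {v}" using v by auto
    show ?thesis
    proof (cases "f u \<inter> f v = {}")
      case True
      then have "neighbors ?G u \<inter> {v} = {}" using u(1) by (auto simp: neighbors_intersection_graph)
      then show ?thesis using u(2) Vv by simp
    next
      case False
      have "k \<le> 1" using u(2) card_mono[of "{v}" "neighbors ?G u \<inter> {v}"] Vv by simp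
      moreover have "card ?N > 0" using False u(1) V(1) by (auto simp: card_gt_0_iff)
      ultimately show ?thesis by linarith
    qed
  qed
  then show ?thesis by (simp add: low_degree_def)
qed

section \<open>Lower tails of the binomial distribution\<close>

definition binomial_lower_tail :: "nat \<Rightarrow> nat \<Rightarrow> real \<Rightarrow> real" where
  "binomial_lower_tail N k p = (\<Sum>j<k. real (N choose j) * (p ^ j * (1 - p) ^ (N - j)))"

lemma prod_if_mem_power:
  assumes "finite W" "J \<subseteq> W"
  shows "(\<Prod>w\<in>W. if w \<in> J then a else b) = (a :: real) ^ card J * b ^ (card W - card J)"
proof -
  have "(\<Prod>w\<in>W. if w \<in> J then a else b) = (\<Prod>w\<in>W \<inter> J. a) * (\<Prod>w\<in>W \<inter> - J. b)"
    using assms(1) by (subst prod.If_cases) auto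
  moreover have "W \<inter> J = J" "W \<inter> - J = W - J" using assms(2) by auto
  moreover have "card (W - J) = card W - card J"
    using assms finite_subset by (intro card_Diff_subset) auto
  ultimately show ?thesis by simp
qed

lemma sum_prod_if_mem:
  assumes "finite W"
  shows "(\<Sum>J | J \<subseteq> W \<and> card J < k. \<Prod>w\<in>W. if w \<in> J then a else b) =
           (\<Sum>j<k. real (card W choose j) * (a ^ j * b ^ (card W - j)))"
proof -
  have "(\<Sum>J | J \<subseteq> W \<and> card J < k. \<Prod>w\<in>W. if w \<in> J then a else b) =
      (\<Sum>J | J \<subseteq> W \<and> card J < k. a ^ card J * b ^ (card W - card J))"
    using assms by (intro sum.cong) (auto simp: prod_if_mem_power)
  also have "\<dots> = (\<Sum>j<k. real (card W choose j) * (a ^ j * b ^ (card W - j)))"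
    by (rule sum_subsets_by_card[OF assms])
  finally show ?thesis .
qed

lemma prob_card_less:
  assumes W: "finite W"
  shows "measure_pmf.prob (Pi_pmf W d (\<lambda>_. Q)) {f. card {w \<in> W. f w \<in> H} < k} =
           binomial_lower_tail (card W) k (measure_pmf.prob Q H)"
proof -
  let ?M = "Pi_pmf W d (\<lambda>_. Q)" and ?p = "measure_pmf.prob Q H"
  let ?\<J> = "{J. J \<subseteq> W \<and> card J < k}"
  have q: "measure_pmf.prob Q (- H) = 1 - ?p"
    using measure_pmf.prob_compl[of H Q] by (simp add: Compl_eq_Diff_UNIV)
  have "{f. card {w \<in> W. f w \<in> H} < k} = (\<Union>J\<in>?\<J>. {f. {w \<in> W. f w \<in> H} = J})" by auto
  then have "measure_pmf.prob ?M {f. card {w \<in> W. f w \<in> H} < k} =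
      (\<Sum>J\<in>?\<J>. measure_pmf.prob ?M {f. {w \<in> W. f w \<in> H} = J})"
    using W by (simp only:, intro measure_pmf.finite_measure_finite_Union) (auto simp: disjoint_family_on_def)
  also have "\<dots> = (\<Sum>J\<in>?\<J>. \<Prod>w\<in>W. if w \<in> J then ?p else 1 - ?p)"
  proof (rule sum.cong[OF refl])
    fix J assume "J \<in> ?\<J>"
    then have "{f. {w \<in> W. f w \<in> H} = J} = Pi W (\<lambda>w. if w \<in> J then H else - H)"
      by (auto simp: Pi_def)
    then have "measure_pmf.prob ?M {f. {w \<in> W. f w \<in> H} = J} =
        (\<Prod>w\<in>W. measure_pmf.prob Q (if w \<in> J then H else - H))"
      using measure_Pi_pmf_Pi[OF W, of d "\<lambda>_. Q" "\<lambda>w. if w \<in> J then H else - H"] by simp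
    also have "\<dots> = (\<Prod>w\<in>W. if w \<in> J then ?p else 1 - ?p)"
      using q by (intro prod.cong) auto
    finally show "measure_pmf.prob ?M {f. {w \<in> W. f w \<in> H} = J} = (\<Prod>w\<in>W. if w \<in> J then ?p else 1 - ?p)" .
  qed
  also have "\<dots> = binomial_lower_tail (card W) k ?p"
    unfolding binomial_lower_tail_def by (rule sum_prod_if_mem[OF W])
  finally show ?thesis .
qed

text \<open>Expansion over the exact sets J1 and J2 of nodes that hit H1 and H2. The weights r need
  not be probabilities: it suffices that C times their product dominates each of the four joint
  cells, and the price is one factor C per node.\<close>

lemma prob_two_cards_less_le:
  fixes r :: "bool \<Rightarrow> real" and W :: "'a set"
  assumes W: "finite W" and C: "C \<ge> 0" and r: "\<And>b. r b \<ge> 0"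
    and cell: "\<And>b1 b2. measure_pmf.prob Q {s. (s \<in> H1 \<longleftrightarrow> b1) \<and> (s \<in> H2 \<longleftrightarrow> b2)} \<le> C * (r b1 * r b2)"
  shows "measure_pmf.prob (Pi_pmf W d (\<lambda>_. Q))
           {f. card {w \<in> W. f w \<in> H1} < k \<and> card {w \<in> W. f w \<in> H2} < k} \<le>
         C ^ card W * (\<Sum>j<k. real (card W choose j) * (r True ^ j * r False ^ (card W - j)))\<^sup>2"
proof -
  let ?M = "Pi_pmf W d (\<lambda>_. Q)"
  let ?\<J> = "{J. J \<subseteq> W \<and> card J < k}"
  let ?E = "\<lambda>J1 J2. {f. {w \<in> W. f w \<in> H1} = J1 \<and> {w \<in> W. f w \<in> H2} = J2}"
  have fin: "finite ?\<J>" using W by simp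
  have "{f. card {w \<in> W. f w \<in> H1} < k \<and> card {w \<in> W. f w \<in> H2} < k} =
      (\<Union>(J1, J2)\<in>?\<J> \<times> ?\<J>. ?E J1 J2)" by auto
  then have "measure_pmf.prob ?M {f. card {w \<in> W. f w \<in> H1} < k \<and> card {w \<in> W. f w \<in> H2} < k} \<le>
      (\<Sum>(J1, J2)\<in>?\<J> \<times> ?\<J>. measure_pmf.prob ?M (?E J1 J2))"
    using fin measure_pmf.finite_measure_subadditive_finite[of "?\<J> \<times> ?\<J>" "\<lambda>(J1, J2). ?E J1 J2" ?M]
    by (simp add: case_prod_beta)
  also have "\<dots> \<le> (\<Sum>(J1, J2)\<in>?\<J> \<times> ?\<J>.
      C ^ card W * ((\<Prod>w\<in>W. if w \<in> J1 then r True else r False) * (\<Prod>w\<in>W. if w \<in> J2 then r True else r False)))"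
  proof (rule sum_mono, clarify)
    fix J1 J2 assume J: "J1 \<subseteq> W" "J2 \<subseteq> W"
    let ?B = "\<lambda>w. {s. (s \<in> H1 \<longleftrightarrow> w \<in> J1) \<and> (s \<in> H2 \<longleftrightarrow> w \<in> J2)}"
    have "?E J1 J2 = Pi W ?B" using J by (auto simp: Pi_def)
    then have "measure_pmf.prob ?M (?E J1 J2) = (\<Prod>w\<in>W. measure_pmf.prob Q (?B w))"
      using measure_Pi_pmf_Pi[OF W, of d "\<lambda>_. Q" ?B] by simp
    also have "\<dots> \<le> (\<Prod>w\<in>W. C * (r (w \<in> J1) * r (w \<in> J2)))"
      using cell by (intro prod_mono) auto
    also have "\<dots> = C ^ card W * ((\<Prod>w\<in>W. r (w \<in> J1)) * (\<Prod>w\<in>W. r (w \<in> J2)))"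
      by (simp add: prod.distrib)
    also have "(\<lambda>w. r (w \<in> J1)) = (\<lambda>w. if w \<in> J1 then r True else r False)" by auto
    also have "(\<lambda>w. r (w \<in> J2)) = (\<lambda>w. if w \<in> J2 then r True else r False)" by auto
    finally show "measure_pmf.prob ?M (?E J1 J2) \<le> C ^ card W *
        ((\<Prod>w\<in>W. if w \<in> J1 then r True else r False) * (\<Prod>w\<in>W. if w \<in> J2 then r True else r False))" .
  qed
  also have "\<dots> = C ^ card W * (\<Sum>J\<in>?\<J>. \<Prod>w\<in>W. if w \<in> J then r True else r False)\<^sup>2"
  proof -
    have "(\<Sum>J\<in>?\<J>. g J)\<^sup>2 = (\<Sum>(J1, J2)\<in>?\<J> \<times> ?\<J>. g J1 * g J2)" for g :: "'a set \<Rightarrow> real"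
      unfolding power2_eq_square sum_product sum.cartesian_product ..
    then show ?thesis by (simp only: sum_distrib_left case_prod_unfold)
  qed
  also have "(\<Sum>J\<in>?\<J>. \<Prod>w\<in>W. if w \<in> J then r True else r False) =
      (\<Sum>j<k. real (card W choose j) * (r True ^ j * r False ^ (card W - j)))"
    by (rule sum_prod_if_mem[OF W])
  finally show ?thesis .
qed

text \<open>One more trial that fails, which has probability 1 - p, keeps the number of successes
  below k. This compares the tails for n - 2 and n - 1 other nodes.\<close>

lemma binomial_lower_tail_Suc_ge:
  assumes "0 \<le> p" "p \<le> 1"
  shows "(1 - p) * binomial_lower_tail N k p \<le> binomial_lower_tail (Suc N) k p"
  unfolding binomial_lower_tail_def sum_distrib_left
proof (rule sum_mono)
  fix j
  show "(1 - p) * (real (N choose j) * (p ^ j * (1 - p) ^ (N - j))) \<le>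
      real (Suc N choose j) * (p ^ j * (1 - p) ^ (Suc N - j))"
  proof (cases "j \<le> N")
    case True
    have "(1 - p) * (real (N choose j) * (p ^ j * (1 - p) ^ (N - j))) =
        real (N choose j) * (p ^ j * (1 - p) ^ (Suc N - j))"
      using True by (simp add: Suc_diff_le)
    also have "\<dots> \<le> real (Suc N choose j) * (p ^ j * (1 - p) ^ (Suc N - j))"
    proof (rule mult_right_mono)
      have "N choose j \<le> Suc N choose j" by (cases j) auto
      then show "real (N choose j) \<le> real (Suc N choose j)" by (simp only: of_nat_le_iff)
    qed (use assms in simp)
    finally show ?thesis .
  next
    case False
    then show ?thesis using assms by (simp add: binomial_eq_0)
  qed
qed

lemma binomial_lower_tail_ge_power:
  assumes "0 \<le> p" "p \<le> 1" "1 \<le> k"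
  shows "(1 - p) ^ N \<le> binomial_lower_tail N k p"
proof -
  have "(\<Sum>j\<in>{0}. real (N choose j) * (p ^ j * (1 - p) ^ (N - j))) \<le> binomial_lower_tail N k p"
    unfolding binomial_lower_tail_def using assms by (intro sum_mono2) auto
  then show ?thesis by simp
qed

section \<open>Exponential moments of intersections and the edge probability\<close>

lemma sum_pow_card: "finite A \<Longrightarrow> (\<Sum>B\<in>Pow A. (c::real) ^ card B) = (1 + c) ^ card A"
  using prod_add[of A "\<lambda>_. c" "\<lambda>_. 1"] by (simp add: add.commute)

text \<open>The power expands into the sum of a^|B| over the subsets B of t \<inter> s. Prescribed
  elements are jointly contained with at most the probability of independent elements of density K /
  P, so the expectation is at most (1 + a K / P)^K.\<close>

lemma expectation_power_card_Int_le:
  fixes a :: real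
  assumes fin: "finite \<Omega>" and K: "K \<le> card \<Omega>" and s: "s \<subseteq> \<Omega>" "card s = K" and a: "a \<ge> 0"
  shows "measure_pmf.expectation (ksubset_pmf \<Omega> K) (\<lambda>t. (1 + a) ^ card (t \<inter> s)) \<le>
           exp (a * (real K ^ 2 / real (card \<Omega>)))"
proof -
  let ?Q = "ksubset_pmf \<Omega> K" and ?P = "real (card \<Omega>)"
  have fins: "finite s" using s fin finite_subset by blast
  have fs: "finite (set_pmf ?Q)" using fin by (simp add: set_ksubset_pmf[OF fin K])
  have "(1 + a) ^ card (t \<inter> s) = (\<Sum>B\<in>Pow s. a ^ card B * indicator {t. B \<subseteq> t} t)" for t
  proof -
    have "(1 + a) ^ card (t \<inter> s) = (\<Sum>B\<in>Pow (t \<inter> s). a ^ card B)"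
      using fins by (subst sum_pow_card) auto
    also have "\<dots> = (\<Sum>B\<in>Pow (t \<inter> s). a ^ card B * indicator {t. B \<subseteq> t} t)"
      by (intro sum.cong) auto
    also have "\<dots> = (\<Sum>B\<in>Pow s. a ^ card B * indicator {t. B \<subseteq> t} t)"
      using fins by (intro sum.mono_neutral_left) (auto simp: indicator_def)
    finally show ?thesis .
  qed
  then have "measure_pmf.expectation ?Q (\<lambda>t. (1 + a) ^ card (t \<inter> s)) =
      (\<Sum>B\<in>Pow s. a ^ card B * measure_pmf.prob ?Q {t. B \<subseteq> t})"
    by (simp add: Bochner_Integration.integral_sum integrable_measure_pmf_finite[OF fs])
  also have "\<dots> \<le> (\<Sum>B\<in>Pow s. a ^ card B * (real K / ?P) ^ card B)"
    using s a by (intro sum_mono mult_left_mono prob_ksubset_contains_le[OF fin K]) auto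
  also have "\<dots> = (\<Sum>B\<in>Pow s. (a * (real K / ?P)) ^ card B)" by (simp only: power_mult_distrib)
  also have "\<dots> = (1 + a * (real K / ?P)) ^ K" using fins s by (simp add: sum_pow_card)
  also have "\<dots> \<le> exp (a * (real K / ?P)) ^ K"
    using a by (intro power_mono) auto
  also have "\<dots> = exp (a * (real K ^ 2 / ?P))"
    by (simp add: power2_eq_square mult_ac flip: exp_of_nat_mult)
  finally show ?thesis .
qed

text \<open>Replaces a^u for u \<ge> 1 by an expression that vanishes at u = 0; the expectation of
  that expression then also reflects how rare overlaps are.\<close>

lemma power_le_power_add_one_diff:
  fixes a :: real
  assumes "a \<ge> 0" "1 \<le> u"
  shows "a ^ u \<le> (1 + a) ^ u - 1"
  using assms(2)
proof (induction u rule: nat_induct_at_least)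
  case (Suc u)
  have "(1 + a) ^ u \<ge> 1" using assms(1) by simp
  moreover have "a * a ^ u \<le> a * ((1 + a) ^ u - 1)" using Suc assms(1) by (intro mult_left_mono) auto
  moreover have "(1 + a) ^ Suc u = (1 + a) ^ u + a * (1 + a) ^ u" by (simp add: algebra_simps)
  ultimately show ?case using assms(1) unfolding right_diff_distrib power_Suc[of a] by linarith
qed simp

text \<open>The edge probability: the quotient is the chance that a random K-subset avoids a fixed
  one.\<close>

definition meet_prob :: "nat \<Rightarrow> nat \<Rightarrow> real" where
  "meet_prob P K = 1 - real ((P - K) choose K) / real (P choose K)"

lemma prob_ksubset_meets:
  assumes "finite \<Omega>" "K \<le> card \<Omega>" "s \<subseteq> \<Omega>" "card s = K"
  shows "measure_pmf.prob (ksubset_pmf \<Omega> K) {S. S \<inter> s \<noteq> {}} = meet_prob (card \<Omega>) K"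
proof -
  have "{S. S \<inter> s \<noteq> {}} = UNIV - {S. S \<inter> s = {}}" by auto
  then have "measure_pmf.prob (ksubset_pmf \<Omega> K) {S. S \<inter> s \<noteq> {}} =
      1 - measure_pmf.prob (ksubset_pmf \<Omega> K) {S. S \<inter> s = {}}"
    using measure_pmf.prob_compl[of "{S. S \<inter> s = {}}" "ksubset_pmf \<Omega> K"] by simp
  then show ?thesis using prob_ksubset_avoids[OF assms(1-3)] assms(4) by (simp add: meet_prob_def)
qed

text \<open>The edge probability equals x up to a relative error x. The upper bound is a union bound
  over the elements of the fixed set; the lower one uses exp (- x) \<le> 1 / (1 + x) \<le> 1 - x +
  x^2 for the avoidance probability.\<close>

lemma meet_prob_bounds:
  assumes K: "K \<le> P"
  defines "x \<equiv> real K ^ 2 / real P"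
  shows "0 \<le> meet_prob P K" "meet_prob P K \<le> 1" "meet_prob P K \<le> x" "x * (1 - x) \<le> meet_prob P K"
proof -
  let ?\<Omega> = "{..<P}" and ?s = "{..<K}"
  have *: "measure_pmf.prob (ksubset_pmf ?\<Omega> K) {S. S \<inter> ?s \<noteq> {}} = meet_prob P K"
    using prob_ksubset_meets[of ?\<Omega> K ?s] K by simp
  show "0 \<le> meet_prob P K" "meet_prob P K \<le> 1" by (auto simp flip: * intro: measure_pmf.prob_le_1)
  show "meet_prob P K \<le> x"
    using prob_ksubset_meets_le[of ?\<Omega> K ?s] K * by (simp add: x_def power2_eq_square)
  have x0: "x \<ge> 0" by (simp add: x_def)
  have "1 - meet_prob P K \<le> exp (- x)"
    using prob_ksubset_avoids_le[of ?\<Omega> K ?s] prob_ksubset_avoids[of ?\<Omega> K ?s] K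
    by (simp add: x_def power2_eq_square meet_prob_def)
  also have "exp (- x) \<le> 1 / (1 + x)"
    using exp_ge_add_one_self[of x] x0 by (simp add: exp_minus field_simps)
  also have "\<dots> \<le> 1 - x + x ^ 2"
  proof -
    have "(1 - x + x ^ 2) * (1 + x) = 1 + x ^ 3" by (simp add: algebra_simps power2_eq_square power3_eq_cube)
    then have "1 \<le> (1 - x + x ^ 2) * (1 + x)" using x0 by simp
    then show ?thesis using x0 by (simp add: divide_le_eq)
  qed
  finally show "x * (1 - x) \<le> meet_prob P K" by (simp add: algebra_simps power2_eq_square)
qed

lemma one_minus_ge_exp:
  fixes x :: real
  assumes "0 \<le> x" "x \<le> 1 / 2"
  shows "exp (- x - 2 * x\<^sup>2) \<le> 1 - x"
proof -
  have "exp (- x - 2 * x\<^sup>2) \<le> exp (ln (1 - x))"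
    using ln_one_minus_pos_lower_bound[OF assms] by simp
  then show ?thesis using assms by simp
qed

section \<open>Degrees of one node and of two nodes\<close>

lemma expectation_pmf_eq_const:
  fixes f :: "'a \<Rightarrow> real"
  assumes "\<And>s. s \<in> set_pmf M \<Longrightarrow> f s = c"
  shows "measure_pmf.expectation M f = c"
proof -
  have "measure_pmf.expectation M f = measure_pmf.expectation M (\<lambda>_. c)"
    using assms by (intro integral_cong_AE) (auto intro: AE_pmfI)
  then show ?thesis by simp
qed

text \<open>Given f v = s, the other nodes meet s independently, and the probability of meeting s is
  the same for every K-subset s. Hence the degree is exactly binomial in spite of the dependence
  between edges.\<close>

lemma prob_low_degree:
  assumes fin: "finite \<Omega>" and K: "K \<le> card \<Omega>" and V: "finite V" "v \<in> V"
  shows "measure_pmf.prob (Pi_pmf V d (\<lambda>_. ksubset_pmf \<Omega> K)) {f. low_degree k V f v} =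
           binomial_lower_tail (card V - 1) k (meet_prob (card \<Omega>) K)"
proof -
  define W where "W = V - {v}"
  have W: "finite W" "v \<notin> W" "V = insert v W" "card W = card V - 1" using V by (auto simp: W_def)
  let ?Q = "ksubset_pmf \<Omega> K"
  have "measure_pmf.prob (Pi_pmf V d (\<lambda>_. ?Q)) {f. low_degree k V f v} =
     measure_pmf.expectation ?Q (\<lambda>s. measure_pmf.prob (Pi_pmf W d (\<lambda>_. ?Q)) {f. f(v := s) \<in> {f. low_degree k V f v}})"
    using prob_Pi_pmf_insert[OF W(1,2), of d "\<lambda>_. ?Q" "{f. low_degree k V f v}"] W(3) by simp
  also have "\<dots> = binomial_lower_tail (card V - 1) k (meet_prob (card \<Omega>) K)"
  proof (rule expectation_pmf_eq_const)
    fix s assume "s \<in> set_pmf ?Q"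
    then have s: "s \<subseteq> \<Omega>" "card s = K" using set_ksubset_pmf[OF fin K] by auto
    have "{w \<in> V - {v}. (f(v := s)) w \<inter> (f(v := s)) v \<noteq> {}} = {w \<in> W. f w \<in> {S. S \<inter> s \<noteq> {}}}" for f
      by (auto simp: W_def)
    then have "{f. f(v := s) \<in> {f. low_degree k V f v}} = {f. card {w \<in> W. f w \<in> {S. S \<inter> s \<noteq> {}}} < k}"
      by (simp only: low_degree_def mem_Collect_eq)
    then show "measure_pmf.prob (Pi_pmf W d (\<lambda>_. ?Q)) {f. f(v := s) \<in> {f. low_degree k V f v}} =
        binomial_lower_tail (card V - 1) k (meet_prob (card \<Omega>) K)"
      using prob_card_less[OF W(1), of d ?Q "{S. S \<inter> s \<noteq> {}}" k] prob_ksubset_meets[OF fin K s] W(4)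
      by (simp only:)
  qed
  finally show ?thesis .
qed

text \<open>Meeting s and meeting t are compared with independent events through the weights \<rho>
  p for a hit and 1 - p for a miss, where \<rho> = 1 / (1 - x). Inflating the hits absorbs the
  discrepancy in the three cells containing a hit, and as fewer than k hits occur for each set, this
  costs at most \<rho>^k twice. Only the cell without hits requires a factor exp (4 x^2) per node,
  which is affordable because n x^2 tends to 0 in the application.\<close>

lemma prob_meet_both_few_disjoint_le:
  assumes fin: "finite \<Omega>" and K: "K \<le> card \<Omega>" and W: "finite W"
    and s: "s \<subseteq> \<Omega>" "card s = K" and t: "t \<subseteq> \<Omega>" "card t = K" and st: "s \<inter> t = {}"
    and x: "x = real K ^ 2 / real (card \<Omega>)" "x \<le> 1 / 2"
  shows "measure_pmf.prob (Pi_pmf W d (\<lambda>_. ksubset_pmf \<Omega> K))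
           {f. card {w \<in> W. f w \<inter> s \<noteq> {}} < k \<and> card {w \<in> W. f w \<inter> t \<noteq> {}} < k} \<le>
         exp (4 * x\<^sup>2 * real (card W)) * (1 / (1 - x)) ^ (2 * k) *
           (binomial_lower_tail (card W) k (meet_prob (card \<Omega>) K))\<^sup>2"
proof -
  let ?Q = "ksubset_pmf \<Omega> K" and ?P = "real (card \<Omega>)" and ?N = "card W"
  let ?H1 = "{S. S \<inter> s \<noteq> {}}" and ?H2 = "{S. S \<inter> t \<noteq> {}}"
  define p \<rho> where "p = meet_prob (card \<Omega>) K" and "\<rho> = 1 / (1 - x)"
  define r where "r b = (if b then \<rho> * p else 1 - p)" for b
  note p = meet_prob_bounds[OF K, folded x(1) p_def]
  have x0: "x \<ge> 0" by (simp add: x)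
  have \<rho>1: "\<rho> \<ge> 1" using x(2) x0 by (simp add: \<rho>_def)
  have fs: "finite s" "finite t" using s t fin finite_subset by auto
  have xp: "x \<le> \<rho> * p" using p(4) x(2) by (simp add: \<rho>_def field_simps)
  have \<rho>q: "1 \<le> \<rho> * (1 - p)" using p(3) x(2) by (simp add: \<rho>_def field_simps)
  have e1: "1 \<le> exp (4 * x\<^sup>2)" by simp
  have H1: "measure_pmf.prob ?Q ?H1 = p" and H2: "measure_pmf.prob ?Q ?H2 = p"
    using prob_ksubset_meets[OF fin K] s t by (auto simp: p_def)
  have TT: "measure_pmf.prob ?Q {S. S \<in> ?H1 \<and> S \<in> ?H2} \<le> x\<^sup>2"
  proof -
    have "{S. S \<in> ?H1 \<and> S \<in> ?H2} = (\<Union>(a, b)\<in>s \<times> t. {S. {a, b} \<subseteq> S})" by auto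
    then have "measure_pmf.prob ?Q {S. S \<in> ?H1 \<and> S \<in> ?H2} \<le>
        (\<Sum>(a, b)\<in>s \<times> t. measure_pmf.prob ?Q {S. {a, b} \<subseteq> S})"
      using fs measure_pmf.finite_measure_subadditive_finite[of "s \<times> t" "\<lambda>(a, b). {S. {a, b} \<subseteq> S}" ?Q]
      by (simp add: case_prod_unfold)
    also have "\<dots> \<le> (\<Sum>(a, b)\<in>s \<times> t. (real K / ?P) ^ 2)"
    proof (rule sum_mono, clarify)
      fix a b assume ab: "a \<in> s" "b \<in> t"
      then have "a \<noteq> b" using st by auto
      then have "card {a, b} = 2" by simp
      then show "measure_pmf.prob ?Q {S. {a, b} \<subseteq> S} \<le> (real K / ?P) ^ 2"
        using prob_ksubset_contains_le[OF fin K, of "{a, b}"] ab s t by auto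
    qed
    also have "\<dots> = x\<^sup>2"
      using s t by (simp add: case_prod_unfold card_cartesian_product x power2_eq_square)
    finally show ?thesis .
  qed
  have FF: "measure_pmf.prob ?Q {S. S \<notin> ?H1 \<and> S \<notin> ?H2} \<le> exp (4 * x\<^sup>2) * ((1 - p) * (1 - p))"
  proof -
    have c: "card (s \<union> t) = 2 * K" using s t st fs by (simp add: card_Un_disjoint)
    have "{S. S \<notin> ?H1 \<and> S \<notin> ?H2} = {S. S \<inter> (s \<union> t) = {}}" by auto
    then have "measure_pmf.prob ?Q {S. S \<notin> ?H1 \<and> S \<notin> ?H2} \<le> exp (- (2 * x))"
      using prob_ksubset_avoids_le[OF fin K, of "s \<union> t"] s t c by (simp add: x power2_eq_square mult.assoc)
    \<comment> \<open>The lower bound exp (- x - 2 x^2) for 1 - p falls short of exp (- x) by exp (-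
      2 x^2); two such factors account for exp (4 x^2).\<close>
    also have "\<dots> = exp (4 * x\<^sup>2) * (exp (- x - 2 * x\<^sup>2) * exp (- x - 2 * x\<^sup>2))"
      by (simp flip: exp_add)
    also have "\<dots> \<le> exp (4 * x\<^sup>2) * ((1 - p) * (1 - p))"
    proof -
      have "exp (- x - 2 * x\<^sup>2) \<le> 1 - p" using one_minus_ge_exp[OF x0 x(2)] p(3) by linarith
      then show ?thesis using p by (intro mult_left_mono mult_mono) auto
    qed
    finally show ?thesis .
  qed
  have pq: "p \<le> exp (4 * x\<^sup>2) * (\<rho> * p * (1 - p))"
  proof -
    have "p * 1 \<le> p * (\<rho> * (1 - p))" using \<rho>q p by (intro mult_left_mono) auto
    also have "\<dots> = 1 * (\<rho> * p * (1 - p))" by simp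
    also have "\<dots> \<le> exp (4 * x\<^sup>2) * (\<rho> * p * (1 - p))"
      using e1 p \<rho>1 by (intro mult_right_mono) auto
    finally show ?thesis by simp
  qed
  have cell: "measure_pmf.prob ?Q {S. (S \<in> ?H1 \<longleftrightarrow> b1) \<and> (S \<in> ?H2 \<longleftrightarrow> b2)} \<le>
      exp (4 * x\<^sup>2) * (r b1 * r b2)" for b1 b2
  proof (cases b1; cases b2)
    assume "b1" "b2"
    moreover have "x\<^sup>2 \<le> exp (4 * x\<^sup>2) * ((\<rho> * p) * (\<rho> * p))"
    proof -
      have "x\<^sup>2 \<le> (\<rho> * p) * (\<rho> * p)" unfolding power2_eq_square using xp x0 by (intro mult_mono) auto
      also have "\<dots> \<le> exp (4 * x\<^sup>2) * ((\<rho> * p) * (\<rho> * p))"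
        using mult_right_mono[OF e1, of "(\<rho> * p) * (\<rho> * p)"] by simp
      finally show ?thesis .
    qed
    ultimately show ?thesis using TT by (simp add: r_def)
  next
    assume b: "b1" "\<not> b2"
    have "measure_pmf.prob ?Q {S. (S \<in> ?H1 \<longleftrightarrow> b1) \<and> (S \<in> ?H2 \<longleftrightarrow> b2)} \<le> measure_pmf.prob ?Q ?H1"
      using b by (intro measure_pmf.finite_measure_mono) auto
    then show ?thesis using b H1 pq by (simp add: r_def)
  next
    assume b: "\<not> b1" "b2"
    have "measure_pmf.prob ?Q {S. (S \<in> ?H1 \<longleftrightarrow> b1) \<and> (S \<in> ?H2 \<longleftrightarrow> b2)} \<le> measure_pmf.prob ?Q ?H2"
      using b by (intro measure_pmf.finite_measure_mono) auto
    then show ?thesis using b H2 pq by (simp add: r_def mult_ac)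
  next
    assume "\<not> b1" "\<not> b2"
    then show ?thesis using FF by (simp add: r_def)
  qed
  have r0: "r b \<ge> 0" for b using p \<rho>1 by (simp add: r_def)
  have "measure_pmf.prob (Pi_pmf W d (\<lambda>_. ?Q))
      {f. card {w \<in> W. f w \<in> ?H1} < k \<and> card {w \<in> W. f w \<in> ?H2} < k} \<le>
      exp (4 * x\<^sup>2) ^ ?N * (\<Sum>j<k. real (?N choose j) * (r True ^ j * r False ^ (?N - j)))\<^sup>2"
    by (rule prob_two_cards_less_le[OF W _ r0 cell]) simp
  also have "\<dots> \<le> exp (4 * x\<^sup>2) ^ ?N * (\<rho> ^ k * binomial_lower_tail ?N k p)\<^sup>2"
  proof (intro mult_left_mono power_mono)
    show "(\<Sum>j<k. real (?N choose j) * (r True ^ j * r False ^ (?N - j))) \<le> \<rho> ^ k * binomial_lower_tail ?N k p"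
      unfolding binomial_lower_tail_def sum_distrib_left
    proof (rule sum_mono)
      fix j assume j: "j \<in> {..<k}"
      have "real (?N choose j) * (r True ^ j * r False ^ (?N - j)) =
          \<rho> ^ j * (real (?N choose j) * (p ^ j * (1 - p) ^ (?N - j)))"
        by (simp add: r_def power_mult_distrib)
      also have "\<dots> \<le> \<rho> ^ k * (real (?N choose j) * (p ^ j * (1 - p) ^ (?N - j)))"
        using j \<rho>1 p by (intro mult_right_mono power_increasing) auto
      finally show "real (?N choose j) * (r True ^ j * r False ^ (?N - j)) \<le>
          \<rho> ^ k * (real (?N choose j) * (p ^ j * (1 - p) ^ (?N - j)))" .
    qed
    show "0 \<le> (\<Sum>j<k. real (?N choose j) * (r True ^ j * r False ^ (?N - j)))"
      using r0 by (intro sum_nonneg mult_nonneg_nonneg zero_le_power) auto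
  qed simp
  also have "\<dots> = exp (4 * x\<^sup>2 * real ?N) * \<rho> ^ (2 * k) * (binomial_lower_tail ?N k p)\<^sup>2"
    by (simp add: power_mult_distrib power_mult[symmetric] mult.commute flip: exp_of_nat_mult)
  finally show ?thesis by (simp add: p_def \<rho>_def)
qed

text \<open>
  This crude bound, which ignores the constraint of \<open>k\<close> for each of \<open>s\<close> and \<open>t\<close>, is only needed for
  overlapping \<open>s\<close> and \<open>t\<close>: two random sets overlap with probability of order \<open>x\<close>, which outweighs
  the polylogarithmic loss.
\<close>

lemma prob_meet_both_few_le:
  assumes fin: "finite \<Omega>" and K: "K \<le> card \<Omega>" "1 \<le> K" and W: "finite W"
    and s: "s \<subseteq> \<Omega>" "card s = K" and t: "t \<subseteq> \<Omega>" "card t = K"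
    and x: "x = real K ^ 2 / real (card \<Omega>)" and N: "N = real (card W)" "N * x \<le> real K"
  shows "measure_pmf.prob (Pi_pmf W d (\<lambda>_. ksubset_pmf \<Omega> K))
           {f. card {w \<in> W. f w \<inter> s \<noteq> {}} < k \<and> card {w \<in> W. f w \<inter> t \<noteq> {}} < k} \<le>
         2 * real k * (1 + 2 * x * N) ^ (2 * k) * exp (- (2 * x * N) + 4 * real k * x) *
           exp 1 ^ card (t \<inter> s)"
proof -
  let ?Q = "ksubset_pmf \<Omega> K" and ?P = "real (card \<Omega>)" and ?H = "{S. S \<inter> (s \<union> t) \<noteq> {}}"
  define u where "u = card (t \<inter> s)"
  define p where "p = measure_pmf.prob ?Q ?H"
  have fs: "finite s" "finite t" using s t fin finite_subset by auto
  have P0: "?P > 0" using K by linarith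
  have x0: "x \<ge> 0" by (simp add: x)
  have K0: "real K > 0" using K by simp
  have cst: "card (s \<union> t) + u = 2 * K"
    using card_Un_Int[OF fs] s t by (simp add: u_def Int_commute)
  have uK: "u \<le> K" using card_mono[OF fs(2), of "t \<inter> s"] t by (simp add: u_def)
  have p01: "0 \<le> p" "p \<le> 1" by (auto simp: p_def)
  have p2: "p \<le> 2 * x"
  proof -
    have "p \<le> real (card (s \<union> t)) * real K / ?P"
      unfolding p_def using s t by (intro prob_ksubset_meets_le[OF fin K(1)]) auto
    also have "\<dots> \<le> real (2 * K) * real K / ?P"
      using cst by (intro divide_right_mono mult_right_mono) auto
    finally show ?thesis by (simp add: x power2_eq_square)
  qed
  \<comment> \<open>The union of s and t has 2 K - u elements, so \<theta> is its avoidance exponent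
    |s \<union> t| K / P.\<close>
  define \<theta> where "\<theta> = 2 * x - real u * x / real K"
  have \<theta>0: "\<theta> \<ge> 0" "\<theta> \<le> 2 * x"
  proof -
    have "real u * x / real K \<le> x" using uK K0 x0 by (simp add: field_simps mult_left_mono)
    then show "\<theta> \<ge> 0" using x0 by (simp add: \<theta>_def)
    show "\<theta> \<le> 2 * x" using x0 by (simp add: \<theta>_def)
  qed
  have q: "1 - p \<le> exp (- \<theta>)"
  proof -
    have "1 - p = measure_pmf.prob ?Q {S. S \<inter> (s \<union> t) = {}}"
    proof -
      have "UNIV - ?H = {S. S \<inter> (s \<union> t) = {}}" by auto
      then show ?thesis using measure_pmf.prob_compl[of ?H ?Q] by (simp add: p_def)
    qed
    also have "\<dots> \<le> exp (- (real (card (s \<union> t)) * real K / ?P))"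
      using s t by (intro prob_ksubset_avoids_le[OF fin K(1)]) auto
    also have "real (card (s \<union> t)) * real K / ?P = \<theta>"
    proof -
      have c: "real (card (s \<union> t)) = 2 * real K - real u" using cst by linarith
      show ?thesis unfolding c using K0 P0 by (simp add: \<theta>_def x field_simps power2_eq_square)
    qed
    finally show ?thesis .
  qed
  have "measure_pmf.prob (Pi_pmf W d (\<lambda>_. ?Q))
      {f. card {w \<in> W. f w \<inter> s \<noteq> {}} < k \<and> card {w \<in> W. f w \<inter> t \<noteq> {}} < k} \<le>
      measure_pmf.prob (Pi_pmf W d (\<lambda>_. ?Q)) {f. card {w \<in> W. f w \<in> ?H} < 2 * k}"
  proof (rule measure_pmf.finite_measure_mono)
    show "{f. card {w \<in> W. f w \<inter> s \<noteq> {}} < k \<and> card {w \<in> W. f w \<inter> t \<noteq> {}} < k} \<subseteq>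
        {f. card {w \<in> W. f w \<in> ?H} < 2 * k}"
    proof clarify
      fix f :: "'b \<Rightarrow> 'a set"
      assume *: "card {w \<in> W. f w \<inter> s \<noteq> {}} < k" "card {w \<in> W. f w \<inter> t \<noteq> {}} < k"
      have "{w \<in> W. f w \<in> ?H} = {w \<in> W. f w \<inter> s \<noteq> {}} \<union> {w \<in> W. f w \<inter> t \<noteq> {}}" by auto
      then have "card {w \<in> W. f w \<in> ?H} \<le> card {w \<in> W. f w \<inter> s \<noteq> {}} + card {w \<in> W. f w \<inter> t \<noteq> {}}"
        by (simp only: card_Un_le)
      then show "card {w \<in> W. f w \<in> ?H} < 2 * k" using * by linarith
    qed
  qed simp
  also have "\<dots> = (\<Sum>j<2 * k. real (card W choose j) * (p ^ j * (1 - p) ^ (card W - j)))"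
    by (simp only: prob_card_less[OF W] binomial_lower_tail_def p_def)
  also have "\<dots> \<le> (\<Sum>j<2 * k. (1 + 2 * x * N) ^ (2 * k) * (exp (- (2 * x * N) + 4 * real k * x) * exp 1 ^ u))"
  proof (rule sum_mono)
    fix j assume "j \<in> {..<2 * k}"
    then have j: "real j \<le> 2 * real k" "j \<le> 2 * k" by auto
    show "real (card W choose j) * (p ^ j * (1 - p) ^ (card W - j)) \<le>
        (1 + 2 * x * N) ^ (2 * k) * (exp (- (2 * x * N) + 4 * real k * x) * exp 1 ^ u)"
    proof (cases "j \<le> card W")
      case True
      have "real (card W choose j) * p ^ j \<le> N ^ j * (2 * x) ^ j"
      proof (rule mult_mono)
        have "real (card W choose j) \<le> real (card W ^ j)"
          using binomial_le_pow[OF True] by (simp only: of_nat_le_iff)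
        then show "real (card W choose j) \<le> N ^ j" by (simp add: N)
        show "p ^ j \<le> (2 * x) ^ j" using p01 p2 by (intro power_mono)
      qed (use p01 N in auto)
      also have "\<dots> = (2 * x * N) ^ j" by (simp add: power_mult_distrib)
      \<comment> \<open>Adding 1 makes the base at least 1, so that the exponent can be raised to 2
        k even if 2 x N is small.\<close>
      also have "\<dots> \<le> (1 + 2 * x * N) ^ j" using x0 N by (intro power_mono) auto
      also have "\<dots> \<le> (1 + 2 * x * N) ^ (2 * k)" using x0 N j by (intro power_increasing) auto
      finally have 1: "real (card W choose j) * p ^ j \<le> (1 + 2 * x * N) ^ (2 * k)" .
      have "(1 - p) ^ (card W - j) \<le> exp (- \<theta>) ^ (card W - j)" using q p01 by (intro power_mono) auto
      also have "\<dots> = exp (- (\<theta> * (N - real j)))"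
        using True by (simp add: N of_nat_diff mult.commute flip: exp_of_nat_mult)
      also have "\<dots> \<le> exp (- (2 * x * N) + 4 * real k * x + real u)"
      proof -
        have "\<theta> * real j \<le> 2 * x * (2 * real k)" using \<theta>0 j by (intro mult_mono) auto
        then have "\<theta> * real j \<le> 4 * real k * x" by (simp add: mult_ac)
        moreover have "\<theta> * N = 2 * x * N - real u * (N * x / real K)" by (simp add: \<theta>_def algebra_simps)
        \<comment> \<open>Because N x \<le> K, every shared object costs at most 1 in the exponent:
          this is the source of the factor exp 1 for each element of t \<inter> s.\<close>
        moreover have "real u * (N * x / real K) \<le> real u * 1"
          using N K0 by (intro mult_left_mono) auto
        moreover have "\<theta> * (N - real j) = \<theta> * N - \<theta> * real j" by (simp add: algebra_simps)
        ultimately have "- (\<theta> * (N - real j)) \<le> - (2 * x * N) + 4 * real k * x + real u" by linarith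
        then show ?thesis by simp
      qed
      also have "\<dots> = exp (- (2 * x * N) + 4 * real k * x) * exp 1 ^ u"
        by (simp add: exp_add flip: exp_of_nat_mult)
      finally have 2: "(1 - p) ^ (card W - j) \<le> exp (- (2 * x * N) + 4 * real k * x) * exp 1 ^ u" .
      have "real (card W choose j) * (p ^ j * (1 - p) ^ (card W - j)) =
          (real (card W choose j) * p ^ j) * (1 - p) ^ (card W - j)" by simp
      also have "\<dots> \<le> (1 + 2 * x * N) ^ (2 * k) * (exp (- (2 * x * N) + 4 * real k * x) * exp 1 ^ u)"
        using p01 x0 N by (intro mult_mono 1 2) auto
      finally show ?thesis .
    next
      case False
      then show ?thesis using x0 N by (simp add: binomial_eq_0)
    qed
  qed
  also have "\<dots> = 2 * real k * (1 + 2 * x * N) ^ (2 * k) * exp (- (2 * x * N) + 4 * real k * x) * exp 1 ^ u"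
    by simp
  finally show ?thesis by (simp add: u_def)
qed

text \<open>The bounds for disjoint and for overlapping s and t merge into one, because (1 + e)^|t
  \<inter> s| - 1 vanishes in the first case and dominates e^|t \<inter> s| in the second. Averaging
  over t turns it into exp (e x) - 1, which is of order x for small x.\<close>

lemma prob_two_low_degree_le:
  fixes \<Omega> :: "'b set" and V :: "'a set"
  assumes fin: "finite \<Omega>" and K: "K \<le> card \<Omega>" "1 \<le> K" and V: "finite V" "u \<in> V" "v \<in> V" "u \<noteq> v"
    and x: "x = real K ^ 2 / real (card \<Omega>)" "x \<le> 1 / 2" and N: "N = real (card V - 2)" "N * x \<le> real K"
  shows "measure_pmf.prob (Pi_pmf V d (\<lambda>_. ksubset_pmf \<Omega> K))
           {f. low_degree k V f u \<and> low_degree k V f v} \<le>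
         exp (4 * x\<^sup>2 * N) * (1 / (1 - x)) ^ (2 * k) *
           (binomial_lower_tail (card V - 2) k (meet_prob (card \<Omega>) K))\<^sup>2 +
         2 * real k * (1 + 2 * x * N) ^ (2 * k) * exp (- (2 * x * N) + 4 * real k * x) *
           (exp (exp 1 * x) - 1)"
    (is "measure_pmf.prob ?M ?E \<le> ?G + ?Z * _")
proof -
  define W where "W = V - {u, v}"
  have W: "finite W" "v \<notin> W" "u \<notin> insert v W" "V = insert u (insert v W)" "finite (insert v W)"
    using V by (auto simp: W_def)
  have cW: "card W = card V - 2" using W(1-4) by simp
  have NW: "N = real (card W)" using N cW by simp
  let ?Q = "ksubset_pmf \<Omega> K"
  let ?A = "\<lambda>s t. {f. card {w \<in> W. f w \<inter> s \<noteq> {}} < k \<and> card {w \<in> W. f w \<inter> t \<noteq> {}} < k}"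
  have x0: "x \<ge> 0" by (simp add: x)
  have G0: "?G \<ge> 0" using x(2) by (intro mult_nonneg_nonneg zero_le_power2 zero_le_power) auto
  have Z0: "?Z \<ge> 0" using x0 N by (intro mult_nonneg_nonneg zero_le_power) auto
  have fsQ: "finite (set_pmf ?Q)" using fin by (simp add: set_ksubset_pmf[OF fin K(1)])
  have A: "measure_pmf.prob (Pi_pmf W d (\<lambda>_. ?Q)) (?A s t) \<le> ?G + ?Z * ((1 + exp 1) ^ card (t \<inter> s) - 1)"
    if s: "s \<subseteq> \<Omega>" "card s = K" and t: "t \<subseteq> \<Omega>" "card t = K" for s t
  proof (cases "t \<inter> s = {}")
    case True
    then have "s \<inter> t = {}" by auto
    from prob_meet_both_few_disjoint_le[OF fin K(1) W(1) s t this x]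
    show ?thesis using True by (simp add: cW NW)
  next
    case False
    have "finite (t \<inter> s)" using t fin finite_subset by blast
    then have "1 \<le> card (t \<inter> s)" using False by (simp add: Suc_le_eq card_gt_0_iff)
    then have "exp 1 ^ card (t \<inter> s) \<le> (1 + exp 1 :: real) ^ card (t \<inter> s) - 1"
      by (intro power_le_power_add_one_diff) auto
    then have "?Z * exp 1 ^ card (t \<inter> s) \<le> ?Z * ((1 + exp 1) ^ card (t \<inter> s) - 1)"
      using Z0 by (rule mult_left_mono)
    then show ?thesis
      using prob_meet_both_few_le[OF fin K W(1) s t x(1) NW N(2), of d k] G0 by linarith
  qed
  have "measure_pmf.prob ?M ?E = measure_pmf.expectation ?Q
      (\<lambda>s. measure_pmf.prob (Pi_pmf (insert v W) d (\<lambda>_. ?Q)) {f. f(u := s) \<in> ?E})"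
    using prob_Pi_pmf_insert[OF W(5,3), of d "\<lambda>_. ?Q" ?E] W(4) by simp
  also have "\<dots> \<le> ?G + ?Z * (exp (exp 1 * x) - 1)"
  proof (rule expectation_pmf_le)
    fix s assume "s \<in> set_pmf ?Q"
    then have s: "s \<subseteq> \<Omega>" "card s = K" using set_ksubset_pmf[OF fin K(1)] by auto
    have "measure_pmf.prob (Pi_pmf (insert v W) d (\<lambda>_. ?Q)) {f. f(u := s) \<in> ?E} =
        measure_pmf.expectation ?Q (\<lambda>t. measure_pmf.prob (Pi_pmf W d (\<lambda>_. ?Q)) {f. f(v := t) \<in> {f. f(u := s) \<in> ?E}})"
      by (rule prob_Pi_pmf_insert[OF W(1,2)])
    also have "\<dots> \<le> measure_pmf.expectation ?Q (\<lambda>t. ?G + ?Z * ((1 + exp 1) ^ card (t \<inter> s) - 1))"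
    proof (rule integral_mono_AE)
      show "AE t in ?Q. measure_pmf.prob (Pi_pmf W d (\<lambda>_. ?Q)) {f. f(v := t) \<in> {f. f(u := s) \<in> ?E}} \<le>
          ?G + ?Z * ((1 + exp 1) ^ card (t \<inter> s) - 1)"
      proof (rule AE_pmfI)
        fix t assume "t \<in> set_pmf ?Q"
        then have t: "t \<subseteq> \<Omega>" "card t = K" using set_ksubset_pmf[OF fin K(1)] by auto
        \<comment> \<open>A possible edge between u and v is ignored: counting only nodes of W
          enlarges the event and expresses both counts through the same independent sets.\<close>
        have "measure_pmf.prob (Pi_pmf W d (\<lambda>_. ?Q)) {f. f(v := t) \<in> {f. f(u := s) \<in> ?E}} \<le>
            measure_pmf.prob (Pi_pmf W d (\<lambda>_. ?Q)) (?A s t)"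
        proof (rule measure_pmf.finite_measure_mono)
          show "{f. f(v := t) \<in> {f. f(u := s) \<in> ?E}} \<subseteq> ?A s t"
          proof
            fix f assume f: "f \<in> {f. f(v := t) \<in> {f. f(u := s) \<in> ?E}}"
            let ?f = "f(v := t, u := s)"
            have lt: "card {w \<in> V - {u}. ?f w \<inter> ?f u \<noteq> {}} < k" "card {w \<in> V - {v}. ?f w \<inter> ?f v \<noteq> {}} < k"
              using f by (simp_all only: mem_Collect_eq low_degree_def)
            have "card {w \<in> W. f w \<inter> s \<noteq> {}} \<le> card {w \<in> V - {u}. ?f w \<inter> ?f u \<noteq> {}}"
              using V by (intro card_mono) (auto simp: W_def)
            moreover have "card {w \<in> W. f w \<inter> t \<noteq> {}} \<le> card {w \<in> V - {v}. ?f w \<inter> ?f v \<noteq> {}}"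
              using V by (intro card_mono) (auto simp: W_def)
            ultimately show "f \<in> ?A s t" using lt by (simp only: mem_Collect_eq) linarith
          qed
        qed simp
        then show "measure_pmf.prob (Pi_pmf W d (\<lambda>_. ?Q)) {f. f(v := t) \<in> {f. f(u := s) \<in> ?E}} \<le>
          ?G + ?Z * ((1 + exp 1) ^ card (t \<inter> s) - 1)" using A[OF s t] by linarith
      qed
    qed (auto intro!: integrable_measure_pmf_finite fsQ)
    also have "\<dots> = ?G + ?Z * (measure_pmf.expectation ?Q (\<lambda>t. (1 + exp 1) ^ card (t \<inter> s)) - 1)"
      by (simp add: integrable_measure_pmf_finite[OF fsQ])
    also have "\<dots> \<le> ?G + ?Z * (exp (exp 1 * x) - 1)"
      using expectation_power_card_Int_le[OF fin K(1) s, of "exp 1"] Z0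
      by (intro add_left_mono mult_left_mono) (auto simp: x)
    finally show "measure_pmf.prob (Pi_pmf (insert v W) d (\<lambda>_. ?Q)) {f. f(u := s) \<in> ?E} \<le>
        ?G + ?Z * (exp (exp 1 * x) - 1)" .
  qed simp
  finally show ?thesis .
qed

subsection \<open>Second moment\<close>

text \<open>Chebyshev's inequality for the number of events that occur: if none occurs, the
  deviation is the full mean. The bound is useful when c is close to b^2.\<close>

lemma prob_none_le_second_moment:
  fixes E :: "'i \<Rightarrow> 'a set" and M :: "'a pmf"
  assumes fs: "finite (set_pmf M)" and I: "finite I" "I \<noteq> {}" and b: "b > 0"
    and E: "\<And>i. i \<in> I \<Longrightarrow> measure_pmf.prob M (E i) = b"
    and pair: "\<And>i j. i \<in> I \<Longrightarrow> j \<in> I \<Longrightarrow> i \<noteq> j \<Longrightarrow> measure_pmf.prob M (E i \<inter> E j) \<le> c" and c: "c \<ge> 0"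
  shows "measure_pmf.prob M {f. \<forall>i\<in>I. f \<notin> E i} \<le> 1 / (real (card I) * b) + (c / b\<^sup>2 - 1)"
proof -
  define X where "X f = (\<Sum>i\<in>I. indicator (E i) f :: real)" for f
  define n where "n = real (card I)"
  have n0: "n > 0" using I by (simp add: n_def card_gt_0_iff)
  have int: "integrable M h" for h :: "_ \<Rightarrow> real" by (rule integrable_measure_pmf_finite[OF fs])
  have EX: "measure_pmf.expectation M X = n * b"
    unfolding X_def using E by (simp add: Bochner_Integration.integral_sum int n_def)
  have "measure_pmf.expectation M (\<lambda>f. (X f)\<^sup>2) = (\<Sum>i\<in>I. \<Sum>j\<in>I. measure_pmf.prob M (E i \<inter> E j))"
  proof -
    have "(X f)\<^sup>2 = (\<Sum>i\<in>I. \<Sum>j\<in>I. indicator (E i \<inter> E j) f)" for f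
      unfolding X_def power2_eq_square sum_product by (simp add: indicator_inter_arith)
    then have "measure_pmf.expectation M (\<lambda>f. (X f)\<^sup>2) =
        measure_pmf.expectation M (\<lambda>f. \<Sum>i\<in>I. \<Sum>j\<in>I. indicator (E i \<inter> E j) f)" by simp
    also have "\<dots> = (\<Sum>i\<in>I. \<Sum>j\<in>I. measure_pmf.expectation M (indicator (E i \<inter> E j)))"
      by (simp only: Bochner_Integration.integral_sum int)
    finally show ?thesis by simp
  qed
  also have "\<dots> \<le> (\<Sum>i\<in>I. b + n * c)"
  proof (rule sum_mono)
    fix i assume i: "i \<in> I"
    have "(\<Sum>j\<in>I. measure_pmf.prob M (E i \<inter> E j)) =
        measure_pmf.prob M (E i \<inter> E i) + (\<Sum>j\<in>I - {i}. measure_pmf.prob M (E i \<inter> E j))"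
      using I(1) i by (rule sum.remove)
    also have "\<dots> \<le> b + (\<Sum>j\<in>I - {i}. c)"
      using E[OF i] pair[OF i] by (intro add_mono sum_mono) auto
    also have "\<dots> \<le> b + n * c"
    proof -
      have "real (card (I - {i})) \<le> n" using I(1) by (simp add: n_def card_Diff1_le)
      then have "real (card (I - {i})) * c \<le> n * c" using c by (rule mult_right_mono)
      then show ?thesis by simp
    qed
    finally show "(\<Sum>j\<in>I. measure_pmf.prob M (E i \<inter> E j)) \<le> b + n * c" .
  qed
  also have "\<dots> = n * b + n\<^sup>2 * c" by (simp add: n_def algebra_simps power2_eq_square)
  finally have EX2: "measure_pmf.expectation M (\<lambda>f. (X f)\<^sup>2) \<le> n * b + n\<^sup>2 * c" .
  have "measure_pmf.prob M {f. \<forall>i\<in>I. f \<notin> E i} \<le>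
      measure_pmf.prob M {f \<in> space (measure_pmf M). \<bar>X f - measure_pmf.expectation M X\<bar> \<ge> n * b}"
  proof (rule measure_pmf.finite_measure_mono)
    show "{f. \<forall>i\<in>I. f \<notin> E i} \<subseteq> {f \<in> space (measure_pmf M). \<bar>X f - measure_pmf.expectation M X\<bar> \<ge> n * b}"
    proof
      fix f assume "f \<in> {f. \<forall>i\<in>I. f \<notin> E i}"
      then have "X f = 0" by (simp add: X_def)
      then show "f \<in> {f \<in> space (measure_pmf M). \<bar>X f - measure_pmf.expectation M X\<bar> \<ge> n * b}"
        using EX by simp
    qed
  qed simp
  also have "\<dots> \<le> measure_pmf.variance M X / (n * b)\<^sup>2"
    using int n0 b by (intro measure_pmf.Chebyshev_inequality) auto
  also have "measure_pmf.variance M X = measure_pmf.expectation M (\<lambda>f. (X f)\<^sup>2) - (n * b)\<^sup>2"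
    using EX by (subst measure_pmf.variance_eq) (auto simp: int)
  also have "(measure_pmf.expectation M (\<lambda>f. (X f)\<^sup>2) - (n * b)\<^sup>2) / (n * b)\<^sup>2 \<le>
      (n * b + n\<^sup>2 * c - (n * b)\<^sup>2) / (n * b)\<^sup>2"
    using EX2 by (intro divide_right_mono) auto
  also have "\<dots> = 1 / (n * b) + (c / b\<^sup>2 - 1)"
    using n0 b by (simp add: field_simps power2_eq_square)
  finally show ?thesis by (simp add: n_def)
qed

lemma prob_k_robust_le:
  assumes K: "1 \<le> K" "K \<le> P" and k: "1 \<le> k" and n: "2 \<le> n"
    and x: "x = real K ^ 2 / real P" "x \<le> 1 / 2" and y: "y = real n * x" "y \<le> real K"
  shows "measure_pmf.prob (uniform_random_intersection_graph n P K) {G. k_robust k G} \<le>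
           1 / (real n * binomial_lower_tail (n - 1) k (meet_prob P K)) +
           (exp (4 * x * y) * (1 / (1 - x)) ^ (2 * k + 2) +
            2 * real k * (1 + 2 * y) ^ (2 * k) * exp (4 * real k * x + 2 * x + 4 * x * y) *
              (exp (exp 1 * x) - 1) - 1)"
proof -
  let ?V = "{1..n}" and ?\<Omega> = "{1..P}"
  let ?M = "Pi_pmf ?V {} (\<lambda>_. ksubset_pmf ?\<Omega> K)"
  define p b T N \<rho> \<delta> where "p = meet_prob P K" and "b = binomial_lower_tail (n - 1) k p"
    and "T = binomial_lower_tail (n - 2) k p" and "N = real (n - 2)" and "\<rho> = 1 / (1 - x)"
    and "\<delta> = exp (exp 1 * x) - 1"
  note p = meet_prob_bounds[OF K(2), folded x(1) p_def]
  have x0: "x \<ge> 0" by (simp add: x)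
  have y0: "y \<ge> 0" using x0 by (simp add: y)
  have Nn: "N + 2 = real n" using n by (simp add: N_def of_nat_diff)
  have N0: "N \<ge> 0" by (simp add: N_def)
  have yN: "y = N * x + 2 * x" unfolding y Nn[symmetric] by (simp add: algebra_simps)
  have Ny: "N * x \<le> y" "x * (N + 1) \<le> y" using x0 by (auto simp: yN algebra_simps)
  have q: "1 - x \<le> 1 - p" using p by simp
  have \<rho>0: "\<rho> > 0" using x(2) by (simp add: \<rho>_def)
  have \<delta>0: "\<delta> \<ge> 0" using x0 by (simp add: \<delta>_def)
  have n1: "n - 1 = Suc (n - 2)" using n by simp
  \<comment> \<open>Isolated nodes alone, that is the term j = 0 of the tail. This crude bound makes
    b positive and normalises the contribution of overlapping sets.\<close>
  have b_ge: "exp (- ((x + 2 * x\<^sup>2) * (N + 1))) \<le> b"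
  proof -
    have "exp (- ((x + 2 * x\<^sup>2) * (N + 1))) = exp (- x - 2 * x\<^sup>2) ^ (n - 1)"
      using n by (simp add: N_def of_nat_diff algebra_simps flip: exp_of_nat_mult)
    also have "\<dots> \<le> (1 - p) ^ (n - 1)"
      using one_minus_ge_exp[OF x0 x(2)] q by (intro power_mono) auto
    also have "\<dots> \<le> b" unfolding b_def using p k by (intro binomial_lower_tail_ge_power) auto
    finally show ?thesis .
  qed
  have b0: "b > 0" using b_ge by (rule less_le_trans[OF exp_gt_zero])
  have T0: "T \<ge> 0" unfolding T_def binomial_lower_tail_def using p by (intro sum_nonneg) auto
  \<comment> \<open>Passing from n - 2 to n - 1 other nodes costs a factor \<rho>; its square raises
    the exponent 2 k to 2 k + 2.\<close>
  have Tb: "T \<le> \<rho> * b"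
  proof -
    have "(1 - x) * T \<le> (1 - p) * T" using q T0 by (rule mult_right_mono)
    also have "\<dots> \<le> b" unfolding T_def b_def n1 using p by (intro binomial_lower_tail_Suc_ge) auto
    finally show ?thesis using x(2) by (simp add: \<rho>_def field_simps)
  qed
  define Z where "Z = 2 * real k * (1 + 2 * x * N) ^ (2 * k) * exp (- (2 * x * N) + 4 * real k * x)"
  define c where "c = exp (4 * x\<^sup>2 * N) * \<rho> ^ (2 * k) * T\<^sup>2 + Z * \<delta>"
  have Z0: "Z \<ge> 0" unfolding Z_def using x0 N0 by (intro mult_nonneg_nonneg zero_le_power) auto
  have c0: "c \<ge> 0" unfolding c_def using Z0 \<delta>0 \<rho>0 by (intro add_nonneg_nonneg mult_nonneg_nonneg) auto
  have card: "card ?\<Omega> = P" "card ?V = n" by simp_all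
  have "measure_pmf.prob (uniform_random_intersection_graph n P K) {G. k_robust k G} \<le>
      measure_pmf.prob ?M {f. \<forall>v\<in>?V. f \<notin> {f. low_degree k ?V f v}}"
    unfolding prob_uniform_random_intersection_graph
  proof (rule measure_pmf.finite_measure_mono)
    show "{f. k_robust k (intersection_graph ?V f)} \<subseteq> {f. \<forall>v\<in>?V. f \<notin> {f :: nat \<Rightarrow> nat set. low_degree k ?V f v}}"
    proof
      fix f :: "nat \<Rightarrow> nat set" assume "f \<in> {f. k_robust k (intersection_graph ?V f)}"
      then have "\<not> low_degree k ?V f v" if "v \<in> ?V" for v
        using k_robust_imp_not_low_degree[of ?V v k f] that n by simp
      then show "f \<in> {f. \<forall>v\<in>?V. f \<notin> {f. low_degree k ?V f v}}" by simp
    qed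
  qed simp
  also have "\<dots> \<le> 1 / (real (card ?V) * b) + (c / b\<^sup>2 - 1)"
  proof (rule prob_none_le_second_moment)
    show "finite (set_pmf ?M)" using K by (intro finite_set_Pi_ksubset) auto
    show "measure_pmf.prob ?M {f. low_degree k ?V f v} = b" if "v \<in> ?V" for v
      using prob_low_degree[of ?\<Omega> K ?V v "{}" k] that K by (simp add: b_def p_def)
    show "measure_pmf.prob ?M ({f. low_degree k ?V f u} \<inter> {f. low_degree k ?V f v}) \<le> c"
      if "u \<in> ?V" "v \<in> ?V" "u \<noteq> v" for u v
    proof -
      have "measure_pmf.prob ?M {f. low_degree k ?V f u \<and> low_degree k ?V f v} \<le> c"
        unfolding c_def Z_def T_def p_def \<rho>_def \<delta>_def
        by (rule prob_two_low_degree_le[where \<Omega> = ?\<Omega> and V = ?V, unfolded card])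
          (use that K x Ny y in \<open>auto simp: N_def\<close>)
      moreover have "{f. low_degree k ?V f u} \<inter> {f. low_degree k ?V f v} =
          {f :: nat \<Rightarrow> nat set. low_degree k ?V f u \<and> low_degree k ?V f v}" by auto
      ultimately show ?thesis by simp
    qed
  qed (use n b0 c0 in auto)
  finally have le: "measure_pmf.prob (uniform_random_intersection_graph n P K) {G. k_robust k G} \<le>
      1 / (real n * b) + (c / b\<^sup>2 - 1)" by simp
  have "c / b\<^sup>2 \<le> exp (4 * x * y) * \<rho> ^ (2 * k + 2) +
      2 * real k * (1 + 2 * y) ^ (2 * k) * exp (4 * real k * x + 2 * x + 4 * x * y) * \<delta>"
  proof -
    have e: "exp (4 * x\<^sup>2 * N) \<le> exp (4 * x * y)"
      using mult_left_mono[OF Ny(1), of x] x0 by (simp add: power2_eq_square mult_ac)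
    have "exp (4 * x\<^sup>2 * N) * \<rho> ^ (2 * k) * T\<^sup>2 \<le> exp (4 * x * y) * \<rho> ^ (2 * k) * (\<rho> * b)\<^sup>2"
      using e Tb T0 \<rho>0 by (intro mult_mono power_mono) auto
    also have "\<dots> = exp (4 * x * y) * \<rho> ^ (2 * k + 2) * b\<^sup>2"
      by (simp add: power_mult_distrib power_add power2_eq_square)
    finally have 1: "exp (4 * x\<^sup>2 * N) * \<rho> ^ (2 * k) * T\<^sup>2 \<le> exp (4 * x * y) * \<rho> ^ (2 * k + 2) * b\<^sup>2" .
    \<comment> \<open>Against the square of the lower bound for b the main part 2 x N of the
      exponent cancels; 2 x + 4 x y covers what is left from N + 1 in place of N and from the
      quadratic term.\<close>
    have "exp (- (2 * x * N) + 4 * real k * x) \<le>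
        exp (4 * real k * x + 2 * x + 4 * x * y) * (exp (- ((x + 2 * x\<^sup>2) * (N + 1))))\<^sup>2"
    proof -
      have "x * (x * (N + 1)) \<le> x * y" using Ny(2) x0 by (rule mult_left_mono)
      then have "- (2 * x * N) + 4 * real k * x \<le>
          4 * real k * x + 2 * x + 4 * x * y + 2 * (- ((x + 2 * x\<^sup>2) * (N + 1)))"
        by (simp add: algebra_simps power2_eq_square)
      then show ?thesis by (simp flip: exp_double exp_add)
    qed
    also have "\<dots> \<le> exp (4 * real k * x + 2 * x + 4 * x * y) * b\<^sup>2"
      using b_ge by (intro mult_left_mono power_mono) auto
    finally have e2: "exp (- (2 * x * N) + 4 * real k * x) \<le> exp (4 * real k * x + 2 * x + 4 * x * y) * b\<^sup>2" .
    have "Z * \<delta> \<le> 2 * real k * (1 + 2 * y) ^ (2 * k) * (exp (4 * real k * x + 2 * x + 4 * x * y) * b\<^sup>2) * \<delta>"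
      unfolding Z_def using Ny x0 y0 N0 \<delta>0 by (intro mult_mono power_mono e2) (auto simp: mult_ac)
    then have "c \<le> (exp (4 * x * y) * \<rho> ^ (2 * k + 2) +
      2 * real k * (1 + 2 * y) ^ (2 * k) * exp (4 * real k * x + 2 * x + 4 * x * y) * \<delta>) * b\<^sup>2"
      using 1 unfolding c_def by (simp add: algebra_simps)
    then show ?thesis using b0 by (simp add: divide_le_eq)
  qed
  then show ?thesis using le unfolding b_def p_def \<rho>_def \<delta>_def by linarith
qed

text \<open>The term k - 1 of the tail is only useful if n p is not too small, hence two regimes.
  For y \<le> L / 2 the term 0 alone makes n b at least exp (L / 2 - 1). Otherwise n p is at least
  of order ln n, and the term k - 1 makes n b at least a constant times exp (- \<alpha>).\<close>

lemma inverse_expected_low_degree_le: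
  fixes \<alpha> L x y :: real
  assumes K: "1 \<le> K" "K \<le> P" and k: "1 \<le> k" and n: "2 \<le> n" "k \<le> n" and L: "L = ln (real n)" "1 \<le> L"
    and x: "x = real K ^ 2 / real P" "x \<le> 1 / 2" and y: "y = real n * x" "2 * x * y \<le> 1"
    and \<alpha>: "y = L + (real k - 1) * ln L + \<alpha>"
  shows "1 / (real n * binomial_lower_tail (n - 1) k (meet_prob P K)) \<le>
           exp (1 - L / 2) + exp 1 * (8 * real (k - 1)) ^ (k - 1) * exp \<alpha>"
proof -
  define p b where "p = meet_prob P K" and "b = binomial_lower_tail (n - 1) k p"
  note p = meet_prob_bounds[OF K(2), folded x(1) p_def]
  have x0: "x \<ge> 0" by (simp add: x)
  have n0: "real n > 0" using n by simp
  have E: "exp L = real n" using L n0 by simp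
  have q: "exp (- y - 1) \<le> (1 - p) ^ n"
  proof -
    have "- y - 1 \<le> real n * (- x - 2 * x\<^sup>2)"
      using y by (simp add: algebra_simps power2_eq_square)
    then have "exp (- y - 1) \<le> exp (real n * (- x - 2 * x\<^sup>2))" by simp
    also have "\<dots> = exp (- x - 2 * x\<^sup>2) ^ n" by (rule exp_of_nat_mult)
    also have "\<dots> \<le> (1 - p) ^ n"
      using one_minus_ge_exp[OF x0 x(2)] p by (intro power_mono) auto
    finally show ?thesis .
  qed
  have qj: "exp (- y - 1) \<le> (1 - p) ^ j" if "j \<le> n" for j
    using q power_decreasing[OF that, of "1 - p"] p by linarith
  have b0: "b > 0"
    using qj[of "n - 1"] binomial_lower_tail_ge_power[OF p(1,2) k, of "n - 1"] exp_gt_zero[of "- y - 1"]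
    unfolding b_def by linarith
  have "1 / (real n * b) \<le> exp (1 - L / 2) + exp 1 * (8 * real (k - 1)) ^ (k - 1) * exp \<alpha>"
  proof (cases "y \<le> L / 2")
    case True
    have "exp (L / 2 - 1) = exp L * exp (- (L / 2) - 1)" by (simp flip: exp_add)
    also have "\<dots> \<le> real n * b"
    proof -
      have "exp (- (L / 2) - 1) \<le> exp (- y - 1)" using True by simp
      also have "\<dots> \<le> b"
        using qj[of "n - 1"] binomial_lower_tail_ge_power[OF p(1,2) k, of "n - 1"] unfolding b_def by linarith
      finally show ?thesis using E n0 by simp
    qed
    finally have "1 / (real n * b) \<le> 1 / exp (L / 2 - 1)" using n0 b0 by (intro divide_left_mono mult_pos_pos) auto
    also have "\<dots> = exp (1 - L / 2)" by (simp add: exp_diff)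
    also have "\<dots> \<le> exp (1 - L / 2) + exp 1 * (8 * real (k - 1)) ^ (k - 1) * exp \<alpha>" by simp
    finally show ?thesis .
  next
    case False
    define j where "j = k - 1"
    have jn: "j \<le> n - 1" and jk: "j < k" and jr: "real j = real k - 1"
      using n k by (auto simp: j_def of_nat_diff)
    have "(L / 8) ^ j * exp (- y - 1) \<le> real j ^ j * (real (n - 1 choose j) * (p ^ j * (1 - p) ^ (n - 1 - j)))"
    proof -
      \<comment> \<open>Three halvings: n - 1 is at least n / 2, p is at least x / 2, and y exceeds
        L / 2.\<close>
      have "L / 8 \<le> real (n - 1) * p"
      proof -
        have "x * (1 / 2) \<le> x * (1 - x)" using x0 x(2) by (intro mult_left_mono) auto
        then have "x / 2 \<le> p" using p(4) by simp
        moreover have "real n / 2 \<le> real (n - 1)" using n by (simp add: of_nat_diff)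
        ultimately have "real n / 2 * (x / 2) \<le> real (n - 1) * p" using x0 by (intro mult_mono) auto
        moreover have "real n / 2 * (x / 2) = y / 4" by (simp add: y)
        ultimately show ?thesis using False by linarith
      qed
      then have "(L / 8) ^ j \<le> (real (n - 1) * p) ^ j" by (rule power_mono) (use L(2) in simp)
      \<comment> \<open>For k = 1 the division by j = 0 does no harm: all exponents are 0 and 0^0 =
        1.\<close>
      also have "\<dots> = real j ^ j * (real (n - 1) / real j) ^ j * p ^ j"
        by (cases "j = 0") (auto simp: power_divide power_mult_distrib)
      also have "\<dots> \<le> real j ^ j * real (n - 1 choose j) * p ^ j"
        using p binomial_ge_n_over_k_pow_k[OF jn, where 'a = real]
        by (intro mult_right_mono mult_left_mono) auto
      finally have "(L / 8) ^ j * exp (- y - 1) \<le>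
          (real j ^ j * real (n - 1 choose j) * p ^ j) * (1 - p) ^ (n - 1 - j)"
        using p L(2) jn by (intro mult_mono qj) auto
      then show ?thesis by (simp add: mult.assoc)
    qed
    also have "\<dots> \<le> real j ^ j * b"
    proof (rule mult_left_mono)
      have "(\<Sum>i\<in>{j}. real (n - 1 choose i) * (p ^ i * (1 - p) ^ (n - 1 - i))) \<le> b"
        unfolding b_def binomial_lower_tail_def using p jk by (intro sum_mono2) auto
      then show "real (n - 1 choose j) * (p ^ j * (1 - p) ^ (n - 1 - j)) \<le> b" by simp
    qed simp
    finally have main: "(L / 8) ^ j * exp (- y - 1) \<le> real j ^ j * b" .
    \<comment> \<open>The summand (k - 1) ln L of y produces the L^j that cancels against (L /
      8)^j.\<close>
    have "exp (- y - 1) = exp (- \<alpha>) / (exp 1 * real n * L ^ j)"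
    proof -
      have "exp ((real k - 1) * ln L) = L ^ j"
        using L(2) exp_of_nat_mult[of j "ln L"] by (simp add: jr)
      then have "exp y = real n * L ^ j * exp \<alpha>" by (simp add: \<alpha> exp_add E)
      then show ?thesis by (simp add: exp_diff exp_minus field_simps)
    qed
    then have "(L / 8) ^ j * exp (- y - 1) = exp (- \<alpha>) / (8 ^ j * exp 1 * real n)"
      using L(2) n0 by (simp add: power_divide field_simps)
    with main have "exp (- \<alpha>) / (8 ^ j * exp 1 * real n) \<le> real j ^ j * b" by simp
    then have "1 \<le> exp 1 * (8 * real j) ^ j * exp \<alpha> * (real n * b)"
      using n0 by (simp add: field_simps exp_minus power_mult_distrib)
    then have "1 / (real n * b) \<le> exp 1 * (8 * real j) ^ j * exp \<alpha>"
      using n0 b0 by (simp add: divide_le_eq)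
    then show ?thesis by (simp add: j_def add_increasing)
  qed
  then show ?thesis by (simp add: b_def p_def)
qed

section \<open>Convergence to 0\<close>

lemma prob_k_robust_tendsto_0:
  fixes k :: nat and P K :: "nat \<Rightarrow> nat" and \<alpha> :: "nat \<Rightarrow> real"
  assumes k: "k \<ge> 1"
    and KP: "\<And>n. n \<ge> 1 \<Longrightarrow> 1 \<le> K n \<and> K n \<le> P n"
    and xn: "\<And>n. n \<ge> 2 \<Longrightarrow> (real (K n))\<^sup>2 / real (P n) =
             (ln (real n) + (real k - 1) * ln (ln (real n)) + \<alpha> n) / real n"
    and c: "c > 0" and K: "eventually (\<lambda>n. c * ln (real n) ^ 3 \<le> real (K n)) sequentially"
    and \<alpha>: "filterlim \<alpha> at_bot sequentially"
  shows "(\<lambda>n. measure_pmf.prob (uniform_random_intersection_graph n (P n) (K n)) {G. k_robust k G}) \<longlonglongrightarrow> 0"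
proof -
  define x where "x n = (real (K n))\<^sup>2 / real (P n)" for n
  define y where "y n = real n * x n" for n
  define L where "L n = ln (real n)" for n
  have x0: "x n \<ge> 0" for n by (simp add: x_def)
  have y0: "y n \<ge> 0" for n using x0 by (simp add: y_def)
  have yn: "y n = L n + (real k - 1) * ln (L n) + \<alpha> n" if "n \<ge> 2" for n
    using xn[OF that] that by (simp add: y_def x_def L_def)
  have l1: "eventually (\<lambda>n. exp 1 \<le> real n) sequentially" by real_asymp
  have "filterlim (\<lambda>n. ln (real n) - (real k - 1) * ln (ln (real n))) at_top sequentially"
    by real_asymp
  then have g: "eventually (\<lambda>n. 0 \<le> ln (real n) - (real k - 1) * ln (ln (real n))) sequentially"
    by (rule filterlim_at_top[THEN iffD1, rule_format])
  have \<alpha>neg: "eventually (\<lambda>n. \<alpha> n \<le> 0) sequentially" using \<alpha> by (simp add: filterlim_at_bot)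
  \<comment> \<open>Since \<alpha> is eventually nonpositive, y is at most 2 ln n and x is of order
    at most ln n / n.\<close>
  have base: "eventually (\<lambda>n. 1 \<le> L n \<and> y n \<le> 2 * L n \<and> 2 \<le> n) sequentially"
    using l1 g \<alpha>neg eventually_ge_at_top[of 2]
  proof eventually_elim
    case (elim n)
    have "1 \<le> ln (real n)" using elim by (simp add: ln_ge_iff)
    then show ?case using elim(2-4) yn[OF elim(4)] unfolding L_def by linarith
  qed
  have xL: "eventually (\<lambda>n. x n \<le> 2 * (ln (real n) / real n)) sequentially"
    using base by eventually_elim (auto simp: y_def L_def field_simps)
  have xlim: "x \<longlonglongrightarrow> 0"
  proof (rule tendsto_sandwich[OF _ xL tendsto_const])
    show "(\<lambda>n. 2 * (ln (real n) / real n)) \<longlonglongrightarrow> 0" by real_asymp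
  qed (simp add: x0)
  have xylim: "(\<lambda>n. x n * y n) \<longlonglongrightarrow> 0"
  proof (rule tendsto_sandwich[OF _ _ tendsto_const])
    show "eventually (\<lambda>n. x n * y n \<le> 4 * (ln (real n) ^ 2 / real n)) sequentially"
      using base xL
    proof eventually_elim
      case (elim n)
      have "x n * y n \<le> 2 * (ln (real n) / real n) * (2 * L n)"
        using elim x0[of n] y0[of n] by (intro mult_mono) (auto simp: L_def)
      then show ?case by (simp add: L_def power2_eq_square)
    qed
    show "(\<lambda>n. 4 * (ln (real n) ^ 2 / real n)) \<longlonglongrightarrow> 0" by real_asymp
  qed (simp add: x0 y0)
  \<comment> \<open>The three errors of the second moment bound: \<open>U1\<close> controls the
    inverse of the expected number of low-degree nodes, \<open>U2\<close> the deviation from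
    independence for disjoint sets, and \<open>U3\<close> the overlapping sets.\<close>
  define U1 U2 U3 where
    "U1 n = exp (1 - L n / 2) + exp 1 * (8 * real (k - 1)) ^ (k - 1) * exp (\<alpha> n)" and
    "U2 n = exp (4 * (x n * y n)) * (1 / (1 - x n)) ^ (2 * k + 2) - 1" and
    "U3 n = exp (4 * real k * x n + 2 * x n + 4 * (x n * y n)) *
       (2 * real k * (1 + 2 * y n) ^ (2 * k) * (exp (exp 1 * x n) - 1))" for n
  have U1: "U1 \<longlonglongrightarrow> 0"
  proof -
    have "(\<lambda>n. exp (1 - L n / 2)) \<longlonglongrightarrow> 0" unfolding L_def by real_asymp
    moreover have "(\<lambda>n. exp (\<alpha> n)) \<longlonglongrightarrow> 0" by (rule filterlim_compose[OF exp_at_bot \<alpha>])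
    ultimately show ?thesis
      unfolding U1_def by (intro tendsto_add_zero tendsto_mult_right_zero)
  qed
  have U2: "U2 \<longlonglongrightarrow> 0"
  proof -
    have "U2 \<longlonglongrightarrow> exp (4 * 0) * (1 / (1 - 0)) ^ (2 * k + 2) - 1"
      unfolding U2_def by (intro tendsto_intros xlim xylim) auto
    then show ?thesis by simp
  qed
  have U3: "U3 \<longlonglongrightarrow> 0"
  proof -
    have e: "(\<lambda>n. exp (4 * real k * x n + 2 * x n + 4 * (x n * y n))) \<longlonglongrightarrow> exp (4 * real k * 0 + 2 * 0 + 4 * 0)"
      by (intro tendsto_intros xlim xylim)
    have Llim: "filterlim (\<lambda>n. ln (real n)) at_top sequentially" by real_asymp
    \<comment> \<open>The factor exp (e x) - 1 is of order at most ln n / n, which beats the power 2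
      k of y; with n written as exp (ln n), the comparison is the limit of t^(2k+1) / exp t.\<close>
    have "(\<lambda>n. ln (real n) ^ Suc (2 * k) / exp (ln (real n))) \<longlonglongrightarrow> 0"
      using filterlim_compose[OF tendsto_power_div_exp_0 Llim] .
    then have bd: "(\<lambda>n. 2 * real k * 5 ^ (2 * k) * (4 * exp 1) * (ln (real n) ^ Suc (2 * k) / exp (ln (real n)))) \<longlonglongrightarrow> 0"
      by (rule tendsto_mult_right_zero)
    have small: "eventually (\<lambda>n. x n < 1 / (2 * exp 1)) sequentially"
      using order_tendstoD(2)[OF xlim, of "1 / (2 * exp 1)"] by simp
    have "(\<lambda>n. 2 * real k * (1 + 2 * y n) ^ (2 * k) * (exp (exp 1 * x n) - 1)) \<longlonglongrightarrow> 0"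
    proof (rule tendsto_sandwich[OF _ _ tendsto_const bd])
      show "eventually (\<lambda>n. 0 \<le> 2 * real k * (1 + 2 * y n) ^ (2 * k) * (exp (exp 1 * x n) - 1)) sequentially"
        using x0 y0 by (intro always_eventually allI mult_nonneg_nonneg) auto
      show "eventually (\<lambda>n. 2 * real k * (1 + 2 * y n) ^ (2 * k) * (exp (exp 1 * x n) - 1) \<le>
          2 * real k * 5 ^ (2 * k) * (4 * exp 1) * (ln (real n) ^ Suc (2 * k) / exp (ln (real n)))) sequentially"
        using small base xL
      proof eventually_elim
        case (elim n)
        have ex: "exp 1 * x n \<le> 1 / 2" using elim(1) by (simp add: field_simps)
        have "exp (exp 1 * x n) \<le> 1 + 2 * (exp 1 * x n)"
          using x0[of n] ex by (intro real_exp_bound_lemma) auto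
        also have "2 * (exp 1 * x n) \<le> 2 * (exp 1 * (2 * (L n / real n)))"
          using elim by (intro mult_left_mono) (auto simp: L_def)
        finally have d: "exp (exp 1 * x n) - 1 \<le> 4 * exp 1 * (L n / real n)" by simp
        have "(1 + 2 * y n) ^ (2 * k) \<le> (5 * L n) ^ (2 * k)"
          using elim y0[of n] by (intro power_mono) auto
        then have "2 * real k * (1 + 2 * y n) ^ (2 * k) * (exp (exp 1 * x n) - 1) \<le>
            2 * real k * (5 * L n) ^ (2 * k) * (4 * exp 1 * (L n / real n))"
          using d elim x0[of n] y0[of n] by (intro mult_mono) auto
        also have "\<dots> = 2 * real k * 5 ^ (2 * k) * (4 * exp 1) * (L n ^ Suc (2 * k) / real n)"
          by (simp add: power_mult_distrib)
        finally show ?case using elim by (simp add: L_def)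
      qed
    qed
    from tendsto_mult[OF e this] show ?thesis unfolding U3_def by simp
  qed
  \<comment> \<open>The growth of K gives K \<ge> 2 ln n \<ge> y eventually, the condition under
    which an overlap costs only a factor e per shared object.\<close>
  have "filterlim (\<lambda>n. c * ln (real n) ^ 3 / (2 * ln (real n))) at_top sequentially"
  proof -
    have "filterlim (\<lambda>n. ln (real n) ^ 3 / (2 * ln (real n))) at_top sequentially" by real_asymp
    from filterlim_tendsto_pos_mult_at_top[OF tendsto_const c this] show ?thesis by simp
  qed
  then have Kbig: "eventually (\<lambda>n. 1 \<le> c * ln (real n) ^ 3 / (2 * ln (real n))) sequentially"
    by (rule filterlim_at_top[THEN iffD1, rule_format])
  have "eventually (\<lambda>n. x n < 1 / 2) sequentially"
    using order_tendstoD(2)[OF xlim, of "1 / 2"] by simp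
  moreover have "eventually (\<lambda>n. x n * y n < 1 / 2) sequentially"
    using order_tendstoD(2)[OF xylim, of "1 / 2"] by simp
  ultimately have ub: "eventually (\<lambda>n. measure_pmf.prob (uniform_random_intersection_graph n (P n) (K n)) {G. k_robust k G} \<le>
      U1 n + U2 n + U3 n) sequentially"
    using base K Kbig eventually_ge_at_top[of k]
  proof eventually_elim
    case (elim n)
    have L1: "1 \<le> L n" and n2: "2 \<le> n" and y2: "y n \<le> 2 * L n" using elim by auto
    have KPn: "1 \<le> K n" "K n \<le> P n" using KP[of n] n2 by auto
    have "2 * L n \<le> c * L n ^ 3" using elim(5) L1 by (simp add: L_def field_simps)
    then have yK: "y n \<le> real (K n)" using y2 elim(4) by (simp add: L_def)
    have x2: "x n \<le> 1 / 2" using elim by simp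
    have xy: "2 * x n * y n \<le> 1" using elim by simp
    have "1 / (real n * binomial_lower_tail (n - 1) k (meet_prob (P n) (K n))) \<le> U1 n"
      unfolding U1_def
      by (rule inverse_expected_low_degree_le[OF KPn k n2 elim(6) L_def L1 x_def x2 y_def xy yn[OF n2]])
    then show ?case
      using prob_k_robust_le[OF KPn k n2 x_def x2 y_def yK] unfolding U2_def U3_def
      by (simp add: mult_ac)
  qed
  have lim: "(\<lambda>n. U1 n + U2 n + U3 n) \<longlonglongrightarrow> 0"
    using tendsto_add[OF tendsto_add[OF U1 U2] U3] by simp
  show ?thesis
    by (rule tendsto_sandwich[OF _ ub tendsto_const lim]) simp
qed

theorem theorem5:
  fixes k :: nat and P K :: "nat \<Rightarrow> nat" and \<alpha> :: "nat \<Rightarrow> real"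
  assumes "k \<ge> 1"
    and "\<And>n. n \<ge> 1 \<Longrightarrow> 1 \<le> K n \<and> K n \<le> P n"
    and "\<And>n. n \<ge> 2 \<Longrightarrow>
           (real (K n))\<^sup>2 / real (P n) =
             (ln (real n) + (real k - 1) * ln (ln (real n)) + \<alpha> n) / real n"
    and "(\<lambda>n. real (K n)) \<in> \<Omega>(\<lambda>n. (ln (real n)) ^ 3)"
  shows "(filterlim \<alpha> at_bot sequentially \<longrightarrow>
            (\<lambda>n. measure_pmf.prob (uniform_random_intersection_graph n (P n) (K n))
                   {G. k_robust k G}) \<longlonglongrightarrow> 0) \<and>
         (filterlim \<alpha> at_top sequentially \<longrightarrow>
            (\<lambda>n. measure_pmf.prob (uniform_random_intersection_graph n (P n) (K n))
                   {G. k_robust k G}) \<longlonglongrightarrow> 1)"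
proof -
  from assms(4) obtain c where c: "c > 0"
    and ev: "eventually (\<lambda>n. norm (real (K n)) \<ge> c * norm (ln (real n) ^ 3)) sequentially"
    by (elim landau_omega.bigE)
  from ev eventually_ge_at_top[of 1]
  have K: "eventually (\<lambda>n. c * ln (real n) ^ 3 \<le> real (K n)) sequentially"
    by eventually_elim simp
  show ?thesis
    using prob_k_robust_tendsto_0[OF assms(1-3) c K] prob_k_robust_tendsto_1[OF assms(1-3) c K] by blast
qed

end
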